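(* Let $Z$ be the solution of the linear stochastic heat equation $\dot Z=\tfrac12Z''+\xi$ on $(0,\infty)\times\mathbb{R}$ with $Z(0,x)=0$ for all $x\in\mathbb{R}$, where $\xi$ is space-time white noise. Let $g(x):=(2\log_+x)^{1/2}$ and, for every $t>0$, let $X_t(x):=(\pi/t)^{1/4}Z(t,x)$, $x\in\mathbb{R}$. For $\gamma>0$ let $$\mathcal{P}_{X_t}(\gamma):=\left\{x\in\mathbb{R}_+:\ x>c_0,\ \frac{|X_t(x)|}{g(x)}>\gamma\right\},$$ where $c_0>0$ is a fixed constant. Then, for every $t>0$, the tall peaks of $X_t$ (with respect to the gauge function $g$) are multifractal with probability one. In fact, for every $t,\gamma>0$, $$\operatorname{Dim}_{\rm H}\left(\mathcal{P}_{X_t}(\gamma)\right)=1-\gamma^{2}\qquad\text{almost surely},$$ where, when the right-hand side is negative, the assertion means that $\mathcal{P}_{X_t}(\gamma)$ is bounded.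
   Context: Solution: $Z(t,x)=\int_{(0,t)\times\mathbb{R}}p_{t-s}(y-x)\,\xi(ds\,dy)$ (Wiener integral), $p_t(x)=(2\pi t)^{-1/2}e^{-x^2/(2t)}$; a version continuous in $(t,x)$ is used. Notation: $\log_+x:=\log(\max\{x,e\})$. Macroscopic (Barlow–Taylor) Hausdorff dimension: in $\mathbb{R}^d$ let $\mathcal{V}_n:=[-e^n,e^n)^d$ for $n\ge0$, $\mathcal{S}_0:=\mathcal{V}_0$, $\mathcal{S}_{n+1}:=\mathcal{V}_{n+1}\setminus\mathcal{V}_n$. An upright box is a set $Q(x,r)=[x_1,x_1+r)\times\cdots\times[x_d,x_d+r)$, $x\in\mathbb{R}^d$, $r>0$; its side is $r$. For $E\subseteq\mathbb{R}^d$, $\rho>0$, let $\nu^n_\rho(E):=\inf\sum_{i=1}^m(\mathrm{side}(Q_i)/e^n)^\rho$, the infimum over all finite covers of $E\cap\mathcal{S}_n$ by upright boxes $Q_1,\dots,Q_m$ of side $\ge1$. Then $\operatorname{Dim}_{\rm H}E:=\inf\{\rho>0:\sum_{n=1}^\infty\nu^n_\rho(E)<\infty\}$. Here $d=1$. Multifractality: the tall peaks of $X_t$ are multifractal if there exist infinitely many length scales $\gamma_1>\gamma_2>\cdots>0$ such that, with probability one, $\operatorname{Dim}_{\rm H}(\mathcal{P}_{X_t}(\gamma_i))<\operatorname{Dim}_{\rm H}(\mathcal{P}_{X_t}(\gamma_{i+1}))$ for all $i\ge1$. *)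

theory Defs
  imports "HOL-Probability.Probability"
begin

definition centered_gaussian :: "'w measure \<Rightarrow> ('w \<Rightarrow> real) \<Rightarrow> bool" where
  "centered_gaussian M Y \<longleftrightarrow>
     Y \<in> borel_measurable M \<and>
     ((AE \<omega> in M. Y \<omega> = 0) \<or>
      (\<exists>\<sigma>>0. distributed M lborel Y (normal_density 0 \<sigma>)))"

text \<open>Points of space-time are pairs (time, space).\<close>

definition spacetime_sets :: "(real \<times> real) set set" where
  "spacetime_sets =
     {A \<in> sets borel. A \<subseteq> {0<..} \<times> UNIV \<and> emeasure lborel A < \<infinity>}"

definition white_noise :: "'w measure \<Rightarrow> ((real \<times> real) set \<Rightarrow> 'w \<Rightarrow> real) \<Rightarrow> bool" where
  "white_noise M \<xi> \<longleftrightarrow>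
     (\<forall>F c. finite F \<and> F \<subseteq> spacetime_sets \<longrightarrow>
        centered_gaussian M (\<lambda>\<omega>. \<Sum>A\<in>F. c A * \<xi> A \<omega>)) \<and>
     (\<forall>A\<in>spacetime_sets. \<forall>B\<in>spacetime_sets.
        (\<integral>\<omega>. \<xi> A \<omega> * \<xi> B \<omega> \<partial>M) = measure lborel (A \<inter> B))"

text \<open>
  The Wiener integral is the \<open>L\<^sup>2\<close>-extension of
  \<open>\<Sum>i. c\<^sub>i * indicator A\<^sub>i \<mapsto> \<Sum>i. c\<^sub>i * \<xi> A\<^sub>i\<close>; it is determined only up to null sets, so it is
  rendered as a relation between integrands and random variables. By the isometry property the
  choice of the approximating sequence is immaterial.
\<close>

definition wiener_integral ::
  "'w measure \<Rightarrow> ((real \<times> real) set \<Rightarrow> 'w \<Rightarrow> real) \<Rightarrow> (real \<times> real \<Rightarrow> real) \<Rightarrow> ('w \<Rightarrow> real) \<Rightarrow> bool"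
where
  "wiener_integral M \<xi> f Y \<longleftrightarrow>
     f \<in> borel_measurable borel \<and> Y \<in> borel_measurable M \<and>
     (\<exists>\<phi> :: nat \<Rightarrow> (real \<times> (real \<times> real) set) list.
        (\<forall>n. \<forall>(c, A)\<in>set (\<phi> n). A \<in> spacetime_sets) \<and>
        (\<lambda>n. \<integral>\<^sup>+z. ennreal (((\<Sum>(c, A)\<leftarrow>\<phi> n. c * indicator A z) - f z)\<^sup>2) \<partial>lborel)
          \<longlonglongrightarrow> 0 \<and>
        (\<lambda>n. \<integral>\<^sup>+\<omega>. ennreal (((\<Sum>(c, A)\<leftarrow>\<phi> n. c * \<xi> A \<omega>) - Y \<omega>)\<^sup>2) \<partial>M)
          \<longlonglongrightarrow> 0)"

definition heat_kernel :: "real \<Rightarrow> real \<Rightarrow> real" where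
  "heat_kernel t x = (2 * pi * t) powr (- 1 / 2) * exp (- x\<^sup>2 / (2 * t))"

definition linear_SHE_solution ::
  "'w measure \<Rightarrow> ((real \<times> real) set \<Rightarrow> 'w \<Rightarrow> real) \<Rightarrow> (real \<Rightarrow> real \<Rightarrow> 'w \<Rightarrow> real) \<Rightarrow> bool"
where
  "linear_SHE_solution M \<xi> Z \<longleftrightarrow>
     (\<forall>t>0. \<forall>x. wiener_integral M \<xi>
        (\<lambda>(s, y). indicator {0<..<t} s * heat_kernel (t - s) (y - x)) (Z t x)) \<and>
     (AE \<omega> in M. (\<forall>x. Z 0 x \<omega> = 0) \<and>
        continuous_on ({0..} \<times> UNIV) (\<lambda>(t, x). Z t x \<omega>))"

subsection \<open>Macroscopic Hausdorff dimension\<close>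

text \<open>For \<open>'a = real\<close> the only basis vector is 1, and boxes are half-open intervals.\<close>

definition macro_cube :: "nat \<Rightarrow> 'a::euclidean_space set" where
  "macro_cube n = {x. \<forall>b\<in>Basis. - exp (real n) \<le> x \<bullet> b \<and> x \<bullet> b < exp (real n)}"

fun macro_shell :: "nat \<Rightarrow> 'a::euclidean_space set" where
  "macro_shell 0 = macro_cube 0"
| "macro_shell (Suc n) = macro_cube (Suc n) - macro_cube n"

definition upright_box :: "'a::euclidean_space \<Rightarrow> real \<Rightarrow> 'a set" where
  "upright_box x r = {y. \<forall>b\<in>Basis. x \<bullet> b \<le> y \<bullet> b \<and> y \<bullet> b < x \<bullet> b + r}"

definition macro_content :: "real \<Rightarrow> nat \<Rightarrow> 'a::euclidean_space set \<Rightarrow> ennreal" where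
  "macro_content \<rho> n E =
     (INF Q \<in> {Q :: ('a \<times> real) list. (\<forall>(x, r)\<in>set Q. r \<ge> 1) \<and>
                 E \<inter> macro_shell n \<subseteq> (\<Union>(x, r)\<in>set Q. upright_box x r)}.
        ennreal (\<Sum>(x, r)\<leftarrow>Q. (r / exp (real n)) powr \<rho>))"

text \<open>
  The infimum is over a nonempty set bounded below by 0: covering each shell by unit boxes shows
  that every \<open>\<rho> > DIM('a)\<close> belongs to it.
\<close>

definition macro_hausdorff_dim :: "'a::euclidean_space set \<Rightarrow> real" where
  "macro_hausdorff_dim E = Inf {\<rho>. \<rho> > 0 \<and> (\<Sum>n. macro_content \<rho> (Suc n) E) < \<infinity>}"

subsection \<open>Tall peaks\<close>

definition log_plus :: "real \<Rightarrow> real" where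
  "log_plus x = ln (max x (exp 1))"

definition tall_peaks :: "real \<Rightarrow> (real \<Rightarrow> real) \<Rightarrow> (real \<Rightarrow> real) \<Rightarrow> real \<Rightarrow> real set" where
  "tall_peaks c\<^sub>0 g X \<gamma> = {x. x \<ge> 0 \<and> x > c\<^sub>0 \<and> \<bar>X x\<bar> / g x > \<gamma>}"

definition multifractal_peaks ::
  "'w measure \<Rightarrow> real \<Rightarrow> (real \<Rightarrow> real) \<Rightarrow> (real \<Rightarrow> 'w \<Rightarrow> real) \<Rightarrow> bool"
where
  "multifractal_peaks M c\<^sub>0 g X \<longleftrightarrow>
     (\<exists>\<gamma> :: nat \<Rightarrow> real. (\<forall>i. \<gamma> (Suc i) < \<gamma> i) \<and> (\<forall>i. 0 < \<gamma> i) \<and>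
        (AE \<omega> in M. \<forall>i.
           macro_hausdorff_dim (tall_peaks c\<^sub>0 g (\<lambda>x. X x \<omega>) (\<gamma> i)) <
           macro_hausdorff_dim (tall_peaks c\<^sub>0 g (\<lambda>x. X x \<omega>) (\<gamma> (Suc i)))))"

end

theory Submission
  imports Defs "HOL-Real_Asymp.Real_Asymp"
begin

text \<open>
  The field \<open>X\<^sub>t\<close> is a stationary Gaussian process with unit variance, Hoelder increments and
  correlations that decay faster than exponentially.

  Upper bound: chaining over dyadic points gives
  \<open>P(sup\<^bsub>[k,k+1]\<^esub> |X\<^sub>t| > (1 + \<beta>) \<mu>) \<le> C exp (- \<mu>\<^sup>2 / 2)\<close> for every \<open>\<beta> > 0\<close>. Hence the shell of
  radius \<open>e\<^sup>n\<close> contains on average at most \<open>C exp (n (1 - \<gamma>'\<^sup>2))\<close> unit intervals that meet the tall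
  peaks, for every \<open>\<gamma>' < \<gamma>\<close>; covering by these intervals bounds the dimension by \<open>1 - \<gamma>\<^sup>2\<close>, and for
  \<open>\<gamma> > 1\<close> only finitely many such intervals exist.

  Lower bound: for \<open>\<rho> < 1 - \<gamma>\<^sup>2\<close> split the shell into blocks of length about \<open>exp (n (1 - \<rho>))\<close> and
  consider points at mutual distance \<open>2n\<close> in a block. Up to a superexponentially small \<open>L\<^sup>2\<close> error the
  values there are Wiener integrals over disjoint regions, hence independent, so the probability
  that a block contains no tall peak is doubly exponentially small. By Borel-Cantelli all blocks
  far out contain a peak, and a set meeting all blocks has \<open>\<rho>\<close>-content bounded away from 0.
\<close>

text \<open>The value 1 - \<gamma>^2 is a balance of counts. At a given point the threshold \<gamma>
  sqrt(2n) is exceeded with probability exp(-\<gamma>^2 n) up to a factor exp(O(sqrt n)), and the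
  shell of radius e^n holds about e^n unit intervals. In a block of length exp(n (1 - \<rho>)) the
  expected number of exceedances among points at distance 2n stays exponentially large as long as
  \<rho> < 1 - \<gamma>^2. The obstacle is the probabilistic input: white noise is given only
  through Gaussian finite linear combinations and covariances, and \<open>Z\<close> only as a
  mean-square limit of simple integrals. Gaussian facts are therefore proved for simple integrals,
  where characteristic functions give independence over disjoint supports, and reach the limit
  through Chebyshev, with estimates sharp enough to preserve the exact variance. The distance 2n
  suffices because cutting the heat kernel at distance n costs only a multiple of exp(-n^2/(2t)) in
  mean square, which beats a union bound over exponentially many points.\<close>

section \<open>Centered Gaussian variables\<close>

text \<open>Both cases carry the mean square as a nonnegative integral, the form in which the Wiener
  isometry delivers it; in the normal case it identifies \<sigma>^2.\<close>

lemma (in prob_space) centered_gaussian_cases: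
  assumes "centered_gaussian M Y"
  obtains (null) "AE \<omega> in M. Y \<omega> = 0" "(\<integral>\<^sup>+\<omega>. ennreal ((Y \<omega>)\<^sup>2) \<partial>M) = 0"
  | (normal) \<sigma> where "0 < \<sigma>" "distributed M lborel Y (normal_density 0 \<sigma>)"
      "(\<integral>\<^sup>+\<omega>. ennreal ((Y \<omega>)\<^sup>2) \<partial>M) = ennreal (\<sigma>\<^sup>2)"
proof -
  consider "AE \<omega> in M. Y \<omega> = 0"
    | \<sigma> where "0 < \<sigma>" "distributed M lborel Y (normal_density 0 \<sigma>)"
    using assms by (auto simp: centered_gaussian_def)
  then show thesis
  proof cases
    case 1
    have "(\<integral>\<^sup>+\<omega>. ennreal ((Y \<omega>)\<^sup>2) \<partial>M) = (\<integral>\<^sup>+\<omega>. 0 \<partial>M)"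
      by (rule nn_integral_cong_AE) (use 1 in auto)
    with 1 show thesis by (intro null) auto
  next
    case (2 \<sigma>)
    have "(\<integral>\<^sup>+\<omega>. ennreal ((Y \<omega>)\<^sup>2) \<partial>M) = (\<integral>\<^sup>+x. ennreal (normal_density 0 \<sigma> x) * ennreal (x\<^sup>2) \<partial>lborel)"
      by (rule distributed_nn_integral[OF 2(2), symmetric]) simp
    also have "\<dots> = (\<integral>\<^sup>+x. ennreal (normal_density 0 \<sigma> x * (x - 0) ^ (2 * 1)) \<partial>lborel)"
      by (intro nn_integral_cong) (simp add: ennreal_mult)
    also have "\<dots> = ennreal (\<integral>x. normal_density 0 \<sigma> x * (x - 0) ^ (2 * 1) \<partial>lborel)"
      using integrable_normal_moment[OF 2(1), of 0 "2 * 1"] by (rule nn_integral_eq_integral) auto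
    also have "\<dots> = ennreal (\<sigma>\<^sup>2)"
      using integral_normal_moment_even[OF 2(1), of 0 1] by (simp add: fact_numeral)
    finally show thesis using 2 by (intro normal)
  qed
qed

lemma centered_gaussian_measurable:
  "centered_gaussian M Y \<Longrightarrow> Y \<in> borel_measurable M"
  by (simp add: centered_gaussian_def)

lemma (in prob_space) centered_gaussian_square_integrable:
  assumes "centered_gaussian M Y"
  shows "integrable M (\<lambda>\<omega>. (Y \<omega>)\<^sup>2)"
proof (rule integrableI_nonneg)
  show "(\<lambda>\<omega>. (Y \<omega>)\<^sup>2) \<in> borel_measurable M"
    using centered_gaussian_measurable[OF assms] by simp
  show "(\<integral>\<^sup>+\<omega>. ennreal ((Y \<omega>)\<^sup>2) \<partial>M) < \<infinity>"
    using assms by (cases rule: centered_gaussian_cases) auto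
qed auto

text \<open>For x > a \<ge> 0 one has x^2 \<ge> a^2 + (x - a)^2, so to the right of a the density
  lies below exp(-a^2/(2\<sigma>^2)) times the normal density recentred at a, which has mass
  1.\<close>

lemma (in prob_space) normal_upper_tail:
  assumes Y: "distributed M lborel Y (normal_density 0 \<sigma>)" and \<sigma>: "0 < \<sigma>" and a: "0 \<le> a"
  shows "prob {\<omega> \<in> space M. a < Y \<omega>} \<le> exp (- a\<^sup>2 / (2 * \<sigma>\<^sup>2))"
proof -
  have "emeasure M {\<omega> \<in> space M. a < Y \<omega>} = emeasure M (Y -` {a<..} \<inter> space M)"
    by (rule arg_cong[where f="emeasure M"]) auto
  also have "\<dots> = (\<integral>\<^sup>+x. ennreal (normal_density 0 \<sigma> x) * indicator {a<..} x \<partial>lborel)"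
    by (rule distributed_emeasure[OF Y]) simp
  also have "\<dots> \<le> (\<integral>\<^sup>+x. ennreal (exp (- a\<^sup>2 / (2 * \<sigma>\<^sup>2))) * ennreal (normal_density a \<sigma> x) \<partial>lborel)"
  proof (intro nn_integral_mono)
    fix x :: real
    have "normal_density 0 \<sigma> x \<le> exp (- a\<^sup>2 / (2 * \<sigma>\<^sup>2)) * normal_density a \<sigma> x" if "a < x"
    proof -
      have "a * (x - a) \<ge> 0" using a that by simp
      then have "- x\<^sup>2 \<le> - a\<^sup>2 + - (x - a)\<^sup>2" by (simp add: power2_eq_square algebra_simps)
      then have "- x\<^sup>2 / (2 * \<sigma>\<^sup>2) \<le> - a\<^sup>2 / (2 * \<sigma>\<^sup>2) + - (x - a)\<^sup>2 / (2 * \<sigma>\<^sup>2)"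
        unfolding add_divide_distrib[symmetric] by (rule divide_right_mono) simp
      then have "exp (- x\<^sup>2 / (2 * \<sigma>\<^sup>2)) \<le> exp (- a\<^sup>2 / (2 * \<sigma>\<^sup>2)) * exp (- (x - a)\<^sup>2 / (2 * \<sigma>\<^sup>2))"
        by (simp add: exp_add[symmetric])
      then show ?thesis
        using \<sigma> by (simp add: normal_density_def divide_right_mono)
    qed
    then show "ennreal (normal_density 0 \<sigma> x) * indicator {a<..} x
        \<le> ennreal (exp (- a\<^sup>2 / (2 * \<sigma>\<^sup>2))) * ennreal (normal_density a \<sigma> x)"
      by (auto simp: indicator_def ennreal_mult[symmetric] simp del: ennreal_mult'' intro!: ennreal_leI)
  qed
  also have "\<dots> = ennreal (exp (- a\<^sup>2 / (2 * \<sigma>\<^sup>2)))"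
    using \<sigma> by (simp add: nn_integral_cmult nn_integral_eq_integral)
  finally show ?thesis by (simp add: emeasure_eq_measure)
qed

text \<open>The mass of the unit interval to the right of a, estimated by the smallest value of the
  density there. Replacing a by a + 1 is affordable: at a of order sqrt n it changes the exponent
  only by O(sqrt n).\<close>

lemma (in prob_space) normal_lower_tail:
  assumes Y: "distributed M lborel Y (normal_density 0 \<sigma>)" and \<sigma>: "0 < \<sigma>" and a: "0 \<le> a"
  shows "exp (- (a + 1)\<^sup>2 / (2 * \<sigma>\<^sup>2)) / sqrt (2 * pi * \<sigma>\<^sup>2) \<le> prob {\<omega> \<in> space M. a < Y \<omega>}"
proof -
  have "ennreal (exp (- (a + 1)\<^sup>2 / (2 * \<sigma>\<^sup>2)) / sqrt (2 * pi * \<sigma>\<^sup>2))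
      = (\<integral>\<^sup>+x. ennreal (exp (- (a + 1)\<^sup>2 / (2 * \<sigma>\<^sup>2)) / sqrt (2 * pi * \<sigma>\<^sup>2)) * indicator {a<..a+1} x \<partial>lborel)"
    by (simp add: nn_integral_cmult_indicator)
  also have "\<dots> \<le> (\<integral>\<^sup>+x. ennreal (normal_density 0 \<sigma> x) * indicator {a<..} x \<partial>lborel)"
  proof (intro nn_integral_mono)
    fix x :: real
    have "exp (- (a + 1)\<^sup>2 / (2 * \<sigma>\<^sup>2)) / sqrt (2 * pi * \<sigma>\<^sup>2) \<le> normal_density 0 \<sigma> x" if "a < x" "x \<le> a + 1"
    proof -
      have "x\<^sup>2 \<le> (a + 1)\<^sup>2" using that a by (intro power_mono) auto
      then have "- (a + 1)\<^sup>2 / (2 * \<sigma>\<^sup>2) \<le> - x\<^sup>2 / (2 * \<sigma>\<^sup>2)"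
        by (intro divide_right_mono) auto
      then show ?thesis unfolding normal_density_def using \<sigma> by (simp add: divide_right_mono)
    qed
    then show "ennreal (exp (- (a + 1)\<^sup>2 / (2 * \<sigma>\<^sup>2)) / sqrt (2 * pi * \<sigma>\<^sup>2)) * indicator {a<..a+1} x
        \<le> ennreal (normal_density 0 \<sigma> x) * indicator {a<..} x"
      by (auto simp: indicator_def intro!: ennreal_leI)
  qed
  also have "\<dots> = emeasure M (Y -` {a<..} \<inter> space M)"
    by (rule distributed_emeasure[OF Y, symmetric]) simp
  also have "Y -` {a<..} \<inter> space M = {\<omega> \<in> space M. a < Y \<omega>}" by auto
  finally show ?thesis by (simp add: emeasure_eq_measure)
qed

lemma (in prob_space) centered_gaussian_tail:
  assumes Y: "centered_gaussian M Y" and V: "(\<integral>\<^sup>+\<omega>. ennreal ((Y \<omega>)\<^sup>2) \<partial>M) \<le> ennreal V" "0 < V"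
    and a: "0 \<le> a"
  shows "prob {\<omega> \<in> space M. a < \<bar>Y \<omega>\<bar>} \<le> 2 * exp (- a\<^sup>2 / (2 * V))"
  using Y
proof (cases rule: centered_gaussian_cases)
  case null
  have "prob {\<omega> \<in> space M. a < \<bar>Y \<omega>\<bar>} = 0"
    by (subst prob_eq_0) (use null a centered_gaussian_measurable[OF Y] in auto)
  then show ?thesis by simp
next
  case (normal \<sigma>)
  have [measurable]: "Y \<in> borel_measurable M" by (rule centered_gaussian_measurable[OF Y])
  have "distributed M lborel (\<lambda>\<omega>. 0 + (-1) * Y \<omega>) (normal_density (0 + (-1) * 0) (\<bar>-1\<bar> * \<sigma>))"
    by (rule normal_density_affine[OF normal(2,1)]) simp
  then have neg: "distributed M lborel (\<lambda>\<omega>. - Y \<omega>) (normal_density 0 \<sigma>)" by simp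
  have sV: "\<sigma>\<^sup>2 \<le> V" using V normal by simp
  have "- a\<^sup>2 / (2 * \<sigma>\<^sup>2) \<le> - a\<^sup>2 / (2 * V)"
    using sV V normal(1) by (auto intro!: divide_left_mono mult_pos_pos)
  then have e: "exp (- a\<^sup>2 / (2 * \<sigma>\<^sup>2)) \<le> exp (- a\<^sup>2 / (2 * V))" by simp
  have "prob {\<omega> \<in> space M. a < \<bar>Y \<omega>\<bar>} \<le> prob ({\<omega> \<in> space M. a < Y \<omega>} \<union> {\<omega> \<in> space M. a < - Y \<omega>})"
    by (rule finite_measure_mono) auto
  also have "\<dots> \<le> prob {\<omega> \<in> space M. a < Y \<omega>} + prob {\<omega> \<in> space M. a < - Y \<omega>}"
    by (rule measure_Un_le) auto
  also have "\<dots> \<le> 2 * exp (- a\<^sup>2 / (2 * V))"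
    using normal_upper_tail[OF normal(2,1) a] normal_upper_tail[OF neg normal(1) a] e by linarith
  finally show ?thesis .
qed

lemma (in prob_space) centered_gaussian_lower_tail:
  assumes Y: "centered_gaussian M Y" and V: "(\<integral>\<^sup>+\<omega>. ennreal ((Y \<omega>)\<^sup>2) \<partial>M) = ennreal V" "0 < V"
    and a: "0 \<le> a"
  shows "exp (- (a + 1)\<^sup>2 / (2 * V)) / sqrt (2 * pi * V) \<le> prob {\<omega> \<in> space M. a < Y \<omega>}"
  using Y
proof (cases rule: centered_gaussian_cases)
  case null
  then show ?thesis using V by simp
next
  case (normal \<sigma>)
  then have "\<sigma>\<^sup>2 = V" using V by simp
  with normal_lower_tail[OF normal(2,1) a] show ?thesis by simp
qed

lemma (in prob_space) centered_gaussian_char: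
  assumes Y: "centered_gaussian M Y" and V: "(\<integral>\<^sup>+\<omega>. ennreal ((Y \<omega>)\<^sup>2) \<partial>M) = ennreal V" "0 \<le> V"
  shows "(CLINT \<omega>|M. iexp (Y \<omega>)) = exp (- V / 2)"
  using Y
proof (cases rule: centered_gaussian_cases)
  case null
  then have "V = 0" using V by simp
  have "(CLINT \<omega>|M. iexp (Y \<omega>)) = (CLINT \<omega>|M. 1)"
    by (rule integral_cong_AE) (use null centered_gaussian_measurable[OF Y] in auto)
  then show ?thesis using \<open>V = 0\<close> by (simp add: prob_space)
next
  case (normal \<sigma>)
  then have s: "\<sigma>\<^sup>2 = V" using V by simp
  have [measurable]: "Y \<in> borel_measurable M" by (rule centered_gaussian_measurable[OF Y])
  have d: "distributed M lborel (\<lambda>\<omega>. (Y \<omega> - 0) / \<sigma>) std_normal_density"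
    using normal normal_standard_normal_convert[OF normal(1)] by blast
  have dd: "std_normal_distribution = distr M lborel (\<lambda>\<omega>. Y \<omega> / \<sigma>)"
    using distributed_distr_eq_density[OF d] by simp
  have "(CLINT \<omega>|M. iexp (Y \<omega>)) = (CLINT \<omega>|M. iexp (\<sigma> * (Y \<omega> / \<sigma>)))"
    using normal(1) by simp
  also have "\<dots> = char std_normal_distribution \<sigma>"
    unfolding dd char_def by (subst integral_distr) auto
  also have "\<dots> = exp (- V / 2)" by (simp add: char_std_normal_distribution s)
  finally show ?thesis .
qed

section \<open>Mean squares and independence from characteristic functions\<close>

text \<open>Expanding (\<eta> f - g)^2 \<ge> 0. The weight \<eta> is kept free so that a small
  perturbation g multiplies the mean square of f by a factor tending to 1; a fixed factor 2 would
  spoil the Gaussian exponents.\<close>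

lemma nn_integral_square_add_le:
  fixes f g :: "'a \<Rightarrow> real"
  assumes [measurable]: "f \<in> borel_measurable M" "g \<in> borel_measurable M" and \<eta>: "0 < \<eta>"
  shows "(\<integral>\<^sup>+x. ennreal ((f x + g x)\<^sup>2) \<partial>M)
    \<le> ennreal (1 + \<eta>) * (\<integral>\<^sup>+x. ennreal ((f x)\<^sup>2) \<partial>M) + ennreal (1 + 1 / \<eta>) * (\<integral>\<^sup>+x. ennreal ((g x)\<^sup>2) \<partial>M)"
proof -
  have "(f x + g x)\<^sup>2 \<le> (1 + \<eta>) * (f x)\<^sup>2 + (1 + 1 / \<eta>) * (g x)\<^sup>2" for x
  proof -
    have "0 \<le> (\<eta> * f x - g x)\<^sup>2 / \<eta>" using \<eta> by simp
    also have "\<dots> = (1 + \<eta>) * (f x)\<^sup>2 + (1 + 1 / \<eta>) * (g x)\<^sup>2 - (f x + g x)\<^sup>2"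
      using \<eta> by (simp add: power2_eq_square field_simps)
    finally show ?thesis by simp
  qed
  then have "(\<integral>\<^sup>+x. ennreal ((f x + g x)\<^sup>2) \<partial>M)
      \<le> (\<integral>\<^sup>+x. ennreal (1 + \<eta>) * ennreal ((f x)\<^sup>2) + ennreal (1 + 1 / \<eta>) * ennreal ((g x)\<^sup>2) \<partial>M)"
    using \<eta> by (intro nn_integral_mono)
      (simp add: ennreal_mult[symmetric] ennreal_plus[symmetric] del: ennreal_plus)
  also have "\<dots> = ennreal (1 + \<eta>) * (\<integral>\<^sup>+x. ennreal ((f x)\<^sup>2) \<partial>M) + ennreal (1 + 1 / \<eta>) * (\<integral>\<^sup>+x. ennreal ((g x)\<^sup>2) \<partial>M)"
    by (subst nn_integral_add) (auto simp: nn_integral_cmult)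
  finally show ?thesis .
qed

lemma nn_integral_square_add_bound:
  fixes f g :: "'a \<Rightarrow> real"
  assumes [measurable]: "f \<in> borel_measurable M" "g \<in> borel_measurable M" and \<eta>: "0 < \<eta>"
    and f: "(\<integral>\<^sup>+x. ennreal ((f x)\<^sup>2) \<partial>M) \<le> ennreal a" and g: "(\<integral>\<^sup>+x. ennreal ((g x)\<^sup>2) \<partial>M) \<le> ennreal b"
    and ab: "0 \<le> a" "0 \<le> b"
  shows "(\<integral>\<^sup>+x. ennreal ((f x + g x)\<^sup>2) \<partial>M) \<le> ennreal ((1 + \<eta>) * a + (1 + 1 / \<eta>) * b)"
proof -
  have "(\<integral>\<^sup>+x. ennreal ((f x + g x)\<^sup>2) \<partial>M)
    \<le> ennreal (1 + \<eta>) * (\<integral>\<^sup>+x. ennreal ((f x)\<^sup>2) \<partial>M) + ennreal (1 + 1 / \<eta>) * (\<integral>\<^sup>+x. ennreal ((g x)\<^sup>2) \<partial>M)"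
    by (rule nn_integral_square_add_le) (use \<eta> in auto)
  also have "\<dots> \<le> ennreal (1 + \<eta>) * ennreal a + ennreal (1 + 1 / \<eta>) * ennreal b"
    by (intro add_mono mult_left_mono f g) auto
  also have "\<dots> = ennreal ((1 + \<eta>) * a + (1 + 1 / \<eta>) * b)"
    using ab \<eta> by (simp add: ennreal_mult[symmetric] ennreal_plus[symmetric] del: ennreal_plus)
  finally show ?thesis .
qed

lemma (in prob_space) square_markov:
  fixes D :: "'a \<Rightarrow> real"
  assumes [measurable]: "D \<in> borel_measurable M"
    and e: "(\<integral>\<^sup>+\<omega>. ennreal ((D \<omega>)\<^sup>2) \<partial>M) \<le> ennreal e" "0 \<le> e" and \<eta>: "0 < \<eta>"
  shows "prob {\<omega> \<in> space M. \<eta> \<le> \<bar>D \<omega>\<bar>} \<le> e / \<eta>\<^sup>2"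
proof -
  have "ennreal (\<eta>\<^sup>2) * emeasure M {\<omega> \<in> space M. \<eta> \<le> \<bar>D \<omega>\<bar>}
      = (\<integral>\<^sup>+\<omega>. ennreal (\<eta>\<^sup>2) * indicator {\<omega> \<in> space M. \<eta> \<le> \<bar>D \<omega>\<bar>} \<omega> \<partial>M)"
    by (simp add: nn_integral_cmult_indicator)
  also have "\<dots> \<le> (\<integral>\<^sup>+\<omega>. ennreal ((D \<omega>)\<^sup>2) \<partial>M)"
  proof (intro nn_integral_mono)
    fix \<omega>
    have "\<eta>\<^sup>2 \<le> (D \<omega>)\<^sup>2" if "\<eta> \<le> \<bar>D \<omega>\<bar>"
      using power_mono[OF that, of 2] \<eta> by simp
    then show "ennreal (\<eta>\<^sup>2) * indicator {\<omega> \<in> space M. \<eta> \<le> \<bar>D \<omega>\<bar>} \<omega> \<le> ennreal ((D \<omega>)\<^sup>2)"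
      by (auto simp: indicator_def intro!: ennreal_leI)
  qed
  also have "\<dots> \<le> ennreal e" by (rule e)
  finally have "\<eta>\<^sup>2 * prob {\<omega> \<in> space M. \<eta> \<le> \<bar>D \<omega>\<bar>} \<le> e"
    using e(2) by (simp add: emeasure_eq_measure ennreal_mult[symmetric])
  then show ?thesis using \<eta> by (simp add: field_simps)
qed

text \<open>Normalised to mean 1, u is the density of a probability under which W has the same
  characteristic function, hence by Levy the same law, as under M. If u has mean 0 it vanishes
  almost surely and both sides are 0. The bound 2 is the maximum of 1 + cos and 1 + sin.\<close>

lemma (in prob_space) weighted_law_eq:
  fixes W u :: "'a \<Rightarrow> real"
  assumes [measurable]: "W \<in> borel_measurable M" "u \<in> borel_measurable M" "B \<in> sets borel"
    and u: "\<And>\<omega>. 0 \<le> u \<omega>" "\<And>\<omega>. u \<omega> \<le> 2"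
    and char: "\<And>s. (CLINT \<omega>|M. u \<omega> * iexp (s * W \<omega>)) = expectation u * (CLINT \<omega>|M. iexp (s * W \<omega>))"
  shows "expectation (\<lambda>\<omega>. u \<omega> * indicator B (W \<omega>)) = expectation u * prob {\<omega> \<in> space M. W \<omega> \<in> B}"
proof -
  have iu: "integrable M u"
    by (rule integrable_const_bound[where B=2]) (use u in auto)
  show ?thesis
  proof (cases "expectation u = 0")
    case True
    then have "AE \<omega> in M. u \<omega> = 0"
      using integral_nonneg_eq_0_iff_AE[OF iu] u by simp
    then have "expectation (\<lambda>\<omega>. u \<omega> * indicator B (W \<omega>)) = expectation (\<lambda>\<omega>. 0)"
      by (intro integral_cong_AE) auto
    with True show ?thesis by simp
  next
    case False
    define e where "e = expectation u"
    have e: "0 < e" using False u Bochner_Integration.integral_nonneg[of M u] by (simp add: e_def less_le)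
    define N where "N = density M (\<lambda>\<omega>. ennreal (u \<omega> / e))"
    have [measurable_cong]: "sets N = sets M" by (simp add: N_def)
    have "emeasure N (space N) = (\<integral>\<^sup>+\<omega>. ennreal (u \<omega> / e) \<partial>M)"
      by (auto simp: N_def emeasure_density intro!: nn_integral_cong)
    also have "\<dots> = ennreal (\<integral>\<omega>. u \<omega> / e \<partial>M)"
      using iu u e by (intro nn_integral_eq_integral) auto
    also have "\<dots> = 1" using e by (simp add: e_def)
    finally interpret N: prob_space N by (rule prob_spaceI)
    have "distr N borel W = distr M borel W"
    proof (rule Levy_uniqueness)
      show "real_distribution (distr N borel W)"
        by (intro N.real_distribution_distr) simp
      show "real_distribution (distr M borel W)"
        by (intro real_distribution_distr) simp
      show "char (distr N borel W) = char (distr M borel W)"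
      proof
        fix s
        have "char (distr N borel W) s = (CLINT \<omega>|N. iexp (s * W \<omega>))"
          by (simp add: char_def integral_distr)
        also have "\<dots> = (CLINT \<omega>|M. (u \<omega> / e) *\<^sub>R iexp (s * W \<omega>))"
          unfolding N_def using u e by (intro integral_density) auto
        also have "\<dots> = (CLINT \<omega>|M. u \<omega> * iexp (s * W \<omega>) / e)"
          by (simp add: scaleR_conv_of_real mult_ac)
        also have "\<dots> = (CLINT \<omega>|M. iexp (s * W \<omega>))"
          using e by (simp only: integral_divide_zero char e_def[symmetric]) simp
        also have "\<dots> = char (distr M borel W) s"
          by (simp add: char_def integral_distr)
        finally show "char (distr N borel W) s = char (distr M borel W) s" .
      qed
    qed
    then have "emeasure (distr N borel W) B = emeasure (distr M borel W) B" by simp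
    then have "emeasure N (W -` B \<inter> space M) = emeasure M (W -` B \<inter> space M)"
      by (simp add: emeasure_distr N_def)
    also have "W -` B \<inter> space M = {\<omega> \<in> space M. W \<omega> \<in> B}" by auto
    also have "emeasure N {\<omega> \<in> space M. W \<omega> \<in> B} = (\<integral>\<^sup>+\<omega>. ennreal (u \<omega> * indicator B (W \<omega>) / e) \<partial>M)"
      by (simp add: N_def emeasure_density)
        (auto intro!: nn_integral_cong simp: indicator_def)
    also have "\<dots> = ennreal (\<integral>\<omega>. u \<omega> * indicator B (W \<omega>) / e \<partial>M)"
      using u e by (intro nn_integral_eq_integral integrable_const_bound[where B="2 / e"])
        (auto intro!: AE_I2 divide_right_mono simp: indicator_def)
    also have "\<dots> = ennreal (expectation (\<lambda>\<omega>. u \<omega> * indicator B (W \<omega>)) / e)" by simp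
    finally have "expectation (\<lambda>\<omega>. u \<omega> * indicator B (W \<omega>)) / e = prob {\<omega> \<in> space M. W \<omega> \<in> B}"
      using u e by (simp add: emeasure_eq_measure Bochner_Integration.integral_nonneg)
    then show ?thesis using e by (simp add: e_def field_simps)
  qed
qed

lemma (in prob_space) integrable_bounded_complex:
  fixes f :: "'a \<Rightarrow> complex"
  assumes "f \<in> borel_measurable M" "\<And>\<omega>. norm (f \<omega>) \<le> c"
  shows "integrable M f"
  by (rule integrable_const_bound[where B=c]) (use assms in auto)

text \<open>
  The uniqueness theorem for characteristic functions is applied to the laws of \<open>W\<close> under the
  weights \<open>1\<^sub>A\<close>, \<open>1\<^sub>A (1 + cos L)\<close> and \<open>1\<^sub>A (1 + sin L)\<close>, which are nonnegative and recover
  \<open>1\<^sub>A exp (i L)\<close> linearly.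
\<close>

lemma (in prob_space) char_factor_event:
  fixes W L :: "'a \<Rightarrow> real"
  assumes [measurable]: "W \<in> borel_measurable M" "L \<in> borel_measurable M" "B \<in> sets borel" "A \<in> events"
    and char: "\<And>s c. (CLINT \<omega>|M. indicator A \<omega> * iexp (s * W \<omega> + c * L \<omega>))
      = (CLINT \<omega>|M. indicator A \<omega> * iexp (c * L \<omega>)) * (CLINT \<omega>|M. iexp (s * W \<omega>))"
  shows "(CLINT \<omega>|M. indicator (A \<inter> {\<omega> \<in> space M. W \<omega> \<in> B}) \<omega> * iexp (L \<omega>))
      = (CLINT \<omega>|M. indicator A \<omega> * iexp (L \<omega>)) * prob {\<omega> \<in> space M. W \<omega> \<in> B}"
proof -
  let ?p = "prob {\<omega> \<in> space M. W \<omega> \<in> B}"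
  let ?\<phi> = "\<lambda>s. CLINT \<omega>|M. iexp (s * W \<omega>)"
  let ?E = "\<lambda>c. CLINT \<omega>|M. indicator A \<omega> * iexp (c * L \<omega>)"
  have int: "integrable M (\<lambda>\<omega>. indicator A \<omega> * iexp (h \<omega>))" if [measurable]: "h \<in> borel_measurable M" for h
    by (rule integrable_bounded_complex[where c=1]) (auto simp: norm_mult indicator_def)
  have ind: "indicator A \<omega> * iexp (a + b) = indicator A \<omega> * iexp b * iexp a" for \<omega> a b
    by (simp add: exp_add distrib_left mult_ac)
  \<comment> \<open>Euler's formula turns the weights into combinations of the frequencies 0, 1 and
    -1 of L, so the hypothesis \<open>char\<close> is called at c = 0, 1, -1 only.\<close>
  have cosw: "of_real (indicator A \<omega> * (1 + cos (L \<omega>))) * iexp (s * W \<omega>)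
      = indicator A \<omega> * iexp (s * W \<omega> + 0 * L \<omega>)
        + (indicator A \<omega> * iexp (s * W \<omega> + 1 * L \<omega>) + indicator A \<omega> * iexp (s * W \<omega> + (-1) * L \<omega>)) / 2" for s \<omega>
    unfolding ind by (auto simp: indicator_def cos_of_real[symmetric] cos_exp_eq algebra_simps add_divide_distrib)
  have sinw: "of_real (indicator A \<omega> * (1 + sin (L \<omega>))) * iexp (s * W \<omega>)
      = indicator A \<omega> * iexp (s * W \<omega> + 0 * L \<omega>)
        + (indicator A \<omega> * iexp (s * W \<omega> + 1 * L \<omega>) - indicator A \<omega> * iexp (s * W \<omega> + (-1) * L \<omega>)) / (2 * \<i>)" for s \<omega>
    unfolding ind by (auto simp: indicator_def sin_of_real[symmetric] sin_exp_eq algebra_simps diff_divide_distrib)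
  have C: "(CLINT \<omega>|M. of_real (indicator A \<omega> * (1 + cos (L \<omega>))) * iexp (s * W \<omega>))
      = (?E 0 + (?E 1 + ?E (-1)) / 2) * ?\<phi> s" for s
    unfolding cosw
    by (subst Bochner_Integration.integral_add, (intro int Bochner_Integration.integrable_add integrable_divide; simp)+,
        subst integral_divide_zero, subst Bochner_Integration.integral_add,
        (intro int; simp)+, simp only: char, simp add: algebra_simps add_divide_distrib)
  have S: "(CLINT \<omega>|M. of_real (indicator A \<omega> * (1 + sin (L \<omega>))) * iexp (s * W \<omega>))
      = (?E 0 + (?E 1 - ?E (-1)) / (2 * \<i>)) * ?\<phi> s" for s
    unfolding sinw
    by (subst Bochner_Integration.integral_add, (intro int Bochner_Integration.integrable_diff integrable_divide; simp)+,
        subst integral_divide_zero, subst Bochner_Integration.integral_diff,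
        (intro int; simp)+, simp only: char, simp add: algebra_simps diff_divide_distrib)
  have weight: "expectation (\<lambda>\<omega>. u \<omega> * indicator B (W \<omega>)) = expectation u * ?p"
    if [measurable]: "u \<in> borel_measurable M" and u: "\<And>\<omega>. 0 \<le> u \<omega>" "\<And>\<omega>. u \<omega> \<le> 2"
      and K: "\<And>s. (CLINT \<omega>|M. of_real (u \<omega>) * iexp (s * W \<omega>)) = K * ?\<phi> s" for u K
  proof (rule weighted_law_eq)
    have "of_real (expectation u) = K"
      using K[of 0] by (simp add: prob_space)
    then show "(CLINT \<omega>|M. u \<omega> * iexp (s * W \<omega>)) = expectation u * (CLINT \<omega>|M. iexp (s * W \<omega>))" for s
      using K by simp
  qed (use u in auto)
  have bnd: "0 \<le> 1 + cos x" "1 + cos x \<le> 2" "0 \<le> 1 + sin x" "1 + sin x \<le> 2" for x :: real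
    using cos_ge_minus_one[of x] cos_le_one[of x] sin_ge_minus_one[of x] sin_le_one[of x] by linarith+
  let ?i = "\<lambda>\<omega>. indicator A \<omega> :: real"
  let ?j = "\<lambda>\<omega>. indicator B (W \<omega>) :: real"
  have r1: "expectation (\<lambda>\<omega>. ?i \<omega> * (1 + cos (L \<omega>)) * ?j \<omega>) = expectation (\<lambda>\<omega>. ?i \<omega> * (1 + cos (L \<omega>))) * ?p"
    by (rule weight[OF _ _ _ C]) (use bnd in \<open>auto simp: indicator_def\<close>)
  have r2: "expectation (\<lambda>\<omega>. ?i \<omega> * (1 + sin (L \<omega>)) * ?j \<omega>) = expectation (\<lambda>\<omega>. ?i \<omega> * (1 + sin (L \<omega>))) * ?p"
    by (rule weight[OF _ _ _ S]) (use bnd in \<open>auto simp: indicator_def\<close>)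
  have r0: "expectation (\<lambda>\<omega>. ?i \<omega> * ?j \<omega>) = expectation ?i * ?p"
  proof (rule weight)
    show "(CLINT \<omega>|M. of_real (?i \<omega>) * iexp (s * W \<omega>)) = ?E 0 * ?\<phi> s" for s
      using char[of s 0] by (simp add: of_real_indicator)
  qed (auto simp: indicator_def)
  have intr: "integrable M (\<lambda>\<omega>. ?i \<omega> * h (L \<omega>))" "integrable M (\<lambda>\<omega>. ?i \<omega> * h (L \<omega>) * ?j \<omega>)"
    "integrable M (\<lambda>\<omega>. ?i \<omega> * ?j \<omega>)" "integrable M ?i"
    if [measurable]: "h \<in> borel_measurable borel" and "\<And>x. \<bar>h x\<bar> \<le> 1" for h :: "real \<Rightarrow> real"
    by (rule integrable_const_bound[where B=1]; use that(2) in \<open>auto simp: indicator_def\<close>)+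
  \<comment> \<open>Subtracting the case of the weight \<open>indicator A\<close> (fact
    \<open>r0\<close>) removes the summand 1 that had been added to make the weight
    nonnegative.\<close>
  have red: "expectation (\<lambda>\<omega>. ?i \<omega> * h (L \<omega>) * ?j \<omega>) = expectation (\<lambda>\<omega>. ?i \<omega> * h (L \<omega>)) * ?p"
    if h: "h \<in> borel_measurable borel" "\<And>x. \<bar>h x\<bar> \<le> 1"
      and e: "expectation (\<lambda>\<omega>. ?i \<omega> * (1 + h (L \<omega>)) * ?j \<omega>) = expectation (\<lambda>\<omega>. ?i \<omega> * (1 + h (L \<omega>))) * ?p"
    for h :: "real \<Rightarrow> real"
  proof -
    note i = intr[OF h]
    have "expectation (\<lambda>\<omega>. ?i \<omega> * (1 + h (L \<omega>)) * ?j \<omega>) = expectation (\<lambda>\<omega>. ?i \<omega> * ?j \<omega>) + expectation (\<lambda>\<omega>. ?i \<omega> * h (L \<omega>) * ?j \<omega>)"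
      using i by (subst Bochner_Integration.integral_add[symmetric]) (auto simp: algebra_simps)
    moreover have "expectation (\<lambda>\<omega>. ?i \<omega> * (1 + h (L \<omega>))) = expectation ?i + expectation (\<lambda>\<omega>. ?i \<omega> * h (L \<omega>))"
      using i by (subst Bochner_Integration.integral_add[symmetric]) (auto simp: algebra_simps)
    ultimately show ?thesis using e r0 by (simp add: algebra_simps)
  qed
  have c: "expectation (\<lambda>\<omega>. ?i \<omega> * cos (L \<omega>) * ?j \<omega>) = expectation (\<lambda>\<omega>. ?i \<omega> * cos (L \<omega>)) * ?p"
    by (rule red[OF _ _ r1]) auto
  have s: "expectation (\<lambda>\<omega>. ?i \<omega> * sin (L \<omega>) * ?j \<omega>) = expectation (\<lambda>\<omega>. ?i \<omega> * sin (L \<omega>)) * ?p"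
    by (rule red[OF _ _ r2]) auto
  have split: "(CLINT \<omega>|M. of_real (v \<omega>) * iexp (L \<omega>))
      = of_real (expectation (\<lambda>\<omega>. v \<omega> * cos (L \<omega>))) + \<i> * of_real (expectation (\<lambda>\<omega>. v \<omega> * sin (L \<omega>)))"
    if [measurable]: "v \<in> borel_measurable M" and "\<And>\<omega>. \<bar>v \<omega>\<bar> \<le> 1" for v :: "'a \<Rightarrow> real"
  proof -
    have i: "integrable M (\<lambda>\<omega>. v \<omega> * h (L \<omega>))"
      if [measurable]: "h \<in> borel_measurable borel" and "\<And>x. \<bar>h x\<bar> \<le> 1" for h :: "real \<Rightarrow> real"
      by (rule integrable_const_bound[where B=1])
        (use \<open>\<And>\<omega>. \<bar>v \<omega>\<bar> \<le> 1\<close> that(2) in \<open>auto simp: abs_mult intro!: mult_le_one AE_I2\<close>)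
    have "(CLINT \<omega>|M. of_real (v \<omega>) * iexp (L \<omega>))
      = (CLINT \<omega>|M. of_real (v \<omega> * cos (L \<omega>)) + \<i> * of_real (v \<omega> * sin (L \<omega>)))"
      by (intro Bochner_Integration.integral_cong) (auto simp: exp_Euler cos_of_real sin_of_real algebra_simps)
    also have "\<dots> = (CLINT \<omega>|M. of_real (v \<omega> * cos (L \<omega>))) + (CLINT \<omega>|M. \<i> * of_real (v \<omega> * sin (L \<omega>)))"
      by (intro Bochner_Integration.integral_add integrable_of_real integrable_mult_right i) auto
    finally show ?thesis by (simp only: integral_mult_right_zero integral_complex_of_real)
  qed
  have eq: "(indicator (A \<inter> {\<omega> \<in> space M. W \<omega> \<in> B}) \<omega> :: complex) = of_real (?i \<omega> * ?j \<omega>)" if "\<omega> \<in> space M" for \<omega>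
    using that by (auto simp: indicator_def)
  have "(CLINT \<omega>|M. indicator (A \<inter> {\<omega> \<in> space M. W \<omega> \<in> B}) \<omega> * iexp (L \<omega>))
      = (CLINT \<omega>|M. of_real (?i \<omega> * ?j \<omega>) * iexp (L \<omega>))"
    by (intro Bochner_Integration.integral_cong) (simp_all add: eq)
  also have "\<dots> = of_real (expectation (\<lambda>\<omega>. ?i \<omega> * cos (L \<omega>) * ?j \<omega>)) + \<i> * of_real (expectation (\<lambda>\<omega>. ?i \<omega> * sin (L \<omega>) * ?j \<omega>))"
    by (subst split) (auto simp: indicator_def mult_ac)
  also have "\<dots> = (of_real (expectation (\<lambda>\<omega>. ?i \<omega> * cos (L \<omega>))) + \<i> * of_real (expectation (\<lambda>\<omega>. ?i \<omega> * sin (L \<omega>)))) * ?p"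
    unfolding c s by (simp add: algebra_simps)
  also have "\<dots> = (CLINT \<omega>|M. of_real (?i \<omega>) * iexp (L \<omega>)) * ?p"
    by (subst split) (auto simp: indicator_def)
  also have "(\<lambda>\<omega>. of_real (?i \<omega>) :: complex) = indicator A" by (auto simp: indicator_def)
  finally show ?thesis by (simp add: indicator_def of_real_indicator)
qed

text \<open>Induction on the index set with A arbitrary: \<open>char_factor_event\<close> moves one
  variable at a time out of the exponential and into the event. In this way the one-dimensional
  uniqueness theorem suffices for joint independence.\<close>

lemma (in prob_space) prob_Inter_of_char_factor:
  fixes W :: "'i \<Rightarrow> 'a \<Rightarrow> real"
  assumes "finite J" "\<And>j. j \<in> J \<Longrightarrow> W j \<in> borel_measurable M" "\<And>j. j \<in> J \<Longrightarrow> B j \<in> sets borel"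
    and "A \<in> events"
    and "\<And>a. (CLINT \<omega>|M. indicator A \<omega> * iexp (\<Sum>j\<in>J. a j * W j \<omega>))
      = prob A * (\<Prod>j\<in>J. CLINT \<omega>|M. iexp (a j * W j \<omega>))"
  shows "prob (A \<inter> {\<omega> \<in> space M. \<forall>j\<in>J. W j \<omega> \<in> B j}) = prob A * (\<Prod>j\<in>J. prob {\<omega> \<in> space M. W j \<omega> \<in> B j})"
  using assms
proof (induction J arbitrary: A rule: finite_induct)
  case empty
  then have "A \<inter> {\<omega> \<in> space M. \<forall>j\<in>{}. W j \<omega> \<in> B j} = A" using sets.sets_into_space by auto
  then show ?case by simp
next
  case (insert k J)
  have [measurable]: "W k \<in> borel_measurable M" "\<And>j. j \<in> J \<Longrightarrow> W j \<in> borel_measurable M" "A \<in> events" "B k \<in> sets borel"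
    using insert.prems by auto
  define A' where "A' = A \<inter> {\<omega> \<in> space M. W k \<omega> \<in> B k}"
  have A'[measurable]: "A' \<in> events" unfolding A'_def by simp
  let ?\<phi> = "\<lambda>j s. CLINT \<omega>|M. iexp (s * W j \<omega>)"
  have full: "(CLINT \<omega>|M. indicator A \<omega> * iexp (s * W k \<omega> + (\<Sum>j\<in>J. a j * W j \<omega>)))
     = prob A * (?\<phi> k s * (\<Prod>j\<in>J. ?\<phi> j (a j)))" for s a
  proof -
    have e: "(\<Sum>j\<in>J. (a(k := s)) j * W j \<omega>) = (\<Sum>j\<in>J. a j * W j \<omega>)" for \<omega>
      using insert.hyps by (intro sum.cong) auto
    have e2: "(\<Prod>j\<in>J. ?\<phi> j ((a(k := s)) j)) = (\<Prod>j\<in>J. ?\<phi> j (a j))"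
      using insert.hyps by (intro prod.cong) auto
    show ?thesis
      using insert.prems(4)[of "a(k := s)"] by (simp only: sum.insert[OF insert.hyps] prod.insert[OF insert.hyps] e e2 fun_upd_same)
  qed
  have J: "(CLINT \<omega>|M. indicator A \<omega> * iexp (\<Sum>j\<in>J. a j * W j \<omega>)) = prob A * (\<Prod>j\<in>J. ?\<phi> j (a j))" for a
    using full[of 0 a] by (simp add: prob_space)
  have fac: "(CLINT \<omega>|M. indicator A' \<omega> * iexp (\<Sum>j\<in>J. a j * W j \<omega>))
      = prob A * (\<Prod>j\<in>J. ?\<phi> j (a j)) * prob {\<omega> \<in> space M. W k \<omega> \<in> B k}" for a
  proof -
    have e: "c * (\<Sum>j\<in>J. a j * W j \<omega>) = (\<Sum>j\<in>J. (c * a j) * W j \<omega>)" for c \<omega>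
      by (simp add: sum_distrib_left mult_ac)
    have *: "(CLINT \<omega>|M. indicator A \<omega> * iexp (s * W k \<omega> + c * (\<Sum>j\<in>J. a j * W j \<omega>)))
      = (CLINT \<omega>|M. indicator A \<omega> * iexp (c * (\<Sum>j\<in>J. a j * W j \<omega>))) * ?\<phi> k s" for s c
      unfolding e full J by simp
    show ?thesis
      unfolding A'_def J[symmetric] by (rule char_factor_event[OF _ _ _ _ *]) measurable
  qed
  \<comment> \<open>Zero coefficients in \<open>fac\<close> leave only the probability of the
    enlarged event, which restores the factorisation hypothesis for A'.\<close>
  have pA': "prob A' = prob A * prob {\<omega> \<in> space M. W k \<omega> \<in> B k}"
  proof -
    have "complex_of_real (prob A') = (CLINT \<omega>|M. of_real (indicator A' \<omega>))"
      unfolding integral_complex_of_real by simp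
    also have "\<dots> = (CLINT \<omega>|M. indicator A' \<omega>)" by (simp only: of_real_indicator)
    also have "\<dots> = prob A * prob {\<omega> \<in> space M. W k \<omega> \<in> B k}"
      using fac[of "\<lambda>_. 0"] by (simp add: prob_space)
    finally show ?thesis by (simp only: of_real_eq_iff of_real_mult[symmetric])
  qed
  have "prob (A' \<inter> {\<omega> \<in> space M. \<forall>j\<in>J. W j \<omega> \<in> B j}) = prob A' * (\<Prod>j\<in>J. prob {\<omega> \<in> space M. W j \<omega> \<in> B j})"
    by (rule insert.IH) (use insert.prems A' fac in \<open>auto simp: pA' mult_ac\<close>)
  moreover have "A' \<inter> {\<omega> \<in> space M. \<forall>j\<in>J. W j \<omega> \<in> B j} = A \<inter> {\<omega> \<in> space M. \<forall>j\<in>insert k J. W j \<omega> \<in> B j}"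
    by (auto simp: A'_def)
  ultimately show ?case using insert.hyps by (simp add: pA')
qed

section \<open>Wiener integrals\<close>

text \<open>A relation between integrand and integral, since the value attached to a step function
  depends on its representation, up to a null set. Lists may repeat a set, which makes addition mere
  concatenation.\<close>

definition simple_wiener ::
  "((real \<times> real) set \<Rightarrow> 'w \<Rightarrow> real) \<Rightarrow> (real \<times> real \<Rightarrow> real) \<Rightarrow> ('w \<Rightarrow> real) \<Rightarrow> bool" where
  "simple_wiener \<xi> F I \<longleftrightarrow> (\<exists>\<phi> :: (real \<times> (real \<times> real) set) list.
     (\<forall>(c, A)\<in>set \<phi>. A \<in> spacetime_sets) \<and>
     F = (\<lambda>z. \<Sum>(c, A)\<leftarrow>\<phi>. c * indicator A z) \<and> I = (\<lambda>\<omega>. \<Sum>(c, A)\<leftarrow>\<phi>. c * \<xi> A \<omega>))"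

lemma simple_wiener_zero: "simple_wiener \<xi> (\<lambda>_. 0) (\<lambda>_. 0)"
  unfolding simple_wiener_def by (rule exI[of _ "[]"]) simp

lemma simple_wiener_add:
  assumes "simple_wiener \<xi> F I" "simple_wiener \<xi> G J"
  shows "simple_wiener \<xi> (\<lambda>z. F z + G z) (\<lambda>\<omega>. I \<omega> + J \<omega>)"
proof -
  obtain \<phi> \<psi> where "\<forall>(c, A)\<in>set \<phi>. A \<in> spacetime_sets" "F = (\<lambda>z. \<Sum>(c, A)\<leftarrow>\<phi>. c * indicator A z)"
    "I = (\<lambda>\<omega>. \<Sum>(c, A)\<leftarrow>\<phi>. c * \<xi> A \<omega>)"
    "\<forall>(c, A)\<in>set \<psi>. A \<in> spacetime_sets" "G = (\<lambda>z. \<Sum>(c, A)\<leftarrow>\<psi>. c * indicator A z)"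
    "J = (\<lambda>\<omega>. \<Sum>(c, A)\<leftarrow>\<psi>. c * \<xi> A \<omega>)"
    using assms unfolding simple_wiener_def by blast
  then show ?thesis
    unfolding simple_wiener_def by (intro exI[of _ "\<phi> @ \<psi>"]) auto
qed

lemma simple_wiener_cmult:
  assumes "simple_wiener \<xi> F I"
  shows "simple_wiener \<xi> (\<lambda>z. a * F z) (\<lambda>\<omega>. a * I \<omega>)"
proof -
  obtain \<phi> where \<phi>: "\<forall>(c, A)\<in>set \<phi>. A \<in> spacetime_sets" "F = (\<lambda>z. \<Sum>(c, A)\<leftarrow>\<phi>. c * indicator A z)"
    "I = (\<lambda>\<omega>. \<Sum>(c, A)\<leftarrow>\<phi>. c * \<xi> A \<omega>)"
    using assms unfolding simple_wiener_def by blast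
  have "a * (\<Sum>(c, A)\<leftarrow>\<phi>. c * h A) = (\<Sum>(c, A)\<leftarrow>map (\<lambda>(c, A). (a * c, A)) \<phi>. c * h A)"
    for h :: "(real \<times> real) set \<Rightarrow> real"
    by (induction \<phi>) (auto simp: algebra_simps)
  with \<phi> show ?thesis
    unfolding simple_wiener_def by (intro exI[of _ "map (\<lambda>(c, A). (a * c, A)) \<phi>"]) auto
qed

lemma simple_wiener_diff:
  assumes "simple_wiener \<xi> F I" "simple_wiener \<xi> G J"
  shows "simple_wiener \<xi> (\<lambda>z. F z - G z) (\<lambda>\<omega>. I \<omega> - J \<omega>)"
  using simple_wiener_add[OF assms(1) simple_wiener_cmult[OF assms(2), of "-1"]] by simp

lemma simple_wiener_sum:
  assumes "finite K" "\<And>k. k \<in> K \<Longrightarrow> simple_wiener \<xi> (F k) (I k)"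
  shows "simple_wiener \<xi> (\<lambda>z. \<Sum>k\<in>K. F k z) (\<lambda>\<omega>. \<Sum>k\<in>K. I k \<omega>)"
  using assms
proof (induction K rule: finite_induct)
  case empty
  then show ?case by (simp add: simple_wiener_zero)
next
  case (insert k K)
  then have "simple_wiener \<xi> (\<lambda>z. F k z + (\<Sum>k\<in>K. F k z)) (\<lambda>\<omega>. I k \<omega> + (\<Sum>k\<in>K. I k \<omega>))"
    by (intro simple_wiener_add) auto
  then show ?case using insert by simp
qed

lemma spacetime_sets_Int:
  assumes "A \<in> spacetime_sets" "S \<in> sets borel"
  shows "A \<inter> S \<in> spacetime_sets"
proof -
  have "emeasure lborel (A \<inter> S) \<le> emeasure lborel A"
    using assms by (intro emeasure_mono) (auto simp: spacetime_sets_def)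
  then show ?thesis using assms by (auto simp: spacetime_sets_def)
qed

lemma simple_wiener_restrict:
  assumes "simple_wiener \<xi> F I" and S: "S \<in> sets borel"
  obtains J where "simple_wiener \<xi> (\<lambda>z. F z * indicator S z) J"
proof -
  obtain \<phi> where \<phi>: "\<forall>(c, A)\<in>set \<phi>. A \<in> spacetime_sets" "F = (\<lambda>z. \<Sum>(c, A)\<leftarrow>\<phi>. c * indicator A z)"
    using assms unfolding simple_wiener_def by blast
  have "(\<Sum>(c, A)\<leftarrow>\<phi>. c * indicator A z) * indicator S z
      = (\<Sum>(c, A)\<leftarrow>map (\<lambda>(c, A). (c, A \<inter> S)) \<phi>. c * indicator A z)" for z
    by (induction \<phi>) (auto simp: algebra_simps indicator_inter_arith)
  with \<phi> have "simple_wiener \<xi> (\<lambda>z. F z * indicator S z)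
      (\<lambda>\<omega>. \<Sum>(c, A)\<leftarrow>map (\<lambda>(c, A). (c, A \<inter> S)) \<phi>. c * \<xi> A \<omega>)"
    unfolding simple_wiener_def
    by (intro exI[of _ "map (\<lambda>(c, A). (c, A \<inter> S)) \<phi>"]) (auto intro!: spacetime_sets_Int S)
  then show thesis by (rule that)
qed

text \<open>\<open>white_noise\<close> speaks of sums over finite sets of distinct A, whereas the
  lists behind simple integrals can contain repetitions; here the coefficients of equal sets are
  merged.\<close>

lemma sum_list_collect_coefficients:
  fixes h :: "'b \<Rightarrow> real"
  shows "(\<Sum>(c, A)\<leftarrow>\<phi>. c * h A) = (\<Sum>A\<in>snd ` set \<phi>. (\<Sum>(c, B)\<leftarrow>\<phi>. if B = A then c else 0) * h A)"
proof (induction \<phi>)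
  case (Cons p \<phi>)
  obtain c B where p: "p = (c, B)" by force
  let ?k = "\<lambda>A. \<Sum>(c, B)\<leftarrow>\<phi>. if B = A then c else 0"
  have z: "?k A = 0" if "A \<notin> snd ` set \<phi>" for A
    using that by (induction \<phi>) auto
  have "(\<Sum>A\<in>insert B (snd ` set \<phi>). ((if B = A then c else 0) + ?k A) * h A)
      = (\<Sum>A\<in>insert B (snd ` set \<phi>). (if B = A then c * h A else 0)) + (\<Sum>A\<in>insert B (snd ` set \<phi>). ?k A * h A)"
    by (subst sum.distrib[symmetric]) (auto intro!: sum.cong simp: algebra_simps)
  also have "(\<Sum>A\<in>insert B (snd ` set \<phi>). (if B = A then c * h A else 0)) = c * h B"
    by simp
  also have "(\<Sum>A\<in>insert B (snd ` set \<phi>). ?k A * h A) = (\<Sum>A\<in>snd ` set \<phi>. ?k A * h A)"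
    using z by (cases "B \<in> snd ` set \<phi>") (auto simp: insert_absorb)
  finally show ?case using Cons.IH by (simp add: p)
qed simp

lemma simple_wiener_set_form:
  assumes "simple_wiener \<xi> F I"
  obtains G c where "finite G" "G \<subseteq> spacetime_sets" "F = (\<lambda>z. \<Sum>A\<in>G. c A * indicator A z)"
    "I = (\<lambda>\<omega>. \<Sum>A\<in>G. c A * \<xi> A \<omega>)"
proof -
  obtain \<phi> where \<phi>: "\<forall>(c, A)\<in>set \<phi>. A \<in> spacetime_sets" "F = (\<lambda>z. \<Sum>(c, A)\<leftarrow>\<phi>. c * indicator A z)"
    "I = (\<lambda>\<omega>. \<Sum>(c, A)\<leftarrow>\<phi>. c * \<xi> A \<omega>)"
    using assms unfolding simple_wiener_def by blast
  show thesis
  proof (rule that)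
    show "finite (snd ` set \<phi>)" "snd ` set \<phi> \<subseteq> spacetime_sets" using \<phi>(1) by auto
    show "F = (\<lambda>z. \<Sum>A\<in>snd ` set \<phi>. (\<Sum>(c, B)\<leftarrow>\<phi>. if B = A then c else 0) * indicator A z)"
      unfolding \<phi>(2) by (subst sum_list_collect_coefficients) simp
    show "I = (\<lambda>\<omega>. \<Sum>A\<in>snd ` set \<phi>. (\<Sum>(c, B)\<leftarrow>\<phi>. if B = A then c else 0) * \<xi> A \<omega>)"
      unfolding \<phi>(3) by (rule ext, rule sum_list_collect_coefficients)
  qed
qed

lemma simple_wiener_borel_measurable:
  assumes "simple_wiener \<xi> F I"
  shows "F \<in> borel_measurable borel"
proof -
  from assms obtain G c where "finite G" "G \<subseteq> spacetime_sets" "F = (\<lambda>z. \<Sum>A\<in>G. c A * indicator A z)"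
    by (rule simple_wiener_set_form)
  then show ?thesis
    by (auto intro!: borel_measurable_sum borel_measurable_times borel_measurable_indicator
        simp: spacetime_sets_def simp del: sum_mult_indicator)
qed

section \<open>Isometry and independence for simple Wiener integrals\<close>

locale white_noise_space = prob_space M for M :: "'w measure" +
  fixes \<xi> :: "(real \<times> real) set \<Rightarrow> 'w \<Rightarrow> real"
  assumes white_noise: "white_noise M \<xi>"
begin

lemma simple_wiener_gaussian:
  assumes "simple_wiener \<xi> F I"
  shows "centered_gaussian M I"
proof -
  from assms obtain G c where "finite G" "G \<subseteq> spacetime_sets" "I = (\<lambda>\<omega>. \<Sum>A\<in>G. c A * \<xi> A \<omega>)"
    by (rule simple_wiener_set_form)
  then show ?thesis using white_noise by (auto simp: white_noise_def)
qed

text \<open>Both squares expand into the same double sum, because the covariance of \<xi> A and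
  \<xi> B is the measure of the intersection of A and B, which is also the integral of the product
  of their indicators.\<close>

lemma simple_wiener_isometry:
  assumes "simple_wiener \<xi> F I"
  shows "(\<integral>\<^sup>+\<omega>. ennreal ((I \<omega>)\<^sup>2) \<partial>M) = (\<integral>\<^sup>+z. ennreal ((F z)\<^sup>2) \<partial>lborel)"
    and "(\<integral>\<^sup>+z. ennreal ((F z)\<^sup>2) \<partial>lborel) < \<infinity>"
proof -
  from assms obtain G c where G: "finite G" "G \<subseteq> spacetime_sets"
    and F: "F = (\<lambda>z. \<Sum>A\<in>G. c A * indicator A z)" and I: "I = (\<lambda>\<omega>. \<Sum>A\<in>G. c A * \<xi> A \<omega>)"
    by (rule simple_wiener_set_form)
  have gauss: "centered_gaussian M (\<xi> A)" if "A \<in> G" for A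
  proof -
    have "centered_gaussian M (\<lambda>\<omega>. \<Sum>B\<in>{A}. 1 * \<xi> B \<omega>)"
      using white_noise that G unfolding white_noise_def
      by (elim conjE allE[of _ "{A}"] allE[of _ "\<lambda>_. 1"]) auto
    then show ?thesis by simp
  qed
  have int: "integrable M (\<lambda>\<omega>. c A * c B * (\<xi> A \<omega> * \<xi> B \<omega>))" if "A \<in> G" "B \<in> G" for A B
  proof (rule integrable_mult_right, rule Bochner_Integration.integrable_bound)
    show "integrable M (\<lambda>\<omega>. (\<xi> A \<omega>)\<^sup>2 + (\<xi> B \<omega>)\<^sup>2)"
      using gauss that by (intro Bochner_Integration.integrable_add centered_gaussian_square_integrable) auto
    show "(\<lambda>\<omega>. \<xi> A \<omega> * \<xi> B \<omega>) \<in> borel_measurable M"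
      using gauss that centered_gaussian_measurable by (intro borel_measurable_times) auto
    have "\<bar>x * y\<bar> \<le> x\<^sup>2 + y\<^sup>2" for x y :: real
    proof -
      have "0 \<le> (\<bar>x\<bar> - \<bar>y\<bar>)\<^sup>2" by simp
      also have "\<dots> = x\<^sup>2 + y\<^sup>2 - 2 * \<bar>x * y\<bar>"
        by (simp add: power2_diff abs_mult)
      finally show ?thesis using abs_ge_zero[of "x * y"] by linarith
    qed
    then show "AE \<omega> in M. norm (\<xi> A \<omega> * \<xi> B \<omega>) \<le> norm ((\<xi> A \<omega>)\<^sup>2 + (\<xi> B \<omega>)\<^sup>2)" by simp
  qed
  have AB: "A \<inter> B \<in> sets borel" "emeasure lborel (A \<inter> B) < \<infinity>" if "A \<in> G" "B \<in> G" for A B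
    using spacetime_sets_Int[of A B] that G by (auto simp: spacetime_sets_def)
  have int': "integrable lborel (\<lambda>z. c A * c B * indicator (A \<inter> B) z)" if "A \<in> G" "B \<in> G" for A B
    using AB[OF that] by (intro integrable_mult_right integrable_real_indicator) auto
  have I2: "(I \<omega>)\<^sup>2 = (\<Sum>A\<in>G. \<Sum>B\<in>G. c A * c B * (\<xi> A \<omega> * \<xi> B \<omega>))" for \<omega>
    unfolding I power2_eq_square sum_product by (intro sum.cong) (auto simp: mult_ac)
  have F2: "(F z)\<^sup>2 = (\<Sum>A\<in>G. \<Sum>B\<in>G. c A * c B * indicator (A \<inter> B) z)" for z
    unfolding F power2_eq_square sum_product by (intro sum.cong) (auto simp: indicator_inter_arith)
  have iI: "integrable M (\<lambda>\<omega>. (I \<omega>)\<^sup>2)"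
    unfolding I2 by (intro Bochner_Integration.integrable_sum int)
  have iF: "integrable lborel (\<lambda>z. (F z)\<^sup>2)"
    unfolding F2 by (intro Bochner_Integration.integrable_sum int')
  have "(\<integral>\<omega>. (I \<omega>)\<^sup>2 \<partial>M) = (\<Sum>A\<in>G. \<Sum>B\<in>G. c A * c B * measure lborel (A \<inter> B))"
    unfolding I2
    by (subst Bochner_Integration.integral_sum, intro Bochner_Integration.integrable_sum int, assumption+,
        intro sum.cong refl, subst Bochner_Integration.integral_sum, intro int, assumption+,
        intro sum.cong refl, subst integral_mult_right_zero)
      (use white_noise G in \<open>auto simp: white_noise_def subset_iff\<close>)
  also have "\<dots> = (\<integral>z. (F z)\<^sup>2 \<partial>lborel)"
    unfolding F2
    by (subst Bochner_Integration.integral_sum, intro Bochner_Integration.integrable_sum int', assumption+,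
        intro sum.cong refl, subst Bochner_Integration.integral_sum, intro int', assumption+,
        intro sum.cong refl, subst integral_mult_right_zero) simp
  finally show "(\<integral>\<^sup>+\<omega>. ennreal ((I \<omega>)\<^sup>2) \<partial>M) = (\<integral>\<^sup>+z. ennreal ((F z)\<^sup>2) \<partial>lborel)"
    by (simp add: nn_integral_eq_integral[OF iI] nn_integral_eq_integral[OF iF])
  show "(\<integral>\<^sup>+z. ennreal ((F z)\<^sup>2) \<partial>lborel) < \<infinity>"
    by (simp add: nn_integral_eq_integral[OF iF])
qed

lemma simple_wiener_char:
  assumes "simple_wiener \<xi> F I" "(\<integral>\<^sup>+z. ennreal ((F z)\<^sup>2) \<partial>lborel) = ennreal V" "0 \<le> V"
  shows "(CLINT \<omega>|M. iexp (I \<omega>)) = exp (- V / 2)"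
  using centered_gaussian_char[OF simple_wiener_gaussian[OF assms(1)], of V] assms simple_wiener_isometry(1)[OF assms(1)]
  by simp

text \<open>Mixed terms vanish pointwise, so the variance of any linear combination is the sum of
  the variances. Its Gaussian characteristic function is then a product, as
  \<open>prob_Inter_of_char_factor\<close> requires with the whole space as initial event.\<close>

lemma simple_wiener_disjoint_prob:
  assumes J: "finite J" and sw: "\<And>j. j \<in> J \<Longrightarrow> simple_wiener \<xi> (F j) (W j)"
    and disj: "\<And>i j z. i \<in> J \<Longrightarrow> j \<in> J \<Longrightarrow> i \<noteq> j \<Longrightarrow> F i z * F j z = 0"
    and B: "\<And>j. j \<in> J \<Longrightarrow> B j \<in> sets borel"
  shows "prob {\<omega> \<in> space M. \<forall>j\<in>J. W j \<omega> \<in> B j} = (\<Prod>j\<in>J. prob {\<omega> \<in> space M. W j \<omega> \<in> B j})"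
proof -
  have mW: "W j \<in> borel_measurable M" if "j \<in> J" for j
    using centered_gaussian_measurable[OF simple_wiener_gaussian[OF sw[OF that]]] .
  define V where "V j = enn2real (\<integral>\<^sup>+z. ennreal ((F j z)\<^sup>2) \<partial>lborel)" for j
  have V: "(\<integral>\<^sup>+z. ennreal ((F j z)\<^sup>2) \<partial>lborel) = ennreal (V j)" "0 \<le> V j" if "j \<in> J" for j
    using simple_wiener_isometry(2)[OF sw[OF that]] by (auto simp: V_def)
  have var: "(\<integral>\<^sup>+z. ennreal ((\<Sum>j\<in>J. a j * F j z)\<^sup>2) \<partial>lborel) = ennreal (\<Sum>j\<in>J. (a j)\<^sup>2 * V j)" for a
  proof -
    have "(\<Sum>j\<in>J. a j * F j z)\<^sup>2 = (\<Sum>j\<in>J. (a j)\<^sup>2 * (F j z)\<^sup>2)" for z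
    proof -
      have "(\<Sum>j\<in>J. a j * F j z)\<^sup>2 = (\<Sum>i\<in>J. \<Sum>j\<in>J. (a i * F i z) * (a j * F j z))"
        by (simp add: power2_eq_square sum_product)
      also have "\<dots> = (\<Sum>i\<in>J. \<Sum>j\<in>J. if i = j then (a i)\<^sup>2 * (F i z)\<^sup>2 else 0)"
        using disj[of _ _ z] by (intro sum.cong refl) (auto simp: power2_eq_square simp del: split_paired_All)
      also have "\<dots> = (\<Sum>j\<in>J. (a j)\<^sup>2 * (F j z)\<^sup>2)" using J by simp
      finally show ?thesis .
    qed
    then have "(\<integral>\<^sup>+z. ennreal ((\<Sum>j\<in>J. a j * F j z)\<^sup>2) \<partial>lborel)
        = (\<integral>\<^sup>+z. (\<Sum>j\<in>J. ennreal ((a j)\<^sup>2) * ennreal ((F j z)\<^sup>2)) \<partial>lborel)"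
      by (intro nn_integral_cong) (simp add: sum_ennreal ennreal_mult[symmetric])
    also have "\<dots> = (\<Sum>j\<in>J. ennreal ((a j)\<^sup>2) * ennreal (V j))"
      using simple_wiener_borel_measurable[OF sw] 
      by (subst nn_integral_sum) (auto intro!: sum.cong simp: nn_integral_cmult V)
    also have "\<dots> = ennreal (\<Sum>j\<in>J. (a j)\<^sup>2 * V j)"
      using V by (subst sum_ennreal[symmetric]) (auto simp: ennreal_mult)
    finally show ?thesis .
  qed
  have char1: "(CLINT \<omega>|M. iexp (a * W j \<omega>)) = exp (- (a\<^sup>2 * V j) / 2)" if "j \<in> J" for a j
  proof (rule simple_wiener_char[OF simple_wiener_cmult[OF sw[OF that]]])
    show "(\<integral>\<^sup>+z. ennreal ((a * F j z)\<^sup>2) \<partial>lborel) = ennreal (a\<^sup>2 * V j)"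
      using simple_wiener_borel_measurable[OF sw] that
      by (simp add: power_mult_distrib ennreal_mult nn_integral_cmult V)
  qed (use V that in simp)
  have fac: "(CLINT \<omega>|M. iexp (\<Sum>j\<in>J. a j * W j \<omega>)) = (\<Prod>j\<in>J. CLINT \<omega>|M. iexp (a j * W j \<omega>))" for a
  proof -
    have "(CLINT \<omega>|M. iexp (\<Sum>j\<in>J. a j * W j \<omega>)) = exp (- (\<Sum>j\<in>J. (a j)\<^sup>2 * V j) / 2)"
      by (rule simple_wiener_char[OF simple_wiener_sum[OF J simple_wiener_cmult[OF sw]]])
        (use V in \<open>auto simp: var intro!: sum_nonneg\<close>)
    also have "\<dots> = (\<Prod>j\<in>J. exp (- ((a j)\<^sup>2 * V j) / 2))"
      using J by (simp add: exp_sum[symmetric] sum_negf sum_divide_distrib)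
    also have "\<dots> = (\<Prod>j\<in>J. CLINT \<omega>|M. iexp (a j * W j \<omega>))"
      unfolding of_real_prod by (intro prod.cong refl char1[symmetric])
    finally show ?thesis .
  qed
  have "prob (space M \<inter> {\<omega> \<in> space M. \<forall>j\<in>J. W j \<omega> \<in> B j})
      = prob (space M) * (\<Prod>j\<in>J. prob {\<omega> \<in> space M. W j \<omega> \<in> B j})"
  proof (rule prob_Inter_of_char_factor[OF J mW B])
    show "(CLINT \<omega>|M. indicator (space M) \<omega> * iexp (\<Sum>j\<in>J. a j * W j \<omega>))
        = prob (space M) * (\<Prod>j\<in>J. CLINT \<omega>|M. iexp (a j * W j \<omega>))" for a
      unfolding fac[symmetric] prob_space
      by (simp cong: Bochner_Integration.integral_cong)
  qed auto
  then show ?thesis by (simp add: prob_space Int_absorb2[of "_ :: 'w set"] Int_def)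
qed

end

text \<open>A weakening of \<open>wiener_integral\<close> for which closure under linear combinations needs no choice of
  sequences.\<close>

definition wiener_approx ::
  "'w measure \<Rightarrow> ((real \<times> real) set \<Rightarrow> 'w \<Rightarrow> real) \<Rightarrow> (real \<times> real \<Rightarrow> real) \<Rightarrow> ('w \<Rightarrow> real) \<Rightarrow> bool" where
  "wiener_approx M \<xi> f Y \<longleftrightarrow> f \<in> borel_measurable borel \<and> Y \<in> borel_measurable M \<and>
     (\<forall>\<epsilon>>0. \<exists>F I. simple_wiener \<xi> F I \<and>
        (\<integral>\<^sup>+z. ennreal ((F z - f z)\<^sup>2) \<partial>lborel) \<le> ennreal \<epsilon> \<and>
        (\<integral>\<^sup>+\<omega>. ennreal ((I \<omega> - Y \<omega>)\<^sup>2) \<partial>M) \<le> ennreal \<epsilon>)"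

lemma wiener_integral_approx:
  assumes "wiener_integral M \<xi> f Y"
  shows "wiener_approx M \<xi> f Y"
proof -
  obtain \<phi> :: "nat \<Rightarrow> (real \<times> (real \<times> real) set) list" where
    \<phi>: "\<And>n. \<forall>(c, A)\<in>set (\<phi> n). A \<in> spacetime_sets"
    and lim: "(\<lambda>n. \<integral>\<^sup>+z. ennreal (((\<Sum>(c, A)\<leftarrow>\<phi> n. c * indicator A z) - f z)\<^sup>2) \<partial>lborel) \<longlonglongrightarrow> 0"
      "(\<lambda>n. \<integral>\<^sup>+\<omega>. ennreal (((\<Sum>(c, A)\<leftarrow>\<phi> n. c * \<xi> A \<omega>) - Y \<omega>)\<^sup>2) \<partial>M) \<longlonglongrightarrow> 0"
    using assms unfolding wiener_integral_def by blast
  have "\<exists>F I. simple_wiener \<xi> F I \<and>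
        (\<integral>\<^sup>+z. ennreal ((F z - f z)\<^sup>2) \<partial>lborel) \<le> ennreal \<epsilon> \<and>
        (\<integral>\<^sup>+\<omega>. ennreal ((I \<omega> - Y \<omega>)\<^sup>2) \<partial>M) \<le> ennreal \<epsilon>" if "\<epsilon> > 0" for \<epsilon>
  proof -
    have e: "(0::ennreal) < ennreal \<epsilon>" using that by simp
    have "\<exists>n. (\<integral>\<^sup>+z. ennreal (((\<Sum>(c, A)\<leftarrow>\<phi> n. c * indicator A z) - f z)\<^sup>2) \<partial>lborel) < ennreal \<epsilon> \<and>
       (\<integral>\<^sup>+\<omega>. ennreal (((\<Sum>(c, A)\<leftarrow>\<phi> n. c * \<xi> A \<omega>) - Y \<omega>)\<^sup>2) \<partial>M) < ennreal \<epsilon>"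
      using eventually_happens[OF eventually_conj[OF order_tendstoD(2)[OF lim(1) e] order_tendstoD(2)[OF lim(2) e]]]
      by simp
    then obtain n where "(\<integral>\<^sup>+z. ennreal (((\<Sum>(c, A)\<leftarrow>\<phi> n. c * indicator A z) - f z)\<^sup>2) \<partial>lborel) < ennreal \<epsilon>"
       "(\<integral>\<^sup>+\<omega>. ennreal (((\<Sum>(c, A)\<leftarrow>\<phi> n. c * \<xi> A \<omega>) - Y \<omega>)\<^sup>2) \<partial>M) < ennreal \<epsilon>" by blast
    moreover have "simple_wiener \<xi> (\<lambda>z. \<Sum>(c, A)\<leftarrow>\<phi> n. c * indicator A z) (\<lambda>\<omega>. \<Sum>(c, A)\<leftarrow>\<phi> n. c * \<xi> A \<omega>)"
      unfolding simple_wiener_def using \<phi> by blast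
    ultimately show ?thesis by (meson less_imp_le)
  qed
  then show ?thesis using assms by (auto simp: wiener_approx_def wiener_integral_def)
qed

context white_noise_space
begin

lemma wiener_approx_diff:
  assumes f: "wiener_approx M \<xi> f Y" and g: "wiener_approx M \<xi> g Z"
  shows "wiener_approx M \<xi> (\<lambda>z. f z - g z) (\<lambda>\<omega>. Y \<omega> - Z \<omega>)"
  unfolding wiener_approx_def
proof (intro conjI allI impI)
  have [measurable]: "f \<in> borel_measurable borel" "g \<in> borel_measurable borel"
    "Y \<in> borel_measurable M" "Z \<in> borel_measurable M"
    using assms by (auto simp: wiener_approx_def)
  show "(\<lambda>z. f z - g z) \<in> borel_measurable borel" "(\<lambda>\<omega>. Y \<omega> - Z \<omega>) \<in> borel_measurable M" by simp_all
  fix \<epsilon> :: real assume e: "0 < \<epsilon>"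
  then have e4: "0 < \<epsilon> / 4" by simp
  obtain F I where FI: "simple_wiener \<xi> F I" "(\<integral>\<^sup>+z. ennreal ((F z - f z)\<^sup>2) \<partial>lborel) \<le> ennreal (\<epsilon> / 4)"
    "(\<integral>\<^sup>+\<omega>. ennreal ((I \<omega> - Y \<omega>)\<^sup>2) \<partial>M) \<le> ennreal (\<epsilon> / 4)"
    using f e4 unfolding wiener_approx_def by blast
  obtain G J where GJ: "simple_wiener \<xi> G J" "(\<integral>\<^sup>+z. ennreal ((G z - g z)\<^sup>2) \<partial>lborel) \<le> ennreal (\<epsilon> / 4)"
    "(\<integral>\<^sup>+\<omega>. ennreal ((J \<omega> - Z \<omega>)\<^sup>2) \<partial>M) \<le> ennreal (\<epsilon> / 4)"
    using g e4 unfolding wiener_approx_def by blast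
  have [measurable]: "F \<in> borel_measurable borel" "G \<in> borel_measurable borel"
    "I \<in> borel_measurable M" "J \<in> borel_measurable M"
    using FI(1) GJ(1) simple_wiener_borel_measurable simple_wiener_gaussian centered_gaussian_measurable by blast+
  have sym: "(a - b)\<^sup>2 = (b - a)\<^sup>2" for a b :: real by (simp add: power2_commute)
  have "(\<integral>\<^sup>+z. ennreal (((F z - f z) + (g z - G z))\<^sup>2) \<partial>lborel) \<le> ennreal ((1 + 1) * (\<epsilon> / 4) + (1 + 1 / 1) * (\<epsilon> / 4))"
    by (rule nn_integral_square_add_bound) (use FI GJ e in \<open>auto simp: sym[of "g _"]\<close>)
  moreover have "(\<integral>\<^sup>+\<omega>. ennreal (((I \<omega> - Y \<omega>) + (Z \<omega> - J \<omega>))\<^sup>2) \<partial>M) \<le> ennreal ((1 + 1) * (\<epsilon> / 4) + (1 + 1 / 1) * (\<epsilon> / 4))"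
    by (rule nn_integral_square_add_bound) (use FI GJ e in \<open>auto simp: sym[of "Z _"]\<close>)
  ultimately show "\<exists>F I. simple_wiener \<xi> F I \<and>
        (\<integral>\<^sup>+z. ennreal ((F z - (f z - g z))\<^sup>2) \<partial>lborel) \<le> ennreal \<epsilon> \<and>
        (\<integral>\<^sup>+\<omega>. ennreal ((I \<omega> - (Y \<omega> - Z \<omega>))\<^sup>2) \<partial>M) \<le> ennreal \<epsilon>"
    using simple_wiener_diff[OF FI(1) GJ(1)]
    by (intro exI[of _ "\<lambda>z. F z - G z"] exI[of _ "\<lambda>\<omega>. I \<omega> - J \<omega>"]) (simp add: algebra_simps)
qed

lemma wiener_approx_cmult:
  assumes f: "wiener_approx M \<xi> f Y"
  shows "wiener_approx M \<xi> (\<lambda>z. a * f z) (\<lambda>\<omega>. a * Y \<omega>)"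
  unfolding wiener_approx_def
proof (intro conjI allI impI)
  have [measurable]: "f \<in> borel_measurable borel" "Y \<in> borel_measurable M"
    using assms by (auto simp: wiener_approx_def)
  show "(\<lambda>z. a * f z) \<in> borel_measurable borel" "(\<lambda>\<omega>. a * Y \<omega>) \<in> borel_measurable M" by simp_all
  fix \<epsilon> :: real assume e: "0 < \<epsilon>"
  define d where "d = \<epsilon> / (a\<^sup>2 + 1)"
  have d: "0 < d" using e by (simp add: d_def add_nonneg_pos)
  have ad: "a\<^sup>2 * d \<le> \<epsilon>" proof -
    have "a\<^sup>2 * d = \<epsilon> * (a\<^sup>2 / (a\<^sup>2 + 1))" by (simp add: d_def)
    also have "\<dots> \<le> \<epsilon> * 1" using e by (intro mult_left_mono) (auto simp: divide_le_eq_1 add_nonneg_pos)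
    finally show ?thesis by simp
  qed
  obtain F I where FI: "simple_wiener \<xi> F I" "(\<integral>\<^sup>+z. ennreal ((F z - f z)\<^sup>2) \<partial>lborel) \<le> ennreal d"
    "(\<integral>\<^sup>+\<omega>. ennreal ((I \<omega> - Y \<omega>)\<^sup>2) \<partial>M) \<le> ennreal d"
    using f d unfolding wiener_approx_def by blast
  have [measurable]: "F \<in> borel_measurable borel" "I \<in> borel_measurable M"
    using FI(1) simple_wiener_borel_measurable simple_wiener_gaussian centered_gaussian_measurable by blast+
  have sc: "(\<integral>\<^sup>+x. ennreal ((a * u x - a * v x)\<^sup>2) \<partial>N) \<le> ennreal \<epsilon>"
    if [measurable]: "u \<in> borel_measurable N" "v \<in> borel_measurable N"
      and le: "(\<integral>\<^sup>+x. ennreal ((u x - v x)\<^sup>2) \<partial>N) \<le> ennreal d" for u v :: "'c \<Rightarrow> real" and N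
  proof -
    have "(\<integral>\<^sup>+x. ennreal ((a * u x - a * v x)\<^sup>2) \<partial>N) = ennreal (a\<^sup>2) * (\<integral>\<^sup>+x. ennreal ((u x - v x)\<^sup>2) \<partial>N)"
      by (subst nn_integral_cmult[symmetric])
        (auto simp: ennreal_mult[symmetric] power_mult_distrib[symmetric] right_diff_distrib)
    also have "\<dots> \<le> ennreal (a\<^sup>2) * ennreal d" by (intro mult_left_mono le) simp
    also have "\<dots> \<le> ennreal \<epsilon>" using ad d by (simp add: ennreal_mult[symmetric] ennreal_leI)
    finally show ?thesis .
  qed
  show "\<exists>F I. simple_wiener \<xi> F I \<and>
        (\<integral>\<^sup>+z. ennreal ((F z - a * f z)\<^sup>2) \<partial>lborel) \<le> ennreal \<epsilon> \<and>
        (\<integral>\<^sup>+\<omega>. ennreal ((I \<omega> - a * Y \<omega>)\<^sup>2) \<partial>M) \<le> ennreal \<epsilon>"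
    using simple_wiener_cmult[OF FI(1), of a] FI(2,3)
    by (intro exI[of _ "\<lambda>z. a * F z"] exI[of _ "\<lambda>\<omega>. a * I \<omega>"]) (auto intro!: sc)
qed

end

section \<open>Gaussian tails and non-exceedance for mean-square limits\<close>

context white_noise_space
begin

text \<open>Instead of identifying the law of Y, the Gaussian tail of a simple integral I near Y is
  used: |Y| > a forces |I| > a - \<eta> or |I - Y| \<ge> \<eta>. Letting \<eta> tend to 0 recovers
  the exact exponent.\<close>

lemma wiener_approx_tail:
  assumes Y: "wiener_approx M \<xi> f Y" and V: "(\<integral>\<^sup>+z. ennreal ((f z)\<^sup>2) \<partial>lborel) \<le> ennreal V" "0 < V"
    and a: "0 \<le> a"
  shows "prob {\<omega> \<in> space M. a < \<bar>Y \<omega>\<bar>} \<le> 2 * exp (- a\<^sup>2 / (2 * V))"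
proof (cases "a = 0")
  case True
  have "prob {\<omega> \<in> space M. a < \<bar>Y \<omega>\<bar>} \<le> 2" by (rule order_trans[OF prob_le_1]) simp
  then show ?thesis using True by simp
next
  case False
  then have a: "0 < a" using a by simp
  have [measurable]: "f \<in> borel_measurable borel" "Y \<in> borel_measurable M"
    using Y by (auto simp: wiener_approx_def)
  let ?h = "\<lambda>\<eta>. 2 * exp (- (a - \<eta>)\<^sup>2 / (2 * ((1 + \<eta>) * V + (1 + 1 / \<eta>) * \<eta>^3))) + \<eta>"
  have le: "prob {\<omega> \<in> space M. a < \<bar>Y \<omega>\<bar>} \<le> ?h \<eta>" if \<eta>: "0 < \<eta>" "\<eta> < a" for \<eta>
  proof -
    \<comment> \<open>The accuracy \<eta>^3 makes the Chebyshev bound \<eta>^3/\<eta>^2 = \<eta>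
      vanish together with the variance correction (1 + 1/\<eta>) \<eta>^3.\<close>
    have e3: "0 < \<eta>^3" using \<eta> by simp
    obtain F I where FI: "simple_wiener \<xi> F I" "(\<integral>\<^sup>+z. ennreal ((F z - f z)\<^sup>2) \<partial>lborel) \<le> ennreal (\<eta>^3)"
      "(\<integral>\<^sup>+\<omega>. ennreal ((I \<omega> - Y \<omega>)\<^sup>2) \<partial>M) \<le> ennreal (\<eta>^3)"
      using Y e3 unfolding wiener_approx_def by blast
    have [measurable]: "F \<in> borel_measurable borel" "I \<in> borel_measurable M"
      using FI(1) simple_wiener_borel_measurable simple_wiener_gaussian centered_gaussian_measurable by blast+
    let ?V = "(1 + \<eta>) * V + (1 + 1 / \<eta>) * \<eta>^3"
    have "(\<integral>\<^sup>+z. ennreal ((f z + (F z - f z))\<^sup>2) \<partial>lborel) \<le> ennreal ?V"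
      by (rule nn_integral_square_add_bound) (use \<eta> V FI in auto)
    then have "(\<integral>\<^sup>+\<omega>. ennreal ((I \<omega>)\<^sup>2) \<partial>M) \<le> ennreal ?V"
      using simple_wiener_isometry(1)[OF FI(1)] by simp
    then have tail: "prob {\<omega> \<in> space M. a - \<eta> < \<bar>I \<omega>\<bar>} \<le> 2 * exp (- (a - \<eta>)\<^sup>2 / (2 * ?V))"
      using \<eta> V by (intro centered_gaussian_tail simple_wiener_gaussian[OF FI(1)]) (auto intro!: add_pos_pos mult_pos_pos)
    have "prob {\<omega> \<in> space M. \<eta> \<le> \<bar>I \<omega> - Y \<omega>\<bar>} \<le> \<eta>^3 / \<eta>\<^sup>2"
      by (rule square_markov) (use FI \<eta> in auto)
    then have dev: "prob {\<omega> \<in> space M. \<eta> \<le> \<bar>I \<omega> - Y \<omega>\<bar>} \<le> \<eta>"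
      using \<eta> by (simp add: power2_eq_square power3_eq_cube)
    have "prob {\<omega> \<in> space M. a < \<bar>Y \<omega>\<bar>}
        \<le> prob ({\<omega> \<in> space M. a - \<eta> < \<bar>I \<omega>\<bar>} \<union> {\<omega> \<in> space M. \<eta> \<le> \<bar>I \<omega> - Y \<omega>\<bar>})"
      by (rule finite_measure_mono) auto
    also have "\<dots> \<le> prob {\<omega> \<in> space M. a - \<eta> < \<bar>I \<omega>\<bar>} + prob {\<omega> \<in> space M. \<eta> \<le> \<bar>I \<omega> - Y \<omega>\<bar>}"
      by (rule measure_Un_le) auto
    finally show ?thesis using tail dev by linarith
  qed
  have "(?h \<longlongrightarrow> 2 * exp (- (a\<^sup>2 * inverse V / 2))) (at_right 0)"
    using V(2) a by real_asymp
  then have "(?h \<longlongrightarrow> 2 * exp (- a\<^sup>2 / (2 * V))) (at_right 0)"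
    by (simp add: field_simps)
  moreover have "eventually (\<lambda>\<eta>. prob {\<omega> \<in> space M. a < \<bar>Y \<omega>\<bar>} \<le> ?h \<eta>) (at_right 0)"
    unfolding eventually_at_right_field using a le by (intro exI[of _ a]) auto
  ultimately show ?thesis by (rule tendsto_lowerbound) simp
qed

text \<open>As for the upper tail, but the lower Gaussian bound contains the variance V of the
  approximant both in the exponent and in the normalising factor, so V has to be controlled from
  both sides: \<open>?u\<close> bounds F by f, and \<open>?l\<close> comes from bounding f by F and
  solving for V.\<close>

lemma wiener_approx_lower_tail:
  assumes Y: "wiener_approx M \<xi> f Y" and V: "(\<integral>\<^sup>+z. ennreal ((f z)\<^sup>2) \<partial>lborel) = 1"
    and a: "0 \<le> a"
  shows "exp (- (a + 1)\<^sup>2 / 2) / sqrt (2 * pi) \<le> prob {\<omega> \<in> space M. a < Y \<omega>}"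
proof -
  have [measurable]: "f \<in> borel_measurable borel" "Y \<in> borel_measurable M"
    using Y by (auto simp: wiener_approx_def)
  let ?u = "\<lambda>\<eta>. (1 + \<eta>) * 1 + (1 + 1 / \<eta>) * \<eta>^3"
  let ?l = "\<lambda>\<eta>. (1 - (1 + 1 / \<eta>) * \<eta>^3) / (1 + \<eta>)"
  let ?h = "\<lambda>\<eta>. exp (- (a + \<eta> + 1)\<^sup>2 / (2 * ?l \<eta>)) / sqrt (2 * pi * ?u \<eta>) - \<eta>"
  have le: "?h \<eta> \<le> prob {\<omega> \<in> space M. a < Y \<omega>}" if \<eta>: "0 < \<eta>" "0 < ?l \<eta>" for \<eta>
  proof -
    have e3: "0 < \<eta>^3" using \<eta> by simp
    obtain F I where FI: "simple_wiener \<xi> F I" "(\<integral>\<^sup>+z. ennreal ((F z - f z)\<^sup>2) \<partial>lborel) \<le> ennreal (\<eta>^3)"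
      "(\<integral>\<^sup>+\<omega>. ennreal ((I \<omega> - Y \<omega>)\<^sup>2) \<partial>M) \<le> ennreal (\<eta>^3)"
      using Y e3 unfolding wiener_approx_def by blast
    have [measurable]: "F \<in> borel_measurable borel" "I \<in> borel_measurable M"
      using FI(1) simple_wiener_borel_measurable simple_wiener_gaussian centered_gaussian_measurable by blast+
    define V where "V = enn2real (\<integral>\<^sup>+z. ennreal ((F z)\<^sup>2) \<partial>lborel)"
    have V: "(\<integral>\<^sup>+z. ennreal ((F z)\<^sup>2) \<partial>lborel) = ennreal V" "0 \<le> V"
      using simple_wiener_isometry(2)[OF FI(1)] by (auto simp: V_def)
    have "(\<integral>\<^sup>+z. ennreal ((f z + (F z - f z))\<^sup>2) \<partial>lborel) \<le> ennreal (?u \<eta>)"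
      by (rule nn_integral_square_add_bound) (use \<eta> \<open>_ = 1\<close> FI in auto)
    moreover have "f z + (F z - f z) = F z" for z by simp
    ultimately have "ennreal V \<le> ennreal (?u \<eta>)" by (simp only: V)
    moreover have "0 \<le> ?u \<eta>" using \<eta> by (simp add: add_nonneg_nonneg)
    ultimately have Vu: "V \<le> ?u \<eta>" by (simp only: ennreal_le_iff)
    have "(\<integral>\<^sup>+z. ennreal ((F z + (f z - F z))\<^sup>2) \<partial>lborel) \<le> ennreal ((1 + \<eta>) * V + (1 + 1 / \<eta>) * \<eta>^3)"
      by (rule nn_integral_square_add_bound) (use \<eta> V FI in \<open>auto simp: power2_commute[of "f _"]\<close>)
    moreover have "F z + (f z - F z) = f z" for z by simp
    ultimately have "ennreal 1 \<le> ennreal ((1 + \<eta>) * V + (1 + 1 / \<eta>) * \<eta>^3)"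
      by (simp only: \<open>_ = 1\<close> ennreal_1)
    moreover have "0 \<le> (1 + \<eta>) * V + (1 + 1 / \<eta>) * \<eta>^3" using V \<eta> by (simp add: add_nonneg_nonneg)
    ultimately have "1 \<le> (1 + \<eta>) * V + (1 + 1 / \<eta>) * \<eta>^3" by (simp only: ennreal_le_iff)
    then have Vl: "?l \<eta> \<le> V" using \<eta> by (simp add: pos_divide_le_eq mult.commute)
    have aux: "- b\<^sup>2 / (2 * l) \<le> - b\<^sup>2 / (2 * v)" if "0 < l" "l \<le> v" for b l v :: real
      using that by (intro divide_left_mono_neg) auto
    have V0: "0 < V" using Vl \<eta> by linarith
    have "exp (- (a + \<eta> + 1)\<^sup>2 / (2 * ?l \<eta>)) / sqrt (2 * pi * ?u \<eta>)
        \<le> exp (- (a + \<eta> + 1)\<^sup>2 / (2 * V)) / sqrt (2 * pi * V)"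
    proof (rule frac_le)
      have "- (a + \<eta> + 1)\<^sup>2 / (2 * ?l \<eta>) \<le> - (a + \<eta> + 1)\<^sup>2 / (2 * V)"
        by (rule aux[OF \<eta>(2) Vl])
      then show "exp (- (a + \<eta> + 1)\<^sup>2 / (2 * ?l \<eta>)) \<le> exp (- (a + \<eta> + 1)\<^sup>2 / (2 * V))" by simp
    qed (use V0 Vu in auto)
    also have "\<dots> \<le> prob {\<omega> \<in> space M. a + \<eta> < I \<omega>}"
      using \<eta> a V V0 simple_wiener_isometry(1)[OF FI(1)]
      by (intro centered_gaussian_lower_tail simple_wiener_gaussian[OF FI(1)]) auto
    finally have tail: "exp (- (a + \<eta> + 1)\<^sup>2 / (2 * ?l \<eta>)) / sqrt (2 * pi * ?u \<eta>) \<le> prob {\<omega> \<in> space M. a + \<eta> < I \<omega>}" .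
    have "prob {\<omega> \<in> space M. \<eta> \<le> \<bar>I \<omega> - Y \<omega>\<bar>} \<le> \<eta>^3 / \<eta>\<^sup>2"
      by (rule square_markov) (use FI \<eta> in auto)
    then have dev: "prob {\<omega> \<in> space M. \<eta> \<le> \<bar>I \<omega> - Y \<omega>\<bar>} \<le> \<eta>"
      using \<eta> by (simp add: power2_eq_square power3_eq_cube)
    have "prob {\<omega> \<in> space M. a + \<eta> < I \<omega>}
        \<le> prob ({\<omega> \<in> space M. a < Y \<omega>} \<union> {\<omega> \<in> space M. \<eta> \<le> \<bar>I \<omega> - Y \<omega>\<bar>})"
      by (rule finite_measure_mono) auto
    also have "\<dots> \<le> prob {\<omega> \<in> space M. a < Y \<omega>} + prob {\<omega> \<in> space M. \<eta> \<le> \<bar>I \<omega> - Y \<omega>\<bar>}"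
      by (rule measure_Un_le) auto
    finally show ?thesis using tail dev by linarith
  qed
  have "(?h \<longlongrightarrow> exp (- ((a + 1)\<^sup>2 / 2)) * inverse ((2 * pi) powr (1 / 2))) (at_right 0)"
    using a by real_asymp
  moreover have "exp (- ((a + 1)\<^sup>2 / 2)) * inverse ((2 * pi) powr (1 / 2)) = exp (- (a + 1)\<^sup>2 / 2) / sqrt (2 * pi)"
    using powr_half_sqrt[of "2 * pi"] pi_ge_zero by (metis divide_inverse minus_divide_left mult_nonneg_nonneg zero_le_numeral)
  ultimately have "(?h \<longlongrightarrow> exp (- (a + 1)\<^sup>2 / 2) / sqrt (2 * pi)) (at_right 0)"
    by (simp only:)
  moreover have "eventually (\<lambda>\<eta>::real. 0 < ?l \<eta>) (at_right 0)" by real_asymp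
  then have "eventually (\<lambda>\<eta>. ?h \<eta> \<le> prob {\<omega> \<in> space M. a < Y \<omega>}) (at_right 0)"
    using eventually_at_right_less[of "0::real"] by eventually_elim (rule le)
  ultimately show ?thesis by (rule tendsto_upperbound) simp
qed

text \<open>Cutting the kernels off to the disjoint sets \<open>S j\<close> makes the integrals independent at the price of
  an \<open>L\<^sup>2\<close> error.\<close>

lemma prob_no_exceedance:
  assumes J: "finite J" and X: "\<And>j. j \<in> J \<Longrightarrow> wiener_approx M \<xi> (f j) (X j)"
    and S: "\<And>j. j \<in> J \<Longrightarrow> S j \<in> sets borel" and disj: "disjoint_family_on S J"
    and one: "\<And>j. j \<in> J \<Longrightarrow> (\<integral>\<^sup>+z. ennreal ((f j z)\<^sup>2) \<partial>lborel) = 1"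
    and cut: "\<And>j. j \<in> J \<Longrightarrow> (\<integral>\<^sup>+z. ennreal ((f j z * indicator (- S j) z)\<^sup>2) \<partial>lborel) \<le> ennreal d"
    and d: "0 < d" and a: "0 \<le> a"
  shows "prob {\<omega> \<in> space M. \<forall>j\<in>J. X j \<omega> \<le> a}
    \<le> exp (- real (card J) * (exp (- (a + 2)\<^sup>2 / 2) / sqrt (2 * pi) - 40 * d)) + real (card J) * (40 * d)"
proof -
  let ?q = "exp (- (a + 2)\<^sup>2 / 2) / sqrt (2 * pi)"
  have mX: "X j \<in> borel_measurable M" if "j \<in> J" for j
    using X[OF that] by (auto simp: wiener_approx_def)
  \<comment> \<open>Constants: approximation and cutoff contribute d each, so W - I has mean square
    at most 2d + 2d = 4d; then W - X is at most 2(4d) + 2d = 10d, and Chebyshev at level 1/2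
    multiplies by 4.\<close>
  have "\<exists>F W. simple_wiener \<xi> (\<lambda>z. F z * indicator (S j) z) W
      \<and> prob {\<omega> \<in> space M. 1/2 \<le> \<bar>W \<omega> - X j \<omega>\<bar>} \<le> 40 * d" if j: "j \<in> J" for j
  proof -
    obtain F I where FI: "simple_wiener \<xi> F I" "(\<integral>\<^sup>+z. ennreal ((F z - f j z)\<^sup>2) \<partial>lborel) \<le> ennreal d"
      "(\<integral>\<^sup>+\<omega>. ennreal ((I \<omega> - X j \<omega>)\<^sup>2) \<partial>M) \<le> ennreal d"
      using X[OF j] d unfolding wiener_approx_def by blast
    obtain W where W: "simple_wiener \<xi> (\<lambda>z. F z * indicator (S j) z) W"
      using simple_wiener_restrict[OF FI(1) S[OF j]] .
    have [measurable]: "F \<in> borel_measurable borel" "I \<in> borel_measurable M" "W \<in> borel_measurable M"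
      "f j \<in> borel_measurable borel" "X j \<in> borel_measurable M" "S j \<in> sets borel"
      using FI(1) W simple_wiener_borel_measurable simple_wiener_gaussian centered_gaussian_measurable
        X[OF j] S[OF j] unfolding wiener_approx_def by blast+
    have sub: "(\<integral>\<^sup>+z. ennreal (((F z - f j z) * indicator (- S j) z)\<^sup>2) \<partial>lborel) \<le> ennreal d"
      by (rule order.trans[OF nn_integral_mono FI(2)]) (auto simp: indicator_def)
    have "(\<integral>\<^sup>+z. ennreal (((F z - f j z) * indicator (- S j) z + f j z * indicator (- S j) z)\<^sup>2) \<partial>lborel)
        \<le> ennreal ((1 + 1) * d + (1 + 1 / 1) * d)"
      by (rule nn_integral_square_add_bound) (use sub cut[OF j] d in auto)
    moreover have "((F z - f j z) * indicator (- S j) z + f j z * indicator (- S j) z)\<^sup>2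
        = (F z * indicator (S j) z - F z)\<^sup>2" for z
      by (auto simp: indicator_def)
    ultimately have "(\<integral>\<^sup>+z. ennreal ((F z * indicator (S j) z - F z)\<^sup>2) \<partial>lborel) \<le> ennreal (4 * d)"
      by simp
    then have WI: "(\<integral>\<^sup>+\<omega>. ennreal ((W \<omega> - I \<omega>)\<^sup>2) \<partial>M) \<le> ennreal (4 * d)"
      using simple_wiener_isometry(1)[OF simple_wiener_diff[OF W FI(1)]] by simp
    have "(\<integral>\<^sup>+\<omega>. ennreal (((W \<omega> - I \<omega>) + (I \<omega> - X j \<omega>))\<^sup>2) \<partial>M) \<le> ennreal ((1 + 1) * (4 * d) + (1 + 1 / 1) * d)"
      by (rule nn_integral_square_add_bound) (use FI WI d in auto)
    then have "prob {\<omega> \<in> space M. 1/2 \<le> \<bar>W \<omega> - X j \<omega>\<bar>} \<le> (10 * d) / (1/2)\<^sup>2"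
      using d by (intro square_markov) auto
    then show ?thesis using W by (intro exI[of _ F] exI[of _ W]) (simp add: power2_eq_square)
  qed
  then have "\<forall>j\<in>J. \<exists>F W. simple_wiener \<xi> (\<lambda>z. F z * indicator (S j) z) W
      \<and> prob {\<omega> \<in> space M. 1/2 \<le> \<bar>W \<omega> - X j \<omega>\<bar>} \<le> 40 * d" by blast
  from bchoice[OF this] obtain F where "\<forall>j\<in>J. \<exists>W. simple_wiener \<xi> (\<lambda>z. F j z * indicator (S j) z) W
      \<and> prob {\<omega> \<in> space M. 1/2 \<le> \<bar>W \<omega> - X j \<omega>\<bar>} \<le> 40 * d" by blast
  from bchoice[OF this] obtain W where W: "\<And>j. j \<in> J \<Longrightarrow> simple_wiener \<xi> (\<lambda>z. F j z * indicator (S j) z) (W j)"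
    and close: "\<And>j. j \<in> J \<Longrightarrow> prob {\<omega> \<in> space M. 1/2 \<le> \<bar>W j \<omega> - X j \<omega>\<bar>} \<le> 40 * d"
    by blast
  have mW: "W j \<in> borel_measurable M" if "j \<in> J" for j
    using centered_gaussian_measurable[OF simple_wiener_gaussian[OF W[OF that]]] .
  have single: "prob {\<omega> \<in> space M. W j \<omega> \<in> {..a + 1/2}} \<le> exp (- (?q - 40 * d))" if j: "j \<in> J" for j
  proof -
    have [measurable]: "W j \<in> borel_measurable M" "X j \<in> borel_measurable M" using mW mX j by auto
    \<comment> \<open>The level a + 1/2 for W lies midway between a and a + 1: up to an error of
      1/2, X above a + 1 forces W above it, and X at most a forces W at most it. One unit of a + 2
      is this margin, the other comes from the lower tail estimate.\<close>
    have "exp (- (a + 1 + 1)\<^sup>2 / 2) / sqrt (2 * pi) \<le> prob {\<omega> \<in> space M. a + 1 < X j \<omega>}"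
      by (rule wiener_approx_lower_tail[OF X[OF j] one[OF j]]) (use a in simp)
    then have q: "?q \<le> prob {\<omega> \<in> space M. a + 1 < X j \<omega>}" by (simp add: add.assoc)
    have "prob {\<omega> \<in> space M. a + 1 < X j \<omega>}
        \<le> prob ({\<omega> \<in> space M. a + 1/2 < W j \<omega>} \<union> {\<omega> \<in> space M. 1/2 \<le> \<bar>W j \<omega> - X j \<omega>\<bar>})"
      by (rule finite_measure_mono) (auto simp: abs_if split: if_splits)
    also have "\<dots> \<le> prob {\<omega> \<in> space M. a + 1/2 < W j \<omega>} + prob {\<omega> \<in> space M. 1/2 \<le> \<bar>W j \<omega> - X j \<omega>\<bar>}"
      by (rule measure_Un_le) auto
    finally have "?q - 40 * d \<le> prob {\<omega> \<in> space M. a + 1/2 < W j \<omega>}" using q close[OF j] by linarith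
    moreover have "prob {\<omega> \<in> space M. W j \<omega> \<in> {..a + 1/2}} = 1 - prob {\<omega> \<in> space M. a + 1/2 < W j \<omega>}"
      by (subst prob_compl[symmetric]) (auto intro!: arg_cong[where f=prob])
    ultimately have "prob {\<omega> \<in> space M. W j \<omega> \<in> {..a + 1/2}} \<le> 1 + - (?q - 40 * d)" by linarith
    also have "\<dots> \<le> exp (- (?q - 40 * d))" by (rule exp_ge_add_one_self)
    finally show ?thesis .
  qed
  have disj': "S i \<inter> S j = {}" if "i \<in> J" "j \<in> J" "i \<noteq> j" for i j
    using disj that by (auto simp: disjoint_family_on_def)
  have "prob {\<omega> \<in> space M. \<forall>j\<in>J. W j \<omega> \<in> {..a + 1/2}} = (\<Prod>j\<in>J. prob {\<omega> \<in> space M. W j \<omega> \<in> {..a + 1/2}})"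
  proof (rule simple_wiener_disjoint_prob[OF J W])
    show "F i z * indicator (S i) z * (F j z * indicator (S j) z) = 0" if "i \<in> J" "j \<in> J" "i \<noteq> j" for i j z
      using disj'[OF that] by (auto simp: indicator_def)
  qed auto
  also have "\<dots> \<le> (\<Prod>j\<in>J. exp (- (?q - 40 * d)))"
    by (intro prod_mono conjI single) auto
  also have "\<dots> = exp (- real (card J) * (?q - 40 * d))"
    by (simp add: exp_of_nat_mult[symmetric] algebra_simps)
  finally have main: "prob {\<omega> \<in> space M. \<forall>j\<in>J. W j \<omega> \<in> {..a + 1/2}} \<le> exp (- real (card J) * (?q - 40 * d))" .
  have mes: "{\<omega> \<in> space M. 1/2 \<le> \<bar>W j \<omega> - X j \<omega>\<bar>} \<in> events" if "j \<in> J" for j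
    using mW[OF that] mX[OF that] by measurable
  have mes2: "{\<omega> \<in> space M. \<forall>j\<in>J. W j \<omega> \<in> {..a + 1/2}} \<in> events"
    using J mW by measurable
  have "prob {\<omega> \<in> space M. \<forall>j\<in>J. X j \<omega> \<le> a}
      \<le> prob ({\<omega> \<in> space M. \<forall>j\<in>J. W j \<omega> \<in> {..a + 1/2}} \<union> (\<Union>j\<in>J. {\<omega> \<in> space M. 1/2 \<le> \<bar>W j \<omega> - X j \<omega>\<bar>}))"
  proof (rule finite_measure_mono)
    show "{\<omega> \<in> space M. \<forall>j\<in>J. W j \<omega> \<in> {..a + 1/2}} \<union> (\<Union>j\<in>J. {\<omega> \<in> space M. 1/2 \<le> \<bar>W j \<omega> - X j \<omega>\<bar>}) \<in> events"
      using mes mes2 J by (intro sets.Un sets.finite_UN) auto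
    have near: "w \<le> a + 1/2" if "x \<le> a" "\<not> 1/2 \<le> \<bar>w - x\<bar>" for x w :: real
      using that by (auto simp: abs_if split: if_splits)
    show "{\<omega> \<in> space M. \<forall>j\<in>J. X j \<omega> \<le> a} \<subseteq> {\<omega> \<in> space M. \<forall>j\<in>J. W j \<omega> \<in> {..a + 1/2}}
        \<union> (\<Union>j\<in>J. {\<omega> \<in> space M. 1/2 \<le> \<bar>W j \<omega> - X j \<omega>\<bar>})"
      using near by blast
  qed
  also have "\<dots> \<le> prob {\<omega> \<in> space M. \<forall>j\<in>J. W j \<omega> \<in> {..a + 1/2}}
      + prob (\<Union>j\<in>J. {\<omega> \<in> space M. 1/2 \<le> \<bar>W j \<omega> - X j \<omega>\<bar>})"
    using mes mes2 J by (intro measure_Un_le) auto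
  also have "prob (\<Union>j\<in>J. {\<omega> \<in> space M. 1/2 \<le> \<bar>W j \<omega> - X j \<omega>\<bar>}) \<le> (\<Sum>j\<in>J. prob {\<omega> \<in> space M. 1/2 \<le> \<bar>W j \<omega> - X j \<omega>\<bar>})"
    using mes J by (intro finite_measure_subadditive_finite) auto
  also have "\<dots> \<le> real (card J) * (40 * d)"
    using close by (intro sum_bounded_above)
  finally show ?thesis using main by linarith
qed

end

section \<open>The heat kernel\<close>

definition heat_integrand :: "real \<Rightarrow> real \<Rightarrow> real \<times> real \<Rightarrow> real" where
  "heat_integrand t x = (\<lambda>(s, y). indicator {0<..<t} s * heat_kernel (t - s) (y - x))"

lemma borel_measurable_heat_integrand [measurable]: "heat_integrand t x \<in> borel_measurable borel"
  unfolding heat_integrand_def heat_kernel_def borel_prod[symmetric] by measurable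

lemma powr_neg_half: "0 < (u::real) \<Longrightarrow> u powr - (1/2) = 1 / sqrt u"
  by (simp only: powr_minus_divide powr_half_sqrt less_imp_le)

text \<open>Completing the square: the y-dependence is Gaussian around the midpoint with variance
  \<tau>/2. The remaining prefactor is \<open>heat_kernel (2 * \<tau>) (x - x')\<close>, as in the
  semigroup property.\<close>

lemma heat_kernel_product:
  assumes "0 < \<tau>"
  shows "heat_kernel \<tau> (y - x) * heat_kernel \<tau> (y - x')
    = exp (- (x - x')\<^sup>2 / (4 * \<tau>)) * (\<tau> powr (-1/2) / (2 * sqrt pi)) * normal_density ((x + x') / 2) (sqrt (\<tau> / 2)) y"
proof -
  have "- (y - x)\<^sup>2 / (2 * \<tau>) + - (y - x')\<^sup>2 / (2 * \<tau>)
      = - (x - x')\<^sup>2 / (4 * \<tau>) + - (y - (x + x') / 2)\<^sup>2 / (2 * (\<tau> / 2))"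
    using assms by (simp add: field_simps power2_eq_square)
  then have e: "exp (- (y - x)\<^sup>2 / (2 * \<tau>)) * exp (- (y - x')\<^sup>2 / (2 * \<tau>))
      = exp (- (x - x')\<^sup>2 / (4 * \<tau>)) * exp (- (y - (x + x') / 2)\<^sup>2 / (2 * (\<tau> / 2)))"
    unfolding exp_add[symmetric] by simp
  have c: "(2 * pi * \<tau>) powr (-1/2) * (2 * pi * \<tau>) powr (-1/2)
      = \<tau> powr (-1/2) / (2 * sqrt pi) * (1 / sqrt (2 * pi * (\<tau> / 2)))"
  proof -
    have "sqrt \<tau> * (sqrt pi * sqrt (pi * \<tau>)) = (sqrt \<tau> * sqrt \<tau>) * (sqrt pi * sqrt pi)"
      by (simp only: real_sqrt_mult mult_ac)
    also have "\<dots> = pi * \<tau>" using assms by simp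
    finally have "sqrt \<tau> * (sqrt pi * sqrt (pi * \<tau>)) = pi * \<tau>" .
    then have "1 / (2 * pi * \<tau>) = 1 / sqrt \<tau> / (2 * sqrt pi) * (1 / sqrt (pi * \<tau>))"
      using assms by simp
    then show ?thesis using assms by (simp add: powr_neg_half)
  qed
  have "heat_kernel \<tau> (y - x) * heat_kernel \<tau> (y - x')
      = ((2 * pi * \<tau>) powr (-1/2) * (2 * pi * \<tau>) powr (-1/2))
        * (exp (- (y - x)\<^sup>2 / (2 * \<tau>)) * exp (- (y - x')\<^sup>2 / (2 * \<tau>)))"
    by (simp add: heat_kernel_def mult_ac)
  also have "\<dots> = exp (- (x - x')\<^sup>2 / (4 * \<tau>)) * (\<tau> powr (-1/2) / (2 * sqrt pi)) * normal_density ((x + x') / 2) (sqrt (\<tau> / 2)) y"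
    unfolding c e normal_density_def using assms by (simp only: mult_ac real_sqrt_pow2)
  finally show ?thesis .
qed

lemma heat_kernel_product_integral:
  assumes "0 < \<tau>"
  shows "has_bochner_integral lborel (\<lambda>y. heat_kernel \<tau> (y - x) * heat_kernel \<tau> (y - x'))
    (exp (- (x - x')\<^sup>2 / (4 * \<tau>)) * (\<tau> powr (-1/2) / (2 * sqrt pi)))"
proof -
  have "has_bochner_integral lborel (normal_density ((x + x') / 2) (sqrt (\<tau> / 2))) 1"
    using assms by (simp add: has_bochner_integral_iff)
  from has_bochner_integral_mult_right[OF this] show ?thesis
    unfolding heat_kernel_product[OF assms] by fastforce
qed

lemma heat_kernel_square_integral:
  assumes "0 < \<tau>"
  shows "(\<integral>\<^sup>+y. ennreal ((heat_kernel \<tau> (y - x))\<^sup>2) \<partial>lborel) = ennreal (\<tau> powr (-1/2) / (2 * sqrt pi))"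
  using heat_kernel_product_integral[OF assms, of x x]
  by (subst nn_integral_eq_integral) (auto simp: power2_eq_square has_bochner_integral_iff)

text \<open>An interpolation between the bounds u and 1. The exponent 1/2 would match the true
  regularity in space but lead to the singularity 1/\<tau> in time; 1/4 gives the integrable
  \<tau>^(-3/4) and still a Hoelder bound, which is enough for chaining.\<close>

lemma one_minus_exp_le_powr:
  assumes "0 \<le> (u::real)"
  shows "1 - exp (- u) \<le> u powr (1/4)"
proof (cases "u \<le> 1")
  case True
  have "1 - exp (- u) \<le> u" using exp_ge_add_one_self[of "-u"] by simp
  also have "\<dots> \<le> u powr (1/4)"
    using powr_mono'[of "1/4" 1 u] assms True by (cases "u = 0") auto
  finally show ?thesis .
next
  case False
  have "1 - exp (- u) \<le> 1" by simp
  also have "\<dots> \<le> u powr (1/4)" using False by (intro ge_one_powr_ge_zero) auto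
  finally show ?thesis .
qed

text \<open>Expanding the square gives twice the difference of the kernel at time 2\<tau> between 0
  and x - x'; the numerical factor left after interpolation is at most 1 and is absorbed.\<close>

lemma heat_kernel_diff_square_integral:
  assumes "0 < \<tau>"
  shows "(\<integral>\<^sup>+y. ennreal ((heat_kernel \<tau> (y - x) - heat_kernel \<tau> (y - x'))\<^sup>2) \<partial>lborel)
    \<le> ennreal (\<bar>x - x'\<bar> powr (1/2) * \<tau> powr (-3/4))"
proof -
  let ?c = "\<tau> powr (-1/2) / (2 * sqrt pi)" and ?u = "(x - x')\<^sup>2 / (4 * \<tau>)"
  have "has_bochner_integral lborel (\<lambda>y. heat_kernel \<tau> (y - x) * heat_kernel \<tau> (y - x)
        + heat_kernel \<tau> (y - x') * heat_kernel \<tau> (y - x') - 2 * (heat_kernel \<tau> (y - x) * heat_kernel \<tau> (y - x')))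
      (exp (- (x - x)\<^sup>2 / (4 * \<tau>)) * ?c + exp (- (x' - x')\<^sup>2 / (4 * \<tau>)) * ?c - 2 * (exp (- (x - x')\<^sup>2 / (4 * \<tau>)) * ?c))"
    by (intro has_bochner_integral_diff has_bochner_integral_add has_bochner_integral_mult_right
        heat_kernel_product_integral assms)
  also have "(\<lambda>y. heat_kernel \<tau> (y - x) * heat_kernel \<tau> (y - x)
        + heat_kernel \<tau> (y - x') * heat_kernel \<tau> (y - x') - 2 * (heat_kernel \<tau> (y - x) * heat_kernel \<tau> (y - x')))
      = (\<lambda>y. (heat_kernel \<tau> (y - x) - heat_kernel \<tau> (y - x'))\<^sup>2)"
    by (auto simp: power2_eq_square algebra_simps)
  also have "exp (- (x - x)\<^sup>2 / (4 * \<tau>)) * ?c + exp (- (x' - x')\<^sup>2 / (4 * \<tau>)) * ?c - 2 * (exp (- (x - x')\<^sup>2 / (4 * \<tau>)) * ?c)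
      = 2 * ?c * (1 - exp (- ?u))"
    by (simp add: algebra_simps)
  finally have hb: "has_bochner_integral lborel (\<lambda>y. (heat_kernel \<tau> (y - x) - heat_kernel \<tau> (y - x'))\<^sup>2) (2 * ?c * (1 - exp (- ?u)))" .
  then have "(\<integral>\<^sup>+y. ennreal ((heat_kernel \<tau> (y - x) - heat_kernel \<tau> (y - x'))\<^sup>2) \<partial>lborel) = ennreal (2 * ?c * (1 - exp (- ?u)))"
    by (subst nn_integral_eq_integral) (auto simp: has_bochner_integral_iff)
  also have "2 * ?c * (1 - exp (- ?u)) \<le> 2 * ?c * ?u powr (1/4)"
    using assms by (intro mult_left_mono one_minus_exp_le_powr) auto
  also have "?u powr (1/4) = \<bar>x - x'\<bar> powr (1/2) * (4 * \<tau>) powr (-1/4)"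
  proof -
    have "(x - x')\<^sup>2 powr (1/4) = \<bar>x - x'\<bar> powr (1/2)"
      using powr_powr[of "\<bar>x - x'\<bar>" 2 "1/4"] by (cases "x = x'") (simp_all add: powr_numeral)
    moreover have "(4 * \<tau>) powr (-1/4) = 1 / (4 * \<tau>) powr (1/4)"
      using powr_minus_divide[of "4 * \<tau>" "1/4"] by simp
    ultimately show ?thesis using assms by (simp add: powr_divide)
  qed
  also have "2 * ?c * (\<bar>x - x'\<bar> powr (1/2) * (4 * \<tau>) powr (-1/4))
      = \<bar>x - x'\<bar> powr (1/2) * \<tau> powr (-3/4) * (4 powr (-1/4) / sqrt pi)"
  proof -
    have "\<tau> powr (-3/4) = \<tau> powr (-1/2) * \<tau> powr (-1/4)" by (simp add: powr_add[symmetric])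
    then show ?thesis using assms by (simp add: powr_mult)
  qed
  also have "\<dots> \<le> \<bar>x - x'\<bar> powr (1/2) * \<tau> powr (-3/4) * 1"
  proof (intro mult_left_mono)
    have "(4::real) powr (-1/4) \<le> 4 powr 0" by (intro powr_mono) auto
    moreover have "1 \<le> sqrt pi" using pi_ge_two by simp
    ultimately show "4 powr (-1/4) / sqrt pi \<le> 1"
      using frac_le[of 1 "4 powr (-1/4)" 1 "sqrt pi"] by simp
  qed simp
  finally show ?thesis by (simp add: ennreal_leI)
qed

text \<open>Outside the K-neighbourhood of x one factor of the square is bounded by its supremum
  there, with \<tau> \<le> t in the exponent; the other factor is a probability density.\<close>

lemma heat_kernel_cutoff_square_integral:
  assumes \<tau>: "0 < \<tau>" "\<tau> \<le> t" and K: "0 \<le> K"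
  shows "(\<integral>\<^sup>+y. ennreal ((heat_kernel \<tau> (y - x) * indicator {y. K \<le> \<bar>y - x\<bar>} y)\<^sup>2) \<partial>lborel)
    \<le> ennreal (exp (- K\<^sup>2 / (2 * t)) * \<tau> powr (-1/2))"
proof -
  have hk: "heat_kernel \<tau> (y - x) = normal_density x (sqrt \<tau>) y" for y
    using \<tau> by (simp add: heat_kernel_def normal_density_def powr_neg_half)
  let ?c = "exp (- K\<^sup>2 / (2 * t)) * \<tau> powr (-1/2)"
  have "(\<integral>\<^sup>+y. ennreal ((heat_kernel \<tau> (y - x) * indicator {y. K \<le> \<bar>y - x\<bar>} y)\<^sup>2) \<partial>lborel)
      \<le> (\<integral>\<^sup>+y. ennreal ?c * ennreal (normal_density x (sqrt \<tau>) y) \<partial>lborel)"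
  proof (rule nn_integral_mono)
    fix y :: real
    have "(heat_kernel \<tau> (y - x))\<^sup>2 \<le> ?c * normal_density x (sqrt \<tau>) y" if "K \<le> \<bar>y - x\<bar>"
    proof -
      have "K\<^sup>2 \<le> (y - x)\<^sup>2" using power_mono[OF that K, of 2] by simp
      then have "K\<^sup>2 / (2 * t) \<le> (y - x)\<^sup>2 / (2 * \<tau>)"
        using \<tau> K by (intro frac_le) auto
      then have "exp (- (y - x)\<^sup>2 / (2 * \<tau>)) \<le> exp (- K\<^sup>2 / (2 * t))" by simp
      moreover have "(2 * pi * \<tau>) powr (-1/2) \<le> \<tau> powr (-1/2)"
        using \<tau> pi_ge_two by (intro powr_mono2') auto
      ultimately have "heat_kernel \<tau> (y - x) \<le> \<tau> powr (-1/2) * exp (- K\<^sup>2 / (2 * t))"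
        unfolding heat_kernel_def by (intro mult_mono) auto
      then have "heat_kernel \<tau> (y - x) * heat_kernel \<tau> (y - x) \<le> ?c * heat_kernel \<tau> (y - x)"
        by (intro mult_right_mono) (auto simp: mult.commute heat_kernel_def)
      then show ?thesis by (simp add: power2_eq_square hk)
    qed
    then show "ennreal ((heat_kernel \<tau> (y - x) * indicator {y. K \<le> \<bar>y - x\<bar>} y)\<^sup>2)
        \<le> ennreal ?c * ennreal (normal_density x (sqrt \<tau>) y)"
      by (auto simp: indicator_def ennreal_mult[symmetric] intro!: ennreal_leI)
  qed
  also have "\<dots> = ennreal ?c"
    using \<tau> by (simp add: nn_integral_cmult nn_integral_eq_integral)
  finally show ?thesis .
qed

lemma nn_integral_reflected_powr:
  assumes a: "-1 < a" and t: "0 < t"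
  shows "(\<integral>\<^sup>+s. ennreal ((t - s) powr a) * indicator {0<..<t} s \<partial>lborel) = ennreal (t powr (a + 1) / (a + 1))"
proof -
  have "(\<integral>\<^sup>+s. ennreal ((t - s) powr a) * indicator {0<..<t} s \<partial>lborel)
      = (\<integral>\<^sup>+s. ennreal (s powr a) * indicator {0<..<t} s \<partial>lborel)"
    by (subst nn_integral_real_affine[where c="-1" and t=t]) (auto intro!: nn_integral_cong simp: indicator_def)
  also have "\<dots> = (\<integral>\<^sup>+s. ennreal (s powr a) * indicator {0..t} s \<partial>lborel)"
  proof (rule nn_integral_cong_AE)
    have "AE s in lborel. s \<noteq> (0::real) \<and> s \<noteq> t"
      using AE_lborel_singleton[of "0::real"] AE_lborel_singleton[of t] by eventually_elim auto
    then show "AE s in lborel. ennreal (s powr a) * indicator {0<..<t} s = ennreal (s powr a) * indicator {0..t} s"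
      by eventually_elim (auto simp: indicator_def)
  qed
  also have "\<dots> = ennreal (t powr (a + 1) / (a + 1))"
    using has_integral_powr_from_0[OF a, of t] t by (intro nn_integral_has_integral_lebesgue') auto
  finally show ?thesis .
qed

text \<open>Tonelli. The condition a > -1 makes the singularity of the spatial bound at s = t
  integrable in time.\<close>

lemma heat_integrand_nn_integral_le:
  fixes G :: "real \<times> real \<Rightarrow> real"
  assumes [measurable]: "G \<in> borel_measurable borel" and t: "0 < t" and a: "-1 < a" and C: "0 \<le> C"
    and G: "\<And>s y. s \<notin> {0<..<t} \<Longrightarrow> G (s, y) = 0"
    and le: "\<And>s. 0 < s \<Longrightarrow> s < t \<Longrightarrow> (\<integral>\<^sup>+y. ennreal (G (s, y)) \<partial>lborel) \<le> ennreal (C * (t - s) powr a)"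
  shows "(\<integral>\<^sup>+z. ennreal (G z) \<partial>lborel) \<le> ennreal (C * (t powr (a + 1) / (a + 1)))"
proof -
  have [measurable]: "G \<in> borel_measurable (borel \<Otimes>\<^sub>M borel)" using assms(1) by (simp add: borel_prod)
  have "(\<integral>\<^sup>+z. ennreal (G z) \<partial>lborel) = (\<integral>\<^sup>+z. ennreal (G z) \<partial>(lborel \<Otimes>\<^sub>M lborel))"
    by (simp add: lborel_prod)
  also have "\<dots> = (\<integral>\<^sup>+s. \<integral>\<^sup>+y. ennreal (G (s, y)) \<partial>lborel \<partial>lborel)"
    by (subst lborel.nn_integral_fst[symmetric]) auto
  also have "\<dots> \<le> (\<integral>\<^sup>+s. ennreal C * (ennreal ((t - s) powr a) * indicator {0<..<t} s) \<partial>lborel)"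
  proof (rule nn_integral_mono)
    fix s :: real
    show "(\<integral>\<^sup>+y. ennreal (G (s, y)) \<partial>lborel) \<le> ennreal C * (ennreal ((t - s) powr a) * indicator {0<..<t} s)"
      using le[of s] G[of s] C by (cases "s \<in> {0<..<t}") (auto simp: ennreal_mult indicator_def)
  qed
  also have "\<dots> = ennreal (C * (t powr (a + 1) / (a + 1)))"
    using C t a by (subst nn_integral_cmult, measurable)
      (subst nn_integral_reflected_powr, auto simp: ennreal_mult[symmetric])
  finally show ?thesis .
qed

text \<open>This is the variance of Z(t,x); its inverse is the square of the normalisation
  (\<pi>/t)^(1/4) in X.\<close>

lemma heat_integrand_norm:
  assumes t: "0 < t"
  shows "(\<integral>\<^sup>+z. ennreal ((heat_integrand t x z)\<^sup>2) \<partial>lborel) = ennreal (sqrt (t / pi))"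
proof -
  have [measurable]: "heat_integrand t x \<in> borel_measurable (borel \<Otimes>\<^sub>M borel)" by (simp add: borel_prod)
  have "(\<integral>\<^sup>+z. ennreal ((heat_integrand t x z)\<^sup>2) \<partial>lborel) = (\<integral>\<^sup>+z. ennreal ((heat_integrand t x z)\<^sup>2) \<partial>(lborel \<Otimes>\<^sub>M lborel))"
    by (simp add: lborel_prod)
  also have "\<dots> = (\<integral>\<^sup>+s. \<integral>\<^sup>+y. ennreal ((heat_integrand t x (s, y))\<^sup>2) \<partial>lborel \<partial>lborel)"
    by (subst lborel.nn_integral_fst[symmetric]) auto
  also have "\<dots> = (\<integral>\<^sup>+s. ennreal (1 / (2 * sqrt pi)) * (ennreal ((t - s) powr (-1/2)) * indicator {0<..<t} s) \<partial>lborel)"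
  proof (rule nn_integral_cong)
    fix s :: real
    show "(\<integral>\<^sup>+y. ennreal ((heat_integrand t x (s, y))\<^sup>2) \<partial>lborel)
        = ennreal (1 / (2 * sqrt pi)) * (ennreal ((t - s) powr (-1/2)) * indicator {0<..<t} s)"
      using heat_kernel_square_integral[of "t - s" x]
      by (cases "s \<in> {0<..<t}") (auto simp: heat_integrand_def indicator_def ennreal_mult[symmetric])
  qed
  also have "\<dots> = ennreal (1 / (2 * sqrt pi)) * ennreal (t powr (-1/2 + 1) / (-1/2 + 1))"
    using t by (subst nn_integral_cmult, measurable) (subst nn_integral_reflected_powr, auto)
  also have "\<dots> = ennreal (sqrt (t / pi))"
    using t by (simp add: ennreal_mult[symmetric] powr_half_sqrt real_sqrt_divide)
  finally show ?thesis .
qed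

lemma heat_integrand_diff_norm:
  assumes t: "0 < t"
  shows "(\<integral>\<^sup>+z. ennreal ((heat_integrand t x z - heat_integrand t x' z)\<^sup>2) \<partial>lborel)
    \<le> ennreal (4 * t powr (1/4) * \<bar>x - x'\<bar> powr (1/2))"
proof -
  have "(\<integral>\<^sup>+z. ennreal ((heat_integrand t x z - heat_integrand t x' z)\<^sup>2) \<partial>lborel)
      \<le> ennreal (\<bar>x - x'\<bar> powr (1/2) * (t powr (-3/4 + 1) / (-3/4 + 1)))"
  proof (rule heat_integrand_nn_integral_le)
    fix s assume "0 < s" "s < t"
    then show "(\<integral>\<^sup>+y. ennreal ((heat_integrand t x (s, y) - heat_integrand t x' (s, y))\<^sup>2) \<partial>lborel)
        \<le> ennreal (\<bar>x - x'\<bar> powr (1/2) * (t - s) powr (-3/4))"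
      using heat_kernel_diff_square_integral[of "t - s" x x'] by (simp add: heat_integrand_def)
  next
    show "(\<lambda>z. (heat_integrand t x z - heat_integrand t x' z)\<^sup>2) \<in> borel_measurable borel" by measurable
  qed (use t in \<open>auto simp: heat_integrand_def indicator_def\<close>)
  then show ?thesis by (simp add: mult_ac)
qed

lemma heat_integrand_cutoff_norm:
  assumes t: "0 < t" and K: "0 \<le> K"
  shows "(\<integral>\<^sup>+z. ennreal ((heat_integrand t x z * indicator (- {z. \<bar>snd z - x\<bar> < K}) z)\<^sup>2) \<partial>lborel)
    \<le> ennreal (2 * sqrt t * exp (- K\<^sup>2 / (2 * t)))"
proof -
  have "(\<integral>\<^sup>+z. ennreal ((heat_integrand t x z * indicator (- {z. \<bar>snd z - x\<bar> < K}) z)\<^sup>2) \<partial>lborel)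
      \<le> ennreal (exp (- K\<^sup>2 / (2 * t)) * (t powr (-1/2 + 1) / (-1/2 + 1)))"
  proof (rule heat_integrand_nn_integral_le)
    have [measurable]: "{z :: real \<times> real. \<bar>snd z - x\<bar> < K} \<in> sets borel"
      by (intro borel_open open_Collect_less continuous_intros)
    show "(\<lambda>z. (heat_integrand t x z * indicator (- {z. \<bar>snd z - x\<bar> < K}) z)\<^sup>2) \<in> borel_measurable borel"
      by measurable
    fix s assume "0 < s" "s < t"
    moreover have "indicator (- {z. \<bar>snd z - x\<bar> < K}) (s, y) = (indicator {y. K \<le> \<bar>y - x\<bar>} y :: real)" for y
      by (auto simp: indicator_def)
    ultimately show "(\<integral>\<^sup>+y. ennreal ((heat_integrand t x (s, y) * indicator (- {z. \<bar>snd z - x\<bar> < K}) (s, y))\<^sup>2) \<partial>lborel)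
        \<le> ennreal (exp (- K\<^sup>2 / (2 * t)) * (t - s) powr (-1/2))"
      using heat_kernel_cutoff_square_integral[of "t - s" t K x] K by (simp add: heat_integrand_def)
  qed (use t in \<open>auto simp: heat_integrand_def indicator_def\<close>)
  then show ?thesis using t by (simp add: mult_ac powr_half_sqrt)
qed

section \<open>Chaining\<close>

text \<open>An even index of the finer grid already lies on the coarser one; an odd index is one
  increment away from its left neighbour, which does. Each level therefore adds one
  increment.\<close>

lemma dyadic_chaining:
  fixes f :: "real \<Rightarrow> real"
  assumes base: "\<And>i. i \<le> 2^N \<Longrightarrow> \<bar>f (k + real i / 2^N)\<bar> \<le> a"
    and inc: "\<And>l i. i < 2^(N + l) \<Longrightarrow>
      \<bar>f (k + real (2 * i + 1) / 2^(N + Suc l)) - f (k + real (2 * i) / 2^(N + Suc l))\<bar> \<le> b l"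
    and i: "i \<le> 2^(N + l)"
  shows "\<bar>f (k + real i / 2^(N + l))\<bar> \<le> a + (\<Sum>j<l. b j)"
  using i
proof (induction l arbitrary: i)
  case 0
  then show ?case using base by simp
next
  case (Suc l)
  have half: "real (2 * j) / 2^(N + Suc l) = real j / 2^(N + l)" for j by simp
  have b: "0 \<le> b l" using inc[of 0 l] by fastforce
  show ?case
  proof (cases "even i")
    case True
    then obtain j where j: "i = 2 * j" by (elim evenE)
    then have "j \<le> 2^(N + l)" using Suc.prems by simp
    from Suc.IH[OF this] show ?thesis unfolding j half using b by simp
  next
    case False
    then obtain j where j: "i = 2 * j + 1" by (elim oddE)
    then have j': "j < 2^(N + l)" using Suc.prems by simp
    have "\<bar>f (k + real (2 * j) / 2^(N + Suc l))\<bar> \<le> a + (\<Sum>j<l. b j)"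
      unfolding half using j' by (intro Suc.IH) simp
    with inc[OF j'] show ?thesis unfolding j by simp
  qed
qed

text \<open>The dyadic points below x at level N + l converge to x, so continuity carries the bound
  from the grid to the whole interval.\<close>

lemma dyadic_chaining_bound:
  fixes f :: "real \<Rightarrow> real"
  assumes cont: "continuous_on {k..k + 1} f"
    and base: "\<And>i. i \<le> 2^N \<Longrightarrow> \<bar>f (k + real i / 2^N)\<bar> \<le> a"
    and inc: "\<And>l i. i < 2^(N + l) \<Longrightarrow>
      \<bar>f (k + real (2 * i + 1) / 2^(N + Suc l)) - f (k + real (2 * i) / 2^(N + Suc l))\<bar> \<le> b l"
    and c: "\<And>l. a + (\<Sum>j<l. b j) \<le> c"
    and x: "x \<in> {k..k + 1}"
  shows "\<bar>f x\<bar> \<le> c"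
proof -
  define m where "m l = nat \<lfloor>(x - k) * 2^(N + l)\<rfloor>" for l
  define y where "y l = k + real (m l) / 2^(N + l)" for l
  have fl: "real (m l) = of_int \<lfloor>(x - k) * 2^(N + l)\<rfloor>" for l
    using x by (simp add: m_def)
  have mle: "m l \<le> 2^(N + l)" for l
  proof -
    have "real (m l) \<le> (x - k) * 2^(N + l)" unfolding fl by simp
    also have "\<dots> \<le> 1 * 2^(N + l)" using x by (intro mult_right_mono) auto
    finally have "real (m l) \<le> real (2^(N + l))" by simp
    then show ?thesis by (simp only: of_nat_le_iff)
  qed
  have yle: "y l \<le> x" "x - (1/2)^l \<le> y l" for l
  proof -
    have "real (m l) \<le> (x - k) * 2^(N + l)" unfolding fl by simp
    then show "y l \<le> x" by (simp add: y_def field_simps)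
    have "(x - k) * 2^(N + l) \<le> real (m l) + 1" unfolding fl by linarith
    then have "x - k \<le> real (m l) / 2^(N + l) + 1 / 2^(N + l)" by (simp add: field_simps)
    moreover have "(1::real) / 2^(N + l) \<le> (1/2)^l"
      by (simp add: power_one_over field_simps power_increasing)
    ultimately show "x - (1/2)^l \<le> y l" by (simp add: y_def)
  qed
  have yin: "y l \<in> {k..k + 1}" for l
  proof -
    have "k \<le> y l" by (simp add: y_def)
    with yle(1)[of l] x show ?thesis by auto
  qed
  have "y \<longlonglongrightarrow> x"
  proof (rule tendsto_sandwich[where f="\<lambda>l. x - (1/2)^l" and h="\<lambda>_. x"])
    have "(\<lambda>l. x - (1/2::real)^l) \<longlonglongrightarrow> x - 0"
      by (intro tendsto_diff tendsto_const LIMSEQ_realpow_zero) auto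
    then show "(\<lambda>l. x - (1/2::real)^l) \<longlonglongrightarrow> x" by simp
  qed (use yle in \<open>auto intro!: always_eventually\<close>)
  then have lim: "(\<lambda>l. f (y l)) \<longlonglongrightarrow> f x"
    by (rule continuous_on_tendsto_compose[OF cont _ x]) (use yin in \<open>auto intro!: always_eventually\<close>)
  have "\<bar>f (y l)\<bar> \<le> c" for l
    unfolding y_def by (rule order_trans[OF dyadic_chaining[OF base inc mle] c])
  then show ?thesis
    by (intro tendsto_upperbound[OF tendsto_rabs[OF lim]]) (auto intro: always_eventually)
qed

text \<open>The interface between the heat equation and the dimension computation. All kernel bounds
  are uniform in x, which takes over the part of stationarity, and \<open>cutoff\<close> replaces
  the decay of correlations.\<close>

locale gaussian_field = white_noise_space M \<xi> for M :: "'w measure" and \<xi> +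
  fixes f :: "real \<Rightarrow> real \<times> real \<Rightarrow> real" and X :: "real \<Rightarrow> 'w \<Rightarrow> real" and D A t :: real
  assumes approx: "\<And>x. wiener_approx M \<xi> (f x) (X x)"
    and norm_one: "\<And>x. (\<integral>\<^sup>+z. ennreal ((f x z)\<^sup>2) \<partial>lborel) = 1"
    and holder: "\<And>x x'. (\<integral>\<^sup>+z. ennreal ((f x z - f x' z)\<^sup>2) \<partial>lborel) \<le> ennreal (D * \<bar>x - x'\<bar> powr (1/2))"
    and cutoff: "\<And>x K. 0 \<le> K \<Longrightarrow>
      (\<integral>\<^sup>+z. ennreal ((f x z * indicator (- {z. \<bar>snd z - x\<bar> < K}) z)\<^sup>2) \<partial>lborel) \<le> ennreal (A * exp (- K\<^sup>2 / (2 * t)))"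
    and D_pos: "0 < D" and A_pos: "0 < A" and t_pos: "0 < t"
    and continuous: "AE \<omega> in M. continuous_on UNIV (\<lambda>x. X x \<omega>)"
begin

lemma field_measurable [measurable]: "X x \<in> borel_measurable M"
  using approx[of x] by (simp add: wiener_approx_def)

lemma field_tail:
  assumes "0 \<le> a" shows "prob {\<omega> \<in> space M. a < \<bar>X x \<omega>\<bar>} \<le> 2 * exp (- a\<^sup>2 / 2)"
  using wiener_approx_tail[OF approx, of x 1 a] norm_one[of x] assms by simp

lemma field_increment_tail:
  assumes "0 \<le> a" "D * \<bar>x - x'\<bar> powr (1/2) \<le> V" "0 < V"
  shows "prob {\<omega> \<in> space M. a < \<bar>X x \<omega> - X x' \<omega>\<bar>} \<le> 2 * exp (- a\<^sup>2 / (2 * V))"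
  by (rule wiener_approx_tail[OF wiener_approx_diff[OF approx approx]])
    (use assms holder[of x x'] in \<open>auto intro: order_trans ennreal_leI\<close>)

text \<open>
  The starting level \<open>N\<close> of the chaining is so fine that the increments of level \<open>N + l\<close> contribute
  at most a multiple of \<open>(2 / e)\<^sup>l exp (- \<mu>\<^sup>2 / 2)\<close>.
\<close>

lemma sup_tail:
  assumes \<beta>: "0 < \<beta>"
  shows "\<exists>C>0. \<forall>k \<mu>. 1 \<le> \<mu> \<longrightarrow> (\<exists>B\<in>events. prob B \<le> C * exp (- \<mu>\<^sup>2 / 2) \<and>
    (\<forall>\<omega>\<in>space M - B. continuous_on UNIV (\<lambda>x. X x \<omega>) \<longrightarrow> (\<forall>x\<in>{k..k + 1}. \<bar>X x \<omega>\<bar> \<le> (1 + \<beta>) * \<mu>)))"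
proof -
  \<comment> \<open>At mesh 2^(-n) the mean square of an increment is at most D r^(4n), since r^4 =
    2^(-1/2). Allowing increments of size proportional to r^l leaves an exponent growing like
    r^(-2l).\<close>
  define r :: real where "r = 2 powr (-1/8)"
  have r: "0 < r" "r < 1" by (auto simp: r_def powr_less_one)
  have r4: "((1/2)^n) powr (1/2) = r^(4 * n)" for n :: nat
    by (simp add: r_def powr_realpow[symmetric] powr_powr powr_divide powr_minus_divide[symmetric] powr_mult)
  \<comment> \<open>Writing 1/r^2 = 1 + u lets Bernoulli's inequality replace that geometric growth
    by the linear 1 + l u.\<close>
  define u where "u = 1 / r\<^sup>2 - 1"
  have u: "0 < u" using r by (simp add: u_def power_less_one_iff abs_square_less_1)
  \<comment> \<open>Times \<mu>^2 (1/r^4)^N, this is the Gaussian exponent of the increments at l =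
    0. The level N is then chosen to make it at least \<mu>^2/2 there, with a gain of at least l at
    the later levels.\<close>
  define g where "g = \<beta>\<^sup>2 * (1 - r)\<^sup>2 / (2 * D)"
  have g: "0 < g" using \<beta> r D_pos by (simp add: g_def)
  have "1 < 1 / r^4" using r by (simp add: power_less_one_iff)
  from real_arch_pow[OF this, of "max (1/2) (1 / u) / g"]
  obtain N where "max (1/2) (1 / u) / g < (1 / r^4)^N" by auto
  then have "max (1/2) (1 / u) \<le> g * (1 / r^4)^N"
    using g by (simp add: pos_divide_less_eq mult.commute less_imp_le del: max_less_iff_conj)
  then have "1/2 \<le> g * (1 / r^4)^N" "1 / u \<le> g * (1 / r^4)^N"
    by (simp_all only: max.bounded_iff)
  then have G: "1/2 \<le> g * (1 / r^4)^N" "1 \<le> g * (1 / r^4)^N * u"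
    by (simp_all only: pos_divide_le_eq[OF u])
  \<comment> \<open>Level N + l has 2^(N+l) increments and gains the factor e^(-l), so the union
    bound is geometric with ratio 2/e < 1.\<close>
  define q :: real where "q = 2 * exp (-1)"
  have q: "0 < q" "q < 1"
  proof -
    have "(1 + 1/2) * (1 + 1/2) \<le> exp (1/2::real) * exp (1/2)"
      by (intro mult_mono exp_ge_add_one_self) auto
    then have "(2::real) < exp 1" by (simp add: exp_add[symmetric])
    then show "q < 1" by (simp add: q_def exp_minus field_simps)
  qed (simp add: q_def)
  define C :: real where "C = (2^N + 1) * 2 + 2^(N + 1) / (1 - q)"
  have C: "0 < C" using q by (auto simp: C_def intro!: add_pos_nonneg)
  show ?thesis
  proof (intro exI[of _ C] conjI allI impI C)
    fix k \<mu> :: real assume l1: "1 \<le> \<mu>"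
    \<comment> \<open>The factor 1 - r normalises the geometric series so that all levels together
      add at most \<beta> \<mu>.\<close>
    define b where "b l = \<beta> * \<mu> * (1 - r) * r^l" for l
    have b: "0 \<le> b l" for l using \<beta> l1 r by (simp add: b_def)
    have sumb: "\<mu> + (\<Sum>j<l. b j) \<le> (1 + \<beta>) * \<mu>" for l
    proof -
      have "(\<Sum>j<l. b j) = \<beta> * \<mu> * (1 - r) * (\<Sum>j<l. r^j)" by (simp add: b_def sum_distrib_left)
      also have "\<dots> = \<beta> * \<mu> * (1 - r^l)"
        using r by (simp add: sum_gp_strict)
      also have "\<dots> \<le> \<beta> * \<mu> * 1" using \<beta> l1 r by (intro mult_left_mono) auto
      finally show ?thesis by (simp add: algebra_simps)
    qed
    define p where "p l i = k + real i / 2^(N + l)" for l i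
    define B0 where "B0 = (\<Union>i\<in>{..2^N}. {\<omega> \<in> space M. \<mu> < \<bar>X (p 0 i) \<omega>\<bar>})"
    define B1 where "B1 l = (\<Union>i\<in>{..<2^(N + l)}. {\<omega> \<in> space M. b l < \<bar>X (p (Suc l) (2 * i + 1)) \<omega> - X (p (Suc l) (2 * i)) \<omega>\<bar>})" for l
    have [measurable]: "B0 \<in> events" "\<And>l. B1 l \<in> events" by (auto simp: B0_def B1_def)
    have "prob B0 \<le> (\<Sum>i\<in>{..2^N::nat}. prob {\<omega> \<in> space M. \<mu> < \<bar>X (p 0 i) \<omega>\<bar>})"
      unfolding B0_def by (rule finite_measure_subadditive_finite) auto
    also have "\<dots> \<le> real (card {..2^N::nat}) * (2 * exp (- \<mu>\<^sup>2 / 2))"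
      using l1 by (intro sum_bounded_above field_tail) auto
    finally have P0: "prob B0 \<le> (2^N + 1) * (2 * exp (- \<mu>\<^sup>2 / 2))" by (simp add: add.commute)
    have P1: "prob (B1 l) \<le> 2^(N + 1) * exp (- \<mu>\<^sup>2 / 2) * q^l" for l
    proof -
      define V where "V = D * r^(4 * (N + l))"
      have V: "0 < V" using D_pos r by (simp add: V_def)
      have e: "exp (- (b l)\<^sup>2 / (2 * V)) \<le> exp (- \<mu>\<^sup>2 / 2) * exp (-1)^l"
      proof -
        have bern: "1 + real l * u \<le> (1 / r\<^sup>2)^l"
          using Bernoulli_inequality[of u l] u by (simp add: u_def)
        have "(b l)\<^sup>2 / (2 * V) = g * (1 / r^4)^N * \<mu>\<^sup>2 * (1 / r\<^sup>2)^l"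
        proof -
          have gen: "(\<beta> * \<mu> * w * s)\<^sup>2 / (2 * (D * (P * s^4))) = \<beta>\<^sup>2 * w\<^sup>2 / (2 * D) * (1 / P) * \<mu>\<^sup>2 * (1 / s\<^sup>2)"
            if "0 < s" "0 < P" for w s P :: real
            using that D_pos by (simp add: power_mult_distrib power4_eq_xxxx power2_eq_square mult_ac)
          have "r^(4 * (N + l)) = (r^4)^N * (r^l)^4"
            by (simp add: power_add power_mult distrib_left) (simp add: power_mult[symmetric] mult.commute)
          moreover have "(1 / r^4)^N = 1 / (r^4)^N" "(1 / r\<^sup>2)^l = 1 / (r^l)\<^sup>2"
            by (simp_all add: power_one_over) (simp add: power_mult[symmetric] mult.commute)
          ultimately show ?thesis
            unfolding b_def V_def g_def using gen[of "r^l" "(r^4)^N" "1 - r"] r by simp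
        qed
        also have "\<dots> \<ge> g * (1 / r^4)^N * \<mu>\<^sup>2 * (1 + real l * u)"
          using g r by (intro mult_left_mono bern) auto
        finally have "g * (1 / r^4)^N * \<mu>\<^sup>2 + (g * (1 / r^4)^N * u) * (real l * \<mu>\<^sup>2) \<le> (b l)\<^sup>2 / (2 * V)"
          by (simp add: algebra_simps)
        moreover have "1/2 * \<mu>\<^sup>2 \<le> g * (1 / r^4)^N * \<mu>\<^sup>2" using G(1) by (rule mult_right_mono) simp
        \<comment> \<open>Here 1 \<le> \<mu> enters: it turns the gain l \<mu>^2 into l, giving a
          ratio uniform in \<mu>.\<close>
        moreover have "1 * (real l * 1) \<le> (g * (1 / r^4)^N * u) * (real l * \<mu>\<^sup>2)"
          using G(2) l1 by (intro mult_mono mult_left_mono) (auto simp: one_le_power)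
        ultimately have "- (b l)\<^sup>2 / (2 * V) \<le> - \<mu>\<^sup>2 / 2 + real l * (-1)" by simp
        then have "exp (- (b l)\<^sup>2 / (2 * V)) \<le> exp (- \<mu>\<^sup>2 / 2 + real l * (-1))" by simp
        also have "\<dots> = exp (- \<mu>\<^sup>2 / 2) * exp (-1)^l" by (simp only: exp_add exp_of_nat_mult)
        finally show ?thesis .
      qed
      have "prob (B1 l) \<le> (\<Sum>i\<in>{..<2^(N + l)::nat}. prob {\<omega> \<in> space M. b l < \<bar>X (p (Suc l) (2 * i + 1)) \<omega> - X (p (Suc l) (2 * i)) \<omega>\<bar>})"
        unfolding B1_def by (rule finite_measure_subadditive_finite) auto
      also have "\<dots> \<le> real (card {..<2^(N + l)::nat}) * (2 * (exp (- \<mu>\<^sup>2 / 2) * exp (-1)^l))"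
      proof (intro sum_bounded_above)
        fix i :: nat
        have "\<bar>p (Suc l) (2 * i + 1) - p (Suc l) (2 * i)\<bar> = (1/2)^(N + Suc l)"
        proof -
          have "p (Suc l) (2 * i + 1) - p (Suc l) (2 * i) = 1 / 2^(N + Suc l)"
            unfolding p_def by (simp only: of_nat_add of_nat_1 add_divide_distrib)
          then show ?thesis by (simp add: power_one_over)
        qed
        then have "D * \<bar>p (Suc l) (2 * i + 1) - p (Suc l) (2 * i)\<bar> powr (1/2) = D * r^(4 * (N + Suc l))"
          by (simp only: r4)
        also have "\<dots> \<le> V" unfolding V_def using r D_pos by (intro mult_left_mono power_decreasing) auto
        finally have "prob {\<omega> \<in> space M. b l < \<bar>X (p (Suc l) (2 * i + 1)) \<omega> - X (p (Suc l) (2 * i)) \<omega>\<bar>}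
            \<le> 2 * exp (- (b l)\<^sup>2 / (2 * V))"
          using b V by (intro field_increment_tail)
        with e show "prob {\<omega> \<in> space M. b l < \<bar>X (p (Suc l) (2 * i + 1)) \<omega> - X (p (Suc l) (2 * i)) \<omega>\<bar>}
            \<le> 2 * (exp (- \<mu>\<^sup>2 / 2) * exp (-1)^l)" by linarith
      qed
      also have "\<dots> = 2^(N + 1) * exp (- \<mu>\<^sup>2 / 2) * q^l"
        by (simp add: q_def power_add power_mult_distrib)
      finally show ?thesis .
    qed
    have sumq: "summable (\<lambda>l. 2^(N + 1) * exp (- \<mu>\<^sup>2 / 2) * q^l)"
      using q by (intro summable_mult summable_geometric) auto
    have s1: "summable (\<lambda>l. prob (B1 l))"
      by (rule summable_comparison_test'[OF sumq]) (use P1 in auto)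
    have "prob (\<Union>l. B1 l) \<le> (\<Sum>l. prob (B1 l))"
      by (rule finite_measure_subadditive_countably) (use s1 in auto)
    also have "\<dots> \<le> (\<Sum>l. 2^(N + 1) * exp (- \<mu>\<^sup>2 / 2) * q^l)"
      by (rule suminf_le[OF P1 s1 sumq])
    also have "\<dots> = 2^(N + 1) * exp (- \<mu>\<^sup>2 / 2) * (1 / (1 - q))"
      using q by (subst suminf_mult) (auto simp: suminf_geometric intro!: summable_geometric)
    finally have P1': "prob (\<Union>l. B1 l) \<le> 2^(N + 1) * exp (- \<mu>\<^sup>2 / 2) * (1 / (1 - q))" .
    show "\<exists>B\<in>events. prob B \<le> C * exp (- \<mu>\<^sup>2 / 2) \<and>
      (\<forall>\<omega>\<in>space M - B. continuous_on UNIV (\<lambda>x. X x \<omega>) \<longrightarrow> (\<forall>x\<in>{k..k + 1}. \<bar>X x \<omega>\<bar> \<le> (1 + \<beta>) * \<mu>))"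
    proof (rule bexI[of _ "B0 \<union> (\<Union>l. B1 l)"], intro conjI ballI impI)
      have "prob (B0 \<union> (\<Union>l. B1 l)) \<le> prob B0 + prob (\<Union>l. B1 l)"
        by (rule measure_Un_le) auto
      also have "\<dots> \<le> (2^N + 1) * (2 * exp (- \<mu>\<^sup>2 / 2)) + 2^(N + 1) * exp (- \<mu>\<^sup>2 / 2) * (1 / (1 - q))"
        using P0 P1' by linarith
      also have "\<dots> = C * exp (- \<mu>\<^sup>2 / 2)" by (simp add: C_def algebra_simps)
      finally show "prob (B0 \<union> (\<Union>l. B1 l)) \<le> C * exp (- \<mu>\<^sup>2 / 2)" .
    next
      fix \<omega> x assume w: "\<omega> \<in> space M - (B0 \<union> (\<Union>l. B1 l))" and c: "continuous_on UNIV (\<lambda>x. X x \<omega>)"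
        and x: "x \<in> {k..k + 1}"
      show "\<bar>X x \<omega>\<bar> \<le> (1 + \<beta>) * \<mu>"
      proof (rule dyadic_chaining_bound[where f="\<lambda>x. X x \<omega>" and N=N and b=b, OF _ _ _ sumb x])
        show "continuous_on {k..k + 1} (\<lambda>x. X x \<omega>)" by (rule continuous_on_subset[OF c]) simp
        show "\<bar>X (k + real i / 2^N) \<omega>\<bar> \<le> \<mu>" if "i \<le> 2^N" for i
          using w that by (auto simp: B0_def p_def not_less)
        show "\<bar>X (k + real (2 * i + 1) / 2^(N + Suc l)) \<omega> - X (k + real (2 * i) / 2^(N + Suc l)) \<omega>\<bar> \<le> b l"
          if "i < 2^(N + l)" for l i
        proof -
          have "\<omega> \<in> space M" "\<omega> \<notin> B1 l" using w by auto
          then have "\<not> b l < \<bar>X (p (Suc l) (2 * i + 1)) \<omega> - X (p (Suc l) (2 * i)) \<omega>\<bar>"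
            using that unfolding B1_def by blast
          then show ?thesis unfolding p_def by linarith
        qed
      qed
    qed simp
  qed
qed

end

section \<open>Covering the tall peaks\<close>

lemma macro_shell_real:
  fixes x :: real
  assumes "0 \<le> x"
  shows "x \<in> macro_shell (Suc n) \<longleftrightarrow> exp (real n) \<le> x \<and> x < exp (real (Suc n))"
proof -
  have "- exp y \<le> x" for y using assms exp_ge_zero[of y] by linarith
  then show ?thesis by (auto simp: macro_cube_def not_less)
qed

lemma macro_content_le_unit_cover:
  fixes E :: "real set" and S :: "nat set"
  assumes S: "finite S" and E: "E \<inter> macro_shell n \<subseteq> (\<Union>k\<in>S. {real k..<real k + 1})"
  shows "macro_content \<rho> n E \<le> ennreal (exp (- \<rho> * real n) * real (card S))"
proof -
  let ?Q = "map (\<lambda>k. (real k, 1::real)) (sorted_list_of_set S)"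
  have "macro_content \<rho> n E \<le> ennreal (\<Sum>(x, r)\<leftarrow>?Q. (r / exp (real n)) powr \<rho>)"
    unfolding macro_content_def
  proof (rule INF_lower, intro CollectI conjI)
    show "\<forall>(x, r)\<in>set ?Q. 1 \<le> r" by auto
    show "E \<inter> macro_shell n \<subseteq> (\<Union>(x, r)\<in>set ?Q. upright_box x r)"
      using E S by (simp add: upright_box_def atLeastLessThan_def Int_def)
  qed
  also have "(\<Sum>(x, r)\<leftarrow>?Q. (r / exp (real n)) powr \<rho>) = real (card S) * (1 / exp (real n)) powr \<rho>"
    using S by (simp add: comp_def sum_list_triv)
  also have "(1 / exp (real n)) powr \<rho> = exp (- \<rho> * real n)"
    by (simp add: powr_def ln_div)
  finally show ?thesis by (simp add: mult.commute)
qed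

section \<open>Upper bound: random covers by unit intervals\<close>

context gaussian_field
begin

text \<open>The gap between \<gamma>' and \<gamma> pays for the factor 1 + \<beta> in
  \<open>sup_tail\<close>, used with \<mu> = \<gamma>' sqrt(2n), for which \<mu>^2/2 = \<gamma>'^2
  n.\<close>

lemma bad_events:
  assumes \<gamma>: "0 < \<gamma>'" "\<gamma>' < \<gamma>"
  shows "\<exists>C>0. \<exists>B :: nat \<Rightarrow> nat \<Rightarrow> 'w set. \<forall>n k. B n k \<in> events \<and>
    prob (B n k) \<le> C * exp (- \<gamma>'\<^sup>2 * real n) \<and>
    (\<forall>\<omega>\<in>space M - B n k. continuous_on UNIV (\<lambda>x. X x \<omega>) \<longrightarrow>
      (\<forall>x\<in>{real k..real k + 1}. \<bar>X x \<omega>\<bar> \<le> \<gamma> * sqrt (2 * real n)))"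
proof -
  define \<beta> where "\<beta> = \<gamma> / \<gamma>' - 1"
  have \<beta>: "0 < \<beta>" "(1 + \<beta>) * \<gamma>' = \<gamma>" using \<gamma> by (auto simp: \<beta>_def)
  obtain C where C: "0 < C" and sup: "\<And>k \<mu>. 1 \<le> \<mu> \<Longrightarrow> (\<exists>B\<in>events. prob B \<le> C * exp (- \<mu>\<^sup>2 / 2) \<and>
    (\<forall>\<omega>\<in>space M - B. continuous_on UNIV (\<lambda>x. X x \<omega>) \<longrightarrow> (\<forall>x\<in>{k..k + 1}. \<bar>X x \<omega>\<bar> \<le> (1 + \<beta>) * \<mu>)))"
    using sup_tail[OF \<beta>(1)] by blast
  define Q where "Q n k B \<longleftrightarrow> B \<in> events \<and> prob B \<le> (C + exp (1/2)) * exp (- \<gamma>'\<^sup>2 * real n) \<and>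
    (\<forall>\<omega>\<in>space M - B. continuous_on UNIV (\<lambda>x. X x \<omega>) \<longrightarrow>
      (\<forall>x\<in>{real k..real k + 1}. \<bar>X x \<omega>\<bar> \<le> \<gamma> * sqrt (2 * real n)))" for n k :: nat and B
  have "\<exists>B. Q n k B" for n k
  proof (cases "1 \<le> \<gamma>' * sqrt (2 * real n)")
    case True
    from sup[OF True, of "real k"] obtain B where B: "B \<in> events"
      "prob B \<le> C * exp (- (\<gamma>' * sqrt (2 * real n))\<^sup>2 / 2)"
      "\<forall>\<omega>\<in>space M - B. continuous_on UNIV (\<lambda>x. X x \<omega>) \<longrightarrow>
        (\<forall>x\<in>{real k..real k + 1}. \<bar>X x \<omega>\<bar> \<le> (1 + \<beta>) * (\<gamma>' * sqrt (2 * real n)))" by blast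
    have "- (\<gamma>' * sqrt (2 * real n))\<^sup>2 / 2 = - \<gamma>'\<^sup>2 * real n" by (simp add: power_mult_distrib)
    then have "prob B \<le> C * exp (- \<gamma>'\<^sup>2 * real n)" using B(2) by simp
    also have "\<dots> \<le> (C + exp (1/2)) * exp (- \<gamma>'\<^sup>2 * real n)" by (intro mult_right_mono) auto
    finally show ?thesis using B(1,3) \<beta>(2) by (intro exI[of _ B]) (simp add: Q_def mult.assoc[symmetric])
  next
    \<comment> \<open>For these small n, where \<open>sup_tail\<close> does not apply, the whole
      space serves as bad event; the summand exp(1/2) in the constant makes the claimed bound at
      least 1.\<close>
    case False
    then have "(\<gamma>' * sqrt (2 * real n))\<^sup>2 \<le> 1\<^sup>2" using \<gamma> by (intro power_mono) auto
    then have "\<gamma>'\<^sup>2 * real n \<le> 1/2" by (simp add: power_mult_distrib)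
    then have "1 \<le> exp (1/2 + - \<gamma>'\<^sup>2 * real n)" by simp
    also have "\<dots> = exp (1/2) * exp (- \<gamma>'\<^sup>2 * real n)" by (rule exp_add)
    also have "\<dots> \<le> (C + exp (1/2)) * exp (- \<gamma>'\<^sup>2 * real n)" using C by (intro mult_right_mono) auto
    finally show ?thesis by (intro exI[of _ "space M"]) (simp add: Q_def prob_space)
  qed
  then have "\<exists>B. \<forall>n k. Q n k (B n k)" by metis
  then show ?thesis using C unfolding Q_def by (intro exI[of _ "C + exp (1/2)"]) (simp add: add_pos_pos)
qed

lemma tall_peaks_cover:
  assumes \<gamma>: "0 < \<gamma>'" "\<gamma>' < \<gamma>" and \<rho>: "1 - \<gamma>'\<^sup>2 < \<rho>"
    and g: "\<And>n x. exp (real n) \<le> x \<Longrightarrow> sqrt (2 * real n) \<le> g x" "\<And>x. 0 < g x"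
  shows "AE \<omega> in M. \<exists>S :: nat \<Rightarrow> nat set. (\<forall>n. finite (S n)) \<and>
    (\<Sum>n. ennreal (exp (- \<rho> * real n) * real (card (S n)))) < \<infinity> \<and>
    (\<forall>n. tall_peaks c g (\<lambda>x. X x \<omega>) \<gamma> \<inter> macro_shell (Suc n) \<subseteq> (\<Union>k\<in>S n. {real k..<real k + 1}))"
proof -
  obtain C and B :: "nat \<Rightarrow> nat \<Rightarrow> 'w set" where C: "0 < C" and B[measurable]: "\<And>n k. B n k \<in> events"
    and pB: "\<And>n k. prob (B n k) \<le> C * exp (- \<gamma>'\<^sup>2 * real n)"
    and sup: "\<And>n k. \<forall>\<omega>\<in>space M - B n k. continuous_on UNIV (\<lambda>x. X x \<omega>) \<longrightarrow>
      (\<forall>x\<in>{real k..real k + 1}. \<bar>X x \<omega>\<bar> \<le> \<gamma> * sqrt (2 * real n))"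
    using bad_events[OF \<gamma>] by blast
  define K where "K n = nat \<lceil>exp (real (Suc n))\<rceil>" for n
  have K: "exp (real (Suc n)) \<le> real (K n)" "real (K n) \<le> 2 * exp 1 * exp (real n)" for n
  proof -
    show "exp (real (Suc n)) \<le> real (K n)" unfolding K_def by (rule real_nat_ceiling_ge)
    have "0 \<le> \<lceil>exp (real (Suc n))\<rceil>" by (metis ceiling_mono ceiling_zero exp_ge_zero)
    then have "real (K n) = of_int \<lceil>exp (real (Suc n))\<rceil>" unfolding K_def by (rule of_nat_nat)
    then have "real (K n) \<le> exp (real (Suc n)) + 1" using of_int_ceiling_le_add_one by metis
    also have "\<dots> \<le> 2 * exp (real (Suc n))" by simp
    finally show "real (K n) \<le> 2 * exp 1 * exp (real n)" by (simp add: exp_add)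
  qed
  define S where "S \<omega> n = {k. k < K n \<and> \<omega> \<in> B n k}" for \<omega> n
  have card: "real (card (S \<omega> n)) = (\<Sum>k<K n. indicator (B n k) \<omega>)" for \<omega> n
  proof -
    have "S \<omega> n = {k \<in> {..<K n}. \<omega> \<in> B n k}" by (auto simp: S_def)
    then show ?thesis by (simp add: indicator_def sum.If_cases Int_def)
  qed
  define q where "q = exp (1 - \<rho> - \<gamma>'\<^sup>2)"
  have q: "0 < q" "q < 1" using \<rho> by (auto simp: q_def)
  have "(\<integral>\<^sup>+\<omega>. (\<Sum>n. ennreal (exp (- \<rho> * real n) * real (card (S \<omega> n)))) \<partial>M)
      = (\<Sum>n. \<integral>\<^sup>+\<omega>. ennreal (exp (- \<rho> * real n) * real (card (S \<omega> n))) \<partial>M)"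
    unfolding card by (rule nn_integral_suminf) measurable
  also have "\<dots> \<le> (\<Sum>n. ennreal (2 * exp 1 * C * q^n))"
  proof (rule suminf_le)
    fix n
    have "(\<integral>\<^sup>+\<omega>. ennreal (exp (- \<rho> * real n) * real (card (S \<omega> n))) \<partial>M)
        = (\<integral>\<^sup>+\<omega>. ennreal (exp (- \<rho> * real n)) * (\<Sum>k<K n. indicator (B n k) \<omega>) \<partial>M)"
      unfolding card by (intro nn_integral_cong) (simp add: ennreal_mult sum_nonneg sum_ennreal[symmetric] ennreal_indicator)
    also have "\<dots> = ennreal (exp (- \<rho> * real n)) * (\<Sum>k<K n. emeasure M (B n k))"
      by (subst nn_integral_cmult, measurable) (subst nn_integral_sum, auto)
    also have "\<dots> = ennreal (exp (- \<rho> * real n) * (\<Sum>k<K n. prob (B n k)))"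
      by (simp add: emeasure_eq_measure ennreal_mult sum_nonneg)
    also have "exp (- \<rho> * real n) * (\<Sum>k<K n. prob (B n k)) \<le> exp (- \<rho> * real n) * (real (card {..<K n}) * (C * exp (- \<gamma>'\<^sup>2 * real n)))"
      by (intro mult_left_mono sum_bounded_above pB) auto
    also have "\<dots> \<le> exp (- \<rho> * real n) * ((2 * exp 1 * exp (real n)) * (C * exp (- \<gamma>'\<^sup>2 * real n)))"
      using C K(2)[of n] by (intro mult_left_mono mult_right_mono) auto
    also have "\<dots> = 2 * exp 1 * C * (exp (- \<rho> * real n) * exp (real n) * exp (- \<gamma>'\<^sup>2 * real n))" by simp
    also have "exp (- \<rho> * real n) * exp (real n) * exp (- \<gamma>'\<^sup>2 * real n) = q^n"
      by (simp add: q_def exp_of_nat_mult[symmetric] exp_add[symmetric] algebra_simps)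
    finally show "(\<integral>\<^sup>+\<omega>. ennreal (exp (- \<rho> * real n) * real (card (S \<omega> n))) \<partial>M) \<le> ennreal (2 * exp 1 * C * q^n)"
      by (simp add: ennreal_leI)
  qed auto
  also have "\<dots> < \<infinity>"
    using q C by (subst suminf_ennreal2) (auto intro!: summable_mult summable_geometric)
  finally have fin: "(\<integral>\<^sup>+\<omega>. (\<Sum>n. ennreal (exp (- \<rho> * real n) * real (card (S \<omega> n)))) \<partial>M) < \<infinity>" .
  have "(\<lambda>\<omega>. \<Sum>n. ennreal (exp (- \<rho> * real n) * real (card (S \<omega> n)))) \<in> borel_measurable M"
    unfolding card by measurable
  then have "AE \<omega> in M. (\<Sum>n. ennreal (exp (- \<rho> * real n) * real (card (S \<omega> n)))) \<noteq> \<infinity>"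
    by (rule nn_integral_noteq_infinite) (use fin in simp)
  with continuous AE_space show ?thesis
  proof eventually_elim
    case (elim \<omega>)
    show ?case
    proof (intro exI[of _ "S \<omega>"] conjI allI)
      show "finite (S \<omega> n)" for n by (simp add: S_def)
      show "(\<Sum>n. ennreal (exp (- \<rho> * real n) * real (card (S \<omega> n)))) < \<infinity>"
        using elim by (simp add: less_top)
      show "tall_peaks c g (\<lambda>x. X x \<omega>) \<gamma> \<inter> macro_shell (Suc n) \<subseteq> (\<Union>k\<in>S \<omega> n. {real k..<real k + 1})" for n
      proof
        fix x assume x: "x \<in> tall_peaks c g (\<lambda>x. X x \<omega>) \<gamma> \<inter> macro_shell (Suc n)"
        then have x0: "0 \<le> x" and gx: "\<gamma> < \<bar>X x \<omega>\<bar> / g x" by (auto simp: tall_peaks_def)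
        have sh: "exp (real n) \<le> x" "x < exp (real (Suc n))" using x macro_shell_real[OF x0] by auto
        define k where "k = nat \<lfloor>x\<rfloor>"
        have k: "real k \<le> x" "x < real k + 1" using x0 by (auto simp: k_def)
        have "real k < real (K n)" using k(1) sh(2) K(1)[of n] by linarith
        then have kK: "k < K n" by simp
        have "\<gamma> * sqrt (2 * real n) \<le> \<gamma> * g x" using g(1)[OF sh(1)] \<gamma> by (intro mult_left_mono) auto
        also have "\<dots> < \<bar>X x \<omega>\<bar>" using gx g(2)[of x] by (simp add: field_simps)
        finally have "\<omega> \<in> B n k" using sup[of n k] elim k by force
        then show "x \<in> (\<Union>k\<in>S \<omega> n. {real k..<real k + 1})" using k kK by (auto simp: S_def)
      qed
    qed
  qed
qed

lemma tall_peaks_content_summable: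
  assumes \<gamma>: "0 < \<gamma>" and \<rho>: "1 - \<gamma>\<^sup>2 < \<rho>" "0 < \<rho>"
    and g: "\<And>n x. exp (real n) \<le> x \<Longrightarrow> sqrt (2 * real n) \<le> g x" "\<And>x. 0 < g x"
  shows "AE \<omega> in M. (\<Sum>n. macro_content \<rho> (Suc n) (tall_peaks c g (\<lambda>x. X x \<omega>) \<gamma>)) < \<infinity>"
proof -
  \<comment> \<open>The square of \<gamma>' is the midpoint of 1 - \<rho> and \<gamma>^2; the
    maximum with 0 keeps the radicand positive when \<rho> exceeds 1.\<close>
  define \<gamma>' where "\<gamma>' = sqrt ((\<gamma>\<^sup>2 + max 0 (1 - \<rho>)) / 2)"
  have "max 0 (1 - \<rho>) < \<gamma>\<^sup>2" using \<gamma> \<rho> by auto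
  then have *: "\<gamma>'\<^sup>2 < \<gamma>\<^sup>2" "max 0 (1 - \<rho>) < \<gamma>'\<^sup>2" "0 \<le> \<gamma>'"
    by (auto simp: \<gamma>'_def)
  then have "\<gamma>' < \<gamma>" "0 < \<gamma>'" "1 - \<gamma>'\<^sup>2 < \<rho>"
    using \<gamma> by (auto simp: power_less_imp_less_base less_le)
  from tall_peaks_cover[OF this(2,1,3), where g=g and c=c] g
  have "AE \<omega> in M. \<exists>S :: nat \<Rightarrow> nat set. (\<forall>n. finite (S n)) \<and>
    (\<Sum>n. ennreal (exp (- \<rho> * real n) * real (card (S n)))) < \<infinity> \<and>
    (\<forall>n. tall_peaks c g (\<lambda>x. X x \<omega>) \<gamma> \<inter> macro_shell (Suc n) \<subseteq> (\<Union>k\<in>S n. {real k..<real k + 1}))" by blast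
  then show ?thesis
  proof eventually_elim
    case (elim \<omega>)
    then obtain S :: "nat \<Rightarrow> nat set" where S: "\<And>n. finite (S n)"
      "(\<Sum>n. ennreal (exp (- \<rho> * real n) * real (card (S n)))) < \<infinity>"
      "\<And>n. tall_peaks c g (\<lambda>x. X x \<omega>) \<gamma> \<inter> macro_shell (Suc n) \<subseteq> (\<Union>k\<in>S n. {real k..<real k + 1})" by blast
    have "(\<Sum>n. macro_content \<rho> (Suc n) (tall_peaks c g (\<lambda>x. X x \<omega>) \<gamma>))
        \<le> (\<Sum>n. ennreal (exp (- \<rho> * real n) * real (card (S n))))"
    proof (rule suminf_le)
      fix n
      have "macro_content \<rho> (Suc n) (tall_peaks c g (\<lambda>x. X x \<omega>) \<gamma>) \<le> ennreal (exp (- \<rho> * real (Suc n)) * real (card (S n)))"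
        by (rule macro_content_le_unit_cover[OF S(1,3)])
      also have "\<dots> \<le> ennreal (exp (- \<rho> * real n) * real (card (S n)))"
        using \<rho>(2) by (intro ennreal_leI mult_right_mono) auto
      finally show "macro_content \<rho> (Suc n) (tall_peaks c g (\<lambda>x. X x \<omega>) \<gamma>) \<le> ennreal (exp (- \<rho> * real n) * real (card (S n)))" .
    qed auto
    with S(2) show ?case by (rule le_less_trans[rotated])
  qed
qed

text \<open>With weight \<rho> = 0 the cover bounds the number of occupied intervals itself. A
  convergent series of natural numbers is eventually zero, so shells far out contain no
  peak.\<close>

lemma tall_peaks_bounded:
  assumes \<gamma>: "1 < \<gamma>"
    and g: "\<And>n x. exp (real n) \<le> x \<Longrightarrow> sqrt (2 * real n) \<le> g x" "\<And>x. 0 < g x"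
  shows "AE \<omega> in M. bounded (tall_peaks c g (\<lambda>x. X x \<omega>) \<gamma>)"
proof -
  define \<gamma>' where "\<gamma>' = (1 + \<gamma>) / 2"
  have "0 < \<gamma>'" "\<gamma>' < \<gamma>" "1 < \<gamma>'" using \<gamma> by (auto simp: \<gamma>'_def)
  moreover from this have "1 - \<gamma>'\<^sup>2 < 0" by (simp add: one_less_power)
  ultimately have "AE \<omega> in M. \<exists>S :: nat \<Rightarrow> nat set. (\<forall>n. finite (S n)) \<and>
    (\<Sum>n. ennreal (exp (- 0 * real n) * real (card (S n)))) < \<infinity> \<and>
    (\<forall>n. tall_peaks c g (\<lambda>x. X x \<omega>) \<gamma> \<inter> macro_shell (Suc n) \<subseteq> (\<Union>k\<in>S n. {real k..<real k + 1}))"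
    using g by (intro tall_peaks_cover) auto
  then show ?thesis
  proof eventually_elim
    case (elim \<omega>)
    let ?E = "tall_peaks c g (\<lambda>x. X x \<omega>) \<gamma>"
    obtain S :: "nat \<Rightarrow> nat set" where S: "\<And>n. finite (S n)"
      "(\<Sum>n. ennreal (real (card (S n)))) < \<infinity>"
      "\<And>n. ?E \<inter> macro_shell (Suc n) \<subseteq> (\<Union>k\<in>S n. {real k..<real k + 1})" using elim by auto
    have "summable (\<lambda>n. real (card (S n)))"
      using S(2) by (intro summable_suminf_not_top) auto
    then have "(\<lambda>n. real (card (S n))) \<longlonglongrightarrow> 0" by (rule summable_LIMSEQ_zero)
    from order_tendstoD(2)[OF this, of 1] obtain n0 where n0: "\<And>n. n0 \<le> n \<Longrightarrow> real (card (S n)) < 1"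
      by (auto simp: eventually_sequentially)
    then have empty: "S n = {}" if "n0 \<le> n" for n using that S(1)[of n] by force
    have "?E \<subseteq> {0..exp (real n0)}"
    proof
      fix x assume x: "x \<in> ?E"
      then have x0: "0 \<le> x" by (auto simp: tall_peaks_def)
      have "x \<le> exp (real n0)"
      proof (rule ccontr)
        assume "\<not> x \<le> exp (real n0)"
        then have big: "exp (real n0) < x" by simp
        then have xpos: "0 < x" using exp_gt_zero[of "real n0"] by linarith
        have lx: "real n0 < ln x" using big xpos by (metis exp_less_cancel_iff exp_ln)
        define n where "n = nat \<lfloor>ln x\<rfloor>"
        have n: "real n \<le> ln x" "ln x < real n + 1" using lx by (auto simp: n_def)
        have "n0 \<le> n" unfolding n_def using lx by linarith
        have "exp (real n) \<le> exp (ln x)" using n by simp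
        moreover have "exp (ln x) < exp (real (Suc n))" using n by simp
        ultimately have "x \<in> macro_shell (Suc n)" using macro_shell_real[OF x0, of n] xpos by simp
        then show False using S(3)[of n] x empty[OF \<open>n0 \<le> n\<close>] by auto
      qed
      with x0 show "x \<in> {0..exp (real n0)}" by simp
    qed
    then show ?case by (rule bounded_subset[rotated]) simp
  qed
qed

end

section \<open>Tall peaks in every block\<close>

lemma card_nat_in_interval:
  fixes T :: "nat set"
  assumes T: "\<And>j. j \<in> T \<Longrightarrow> a < real j" "\<And>j. j \<in> T \<Longrightarrow> real j < b" and fin: "finite T" and ab: "a \<le> b"
  shows "real (card T) \<le> b - a + 1"
proof (cases "T = {}")
  case False
  have "T \<subseteq> {Min T..Max T}" using fin by auto
  then have "card T \<le> card {Min T..Max T}" by (intro card_mono) auto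
  also have "\<dots> = Suc (Max T) - Min T" by simp
  finally have "real (card T) \<le> real (Max T) - real (Min T) + 1"
    using Min_le[OF fin Max_in[OF fin False]] by linarith
  also have "\<dots> \<le> b - a + 1" using T Min_in[OF fin False] Max_in[OF fin False] by fastforce
  finally show ?thesis .
qed (use ab in simp)

lemma card_UN_list_le: "card (\<Union>p\<in>set Q. H p) \<le> (\<Sum>p\<leftarrow>Q. card (H p))"
proof (induction Q)
  case (Cons p Q)
  have "card (H p \<union> (\<Union>p\<in>set Q. H p)) \<le> card (H p) + card (\<Union>p\<in>set Q. H p)" by (rule card_Un_le)
  with Cons.IH show ?case by simp
qed simp

text \<open>A box of side \<open>r\<close> meets at most \<open>r / D + 2\<close> of the blocks, which all have to be covered.\<close>

lemma macro_content_ge_of_blocks: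
  fixes E :: "real set"
  assumes D: "0 < D" "D \<le> exp (real (Suc n) * (1 - \<rho>))"
    and N: "exp (real n) + real N * D \<le> exp (real (Suc n))" "exp (real n) \<le> 2 * (real N * D)"
    and hit: "\<And>j. j < N \<Longrightarrow> \<exists>x\<in>E. exp (real n) + real j * D \<le> x \<and> x < exp (real n) + (real j + 1) * D"
    and \<rho>: "0 < \<rho>'" "\<rho>' \<le> \<rho>" "\<rho> \<le> 1"
  shows "ennreal (1 / (6 * exp 1)) \<le> macro_content \<rho>' (Suc n) E"
  unfolding macro_content_def
proof (rule INF_greatest, rule ennreal_leI)
  fix Q :: "(real \<times> real) list"
  assume "Q \<in> {Q. (\<forall>(x, r)\<in>set Q. 1 \<le> r) \<and> E \<inter> macro_shell (Suc n) \<subseteq> (\<Union>(x, r)\<in>set Q. upright_box x r)}"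
  then have r1: "\<And>x r. (x, r) \<in> set Q \<Longrightarrow> 1 \<le> r"
    and cover: "E \<inter> macro_shell (Suc n) \<subseteq> (\<Union>(x, r)\<in>set Q. upright_box x r)" by auto
  define s where "s = exp (real (Suc n))"
  have s: "1 \<le> s" "0 < s" by (auto simp: s_def)
  let ?S = "\<Sum>(x, r)\<leftarrow>Q. (r / s) powr \<rho>'"
  have "(1::real) \<le> 6 * exp 1" using exp_ge_add_one_self[of "1::real"] by linarith
  then have e: "1 / (6 * exp 1) \<le> (1::real)" using frac_le[of 1 1 1 "6 * exp 1 :: real"] by simp
  have "1 / (6 * exp 1) \<le> ?S"
  proof (cases "\<exists>(x, r)\<in>set Q. s < r")
    \<comment> \<open>A box longer than the radius of the shell alone contributes at least 1;
      otherwise all ratios r/s lie in (0, 1].\<close>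
    case True
    then obtain x r where xr: "(x, r) \<in> set Q" "s < r" by auto
    obtain Q1 Q2 where Q: "Q = Q1 @ (x, r) # Q2" using xr(1) by (meson in_set_conv_decomp)
    have nn: "0 \<le> (\<Sum>(x, r)\<leftarrow>L. (r / s) powr \<rho>')" for L :: "(real \<times> real) list"
      by (rule sum_list_nonneg) auto
    have "1 \<le> (r / s) powr \<rho>'" using xr s \<rho> by (intro ge_one_powr_ge_zero) auto
    then have "1 \<le> ?S" using nn[of Q1] nn[of Q2] by (simp add: Q)
    with e show ?thesis by linarith
  next
    case False
    then have rs: "r \<le> s" if "(x, r) \<in> set Q" for x r using that by force
    \<comment> \<open>The indices of the blocks that the box p meets, block j being the interval of
      length D that starts at e^n + j D.\<close>
    define H where "H p = {j \<in> {..<N}. fst p - exp (real n) - D < real j * D \<and> real j * D < fst p + snd p - exp (real n)}" for p :: "real \<times> real"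
    have cardH: "real (card (H p)) \<le> snd p / D + 2" if "p \<in> set Q" for p
    proof -
      have r: "1 \<le> snd p" using r1[of "fst p" "snd p"] that by simp
      have "real (card (H p)) \<le> (fst p + snd p - exp (real n)) / D - (fst p - exp (real n) - D) / D + 1"
        by (rule card_nat_in_interval)
          (use D r in \<open>auto simp: H_def pos_divide_less_eq pos_less_divide_eq intro!: divide_right_mono\<close>)
      also have "\<dots> = snd p / D + 2" using D by (simp add: diff_divide_distrib add_divide_distrib)
      finally show ?thesis .
    qed
    have "{..<N} \<subseteq> (\<Union>p\<in>set Q. H p)"
    proof
      fix j assume j: "j \<in> {..<N}"
      then obtain x where x: "x \<in> E" "exp (real n) + real j * D \<le> x" "x < exp (real n) + (real j + 1) * D"
        using hit[of j] by auto
      have "0 \<le> real j * D" using D by simp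
      then have x0: "0 \<le> x" "exp (real n) \<le> x" using x(2) exp_ge_zero[of "real n"] by linarith+
      have "(real j + 1) * D \<le> real N * D" using j D by (intro mult_right_mono) auto
      then have "x < exp (real (Suc n))" using x(3) N(1) by linarith
      then have "x \<in> macro_shell (Suc n)" using macro_shell_real[OF x0(1)] x0(2) by simp
      then obtain y r where yr: "(y, r) \<in> set Q" "x \<in> upright_box y r" using cover x(1) by blast
      then have "y \<le> x" "x < y + r" by (auto simp: upright_box_def)
      moreover have "(real j + 1) * D = real j * D + D" by (simp add: algebra_simps)
      ultimately have "j \<in> H (y, r)" using j x by (simp add: H_def)
      then show "j \<in> (\<Union>p\<in>set Q. H p)" using yr(1) by blast
    qed
    then have "card {..<N} \<le> card (\<Union>p\<in>set Q. H p)" by (intro card_mono) (auto simp: H_def)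
    also have "\<dots> \<le> (\<Sum>p\<leftarrow>Q. card (H p))" by (rule card_UN_list_le)
    finally have "real N \<le> real (\<Sum>p\<leftarrow>Q. card (H p))" by (simp only: card_lessThan of_nat_le_iff)
    also have "\<dots> = (\<Sum>p\<leftarrow>Q. real (card (H p)))" by (induction Q) auto
    also have "\<dots> \<le> (\<Sum>(x, r)\<leftarrow>Q. 3 * s / D * (r / s) powr \<rho>')"
    proof (rule sum_list_mono)
      fix p assume p: "p \<in> set Q"
      obtain x r where xr: "p = (x, r)" by force
      have r: "1 \<le> r" "r \<le> s" using r1 rs p xr by auto
      define v where "v = r / s"
      have v: "0 < v" "v \<le> 1" "1 / s \<le> v" using r s by (auto simp: v_def divide_right_mono)
      have v1: "v \<le> v powr \<rho>'" using powr_mono'[of \<rho>' 1 v] v \<rho> by simp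
      \<comment> \<open>Sides are at least 1 and D is at most s^(1 - \<rho>), so even the smallest
        box has weight at least D/s. This absorbs the 2 in r/D + 2 and gives the factor 3. As v
        \<le> 1, passing to a smaller exponent only increases the weight.\<close>
      have "1 = (1 / s) powr \<rho> * s powr \<rho>" using s by (simp add: powr_divide)
      also have "\<dots> \<le> v powr \<rho> * s powr \<rho>" using v s \<rho> by (intro mult_right_mono powr_mono2) auto
      also have "\<dots> \<le> v powr \<rho>' * s powr \<rho>" using v s \<rho> by (intro mult_right_mono powr_mono') auto
      also have "\<dots> \<le> v powr \<rho>' * (s / D)"
      proof (intro mult_left_mono)
        have "s powr \<rho> * D \<le> s powr \<rho> * exp (real (Suc n) * (1 - \<rho>))" by (intro mult_left_mono D) auto
        also have "\<dots> = s" unfolding s_def by (simp add: powr_def exp_add[symmetric] algebra_simps)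
        finally show "s powr \<rho> \<le> s / D" using D by (simp add: pos_le_divide_eq)
      qed simp
      finally have v2: "1 \<le> v powr \<rho>' * (s / D)" .
      have "real (card (H p)) \<le> r / D + 2" using cardH[OF p] xr by simp
      also have "r / D = v * (s / D)" using s by (simp add: v_def)
      also have "\<dots> \<le> v powr \<rho>' * (s / D)" using v1 s D by (intro mult_right_mono) auto
      finally have "real (card (H p)) \<le> 3 * (v powr \<rho>' * (s / D))" using v2 by linarith
      then show "real (card (H p)) \<le> (case p of (x, r) \<Rightarrow> 3 * s / D * (r / s) powr \<rho>')"
        by (simp add: xr v_def mult_ac)
    qed
    also have "\<dots> = 3 * s / D * ?S" by (induction Q) (auto simp: algebra_simps)
    \<comment> \<open>The blocks fill at least half of e^n and s = e * e^n, whence the constant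
      1/(6e).\<close>
    finally have "real N * D \<le> 3 * s * ?S" using D by (simp add: field_simps)
    then have "exp (real n) \<le> 6 * s * ?S" using N(2) by linarith
    also have "6 * s * ?S = exp (real n) * (6 * exp 1 * ?S)" by (simp add: s_def exp_add)
    finally have "1 \<le> 6 * exp 1 * ?S" by simp
    then show ?thesis by (simp add: divide_le_eq mult.commute)
  qed
  then show "1 / (6 * exp 1) \<le> (\<Sum>(x, r)\<leftarrow>Q. (r / exp (real (Suc n))) powr \<rho>')" by (simp add: s_def)
qed

lemma suminf_ennreal_eventually_ge:
  fixes h :: "nat \<Rightarrow> ennreal"
  assumes "eventually (\<lambda>n. ennreal c \<le> h n) sequentially" "0 < c"
  shows "\<not> suminf h < \<infinity>"
proof
  assume fin: "suminf h < \<infinity>"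
  have hn: "h n \<noteq> \<infinity>" for n
    using fin sum_le_suminf[of h "{n}"] by (auto simp: top_unique)
  then have h: "h n = ennreal (enn2real (h n))" for n by (simp add: less_top)
  have "summable (\<lambda>n. enn2real (h n))"
    using fin h by (intro summable_suminf_not_top) auto
  then have "(\<lambda>n. enn2real (h n)) \<longlonglongrightarrow> 0" by (rule summable_LIMSEQ_zero)
  from order_tendstoD(2)[OF this assms(2)] assms(1)
  have "eventually (\<lambda>n. False) sequentially"
  proof eventually_elim
    case (elim n)
    then have "ennreal c \<le> ennreal (enn2real (h n))" using h[of n] by simp
    with elim show ?case by (simp add: ennreal_le_iff)
  qed
  then show False by simp
qed

section \<open>Lower bound: probability that some block has no peak\<close>

context gaussian_field
begin

text \<open>Here s is the shell index, q a lower bound for the exceedance probability of one point,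
  d the cutoff error. In turn: the error is at most half of q; a block has on average at least 2s
  exceedances; the errors of all blocks together are summable; rounding the number of points down is
  harmless; blocks are short compared with the shell. The second claim is where \<rho> < 1 -
  \<gamma>^2 is decisive.\<close>

lemma exceedance_asymptotics:
  assumes \<gamma>: "0 < \<gamma>" and \<rho>0: "0 < \<rho>" and \<rho>: "\<rho> < 1 - \<gamma>\<^sup>2"
  defines "q \<equiv> (\<lambda>s. exp (- (\<gamma> * sqrt (2 * s) + 2)\<^sup>2 / 2) / sqrt (2 * pi))"
    and "d \<equiv> (\<lambda>s. A * exp (- s\<^sup>2 / (2 * t)))"
  shows "eventually (\<lambda>s. 40 * d s \<le> q s / 2) at_top"
    and "eventually (\<lambda>s. 2 * s \<le> exp (s * (1 - \<rho>)) / (4 * s) * (q s / 2)) at_top"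
    and "eventually (\<lambda>s. exp s * (exp (s * (1 - \<rho>)) * (40 * d s)) \<le> exp (- s)) at_top"
    and "eventually (\<lambda>s. 1 \<le> exp (s * (1 - \<rho>)) / (4 * s)) at_top"
    and "eventually (\<lambda>s. exp (s * (1 - \<rho>)) \<le> exp s / 10) at_top"
proof -
  define \<epsilon> where "\<epsilon> = 1 - \<rho> - \<gamma>\<^sup>2"
  have \<epsilon>: "0 < \<epsilon>" using \<rho> by (simp add: \<epsilon>_def)
  \<comment> \<open>The shift by 2 contributes only 2\<gamma> sqrt(2s) + 2 to the exponent, which
    the linear margin \<epsilon> s dominates.\<close>
  have qe: "q s = exp (- (\<gamma>\<^sup>2 * s + 2 * \<gamma> * sqrt (2 * s) + 2)) / sqrt (2 * pi)" if "0 \<le> s" for s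
  proof -
    have "(\<gamma> * sqrt (2 * s) + 2)\<^sup>2 / 2 = \<gamma>\<^sup>2 * s + 2 * \<gamma> * sqrt (2 * s) + 2"
      using that by (simp add: power2_sum power_mult_distrib)
    then have "- (\<gamma> * sqrt (2 * s) + 2)\<^sup>2 / 2 = - (\<gamma>\<^sup>2 * s + 2 * \<gamma> * sqrt (2 * s) + 2)" by linarith
    then show ?thesis by (simp only: q_def)
  qed
  have p: "0 < 1 - \<rho>" using \<rho> \<gamma> by (smt (verit) zero_le_power2)
  have "eventually (\<lambda>s. 80 * A * sqrt (2 * pi) * exp (- s\<^sup>2 * (1 / (2 * t))) \<le> exp (- (\<gamma>\<^sup>2 * s + 2 * \<gamma> * sqrt (2 * s) + 2))) at_top"
    using t_pos A_pos \<gamma> by real_asymp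
  then show "eventually (\<lambda>s. 40 * d s \<le> q s / 2) at_top"
    using eventually_ge_at_top[of 0]
  proof eventually_elim
    case (elim s)
    then show ?case by (simp add: qe d_def field_simps)
  qed
  have "eventually (\<lambda>s::real. 16 * sqrt (2 * pi) * s\<^sup>2 \<le> exp (\<epsilon> * s - 2 * \<gamma> * sqrt (2 * s) - 2)) at_top"
    using \<epsilon> \<gamma> by real_asymp
  then show "eventually (\<lambda>s. 2 * s \<le> exp (s * (1 - \<rho>)) / (4 * s) * (q s / 2)) at_top"
    using eventually_gt_at_top[of 0]
  proof eventually_elim
    case (elim s)
    have "exp (s * (1 - \<rho>)) * q s = exp (\<epsilon> * s - 2 * \<gamma> * sqrt (2 * s) - 2) / sqrt (2 * pi)"
      using elim by (simp add: qe exp_add[symmetric] \<epsilon>_def algebra_simps)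
    with elim have "16 * s\<^sup>2 \<le> exp (s * (1 - \<rho>)) * q s" by (simp add: pos_le_divide_eq mult_ac)
    then show ?case using elim by (simp add: field_simps power2_eq_square)
  qed
  have "eventually (\<lambda>s. exp s * (exp (s * (1 - \<rho>)) * (40 * (A * exp (- s\<^sup>2 * (1 / (2 * t)))))) \<le> exp (- s)) at_top"
    using t_pos A_pos p by real_asymp
  then show "eventually (\<lambda>s. exp s * (exp (s * (1 - \<rho>)) * (40 * d s)) \<le> exp (- s)) at_top"
    by (simp add: d_def)
  show "eventually (\<lambda>s. 1 \<le> exp (s * (1 - \<rho>)) / (4 * s)) at_top"
    using p by real_asymp
  show "eventually (\<lambda>s. exp (s * (1 - \<rho>)) \<le> exp s / 10) at_top"
    using p \<rho>0 by real_asymp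
qed


text \<open>Strips of half-width s around points at mutual distance 2s are disjoint, so
  \<open>prob_no_exceedance\<close> applies with the cutoff error at K = s.\<close>

lemma prob_block_without_peak:
  assumes s: "0 < s" and a: "0 \<le> a"
  shows "prob {\<omega> \<in> space M. \<forall>i<m. X (y + real i * (2 * s)) \<omega> \<le> a}
    \<le> exp (- real m * (exp (- (a + 2)\<^sup>2 / 2) / sqrt (2 * pi) - 40 * (A * exp (- s\<^sup>2 / (2 * t)))))
      + real m * (40 * (A * exp (- s\<^sup>2 / (2 * t))))"
proof -
  let ?x = "\<lambda>i. y + real i * (2 * s)"
  have "disjoint_family_on (\<lambda>i. {z :: real \<times> real. \<bar>snd z - ?x i\<bar> < s}) {..<m}"
  proof -
    have "i = j" if "\<bar>v - ?x i\<bar> < s" "\<bar>v - ?x j\<bar> < s" for v :: real and i j :: nat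
    proof (rule ccontr)
      assume "i \<noteq> j"
      then have "1 \<le> \<bar>real i - real j\<bar>" by linarith
      then have "1 * (2 * s) \<le> \<bar>real i - real j\<bar> * (2 * s)" using s by (intro mult_right_mono) auto
      also have "\<dots> = \<bar>(real i - real j) * (2 * s)\<bar>" using s by (simp add: abs_mult)
      also have "(real i - real j) * (2 * s) = ?x i - ?x j" by (simp add: left_diff_distrib)
      also have "\<bar>?x i - ?x j\<bar> < 2 * s" using that by linarith
      finally show False by simp
    qed
    then show ?thesis by (auto simp: disjoint_family_on_def)
  qed
  then have "prob {\<omega> \<in> space M. \<forall>i\<in>{..<m}. X (?x i) \<omega> \<le> a}
    \<le> exp (- real (card {..<m}) * (exp (- (a + 2)\<^sup>2 / 2) / sqrt (2 * pi) - 40 * (A * exp (- s\<^sup>2 / (2 * t)))))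
      + real (card {..<m}) * (40 * (A * exp (- s\<^sup>2 / (2 * t))))"
    using s a A_pos cutoff[OF less_imp_le[OF s]]
    by (intro prob_no_exceedance[where f="\<lambda>i. f (?x i)" and S="\<lambda>i. {z. \<bar>snd z - ?x i\<bar> < s}"])
      (auto intro!: approx norm_one borel_open open_Collect_less continuous_intros)
  then show ?thesis by (simp add: Ball_def)
qed

text \<open>\<open>m\<close> is the number of test points in a block, \<open>L\<close> the resulting
  block length, rounded down to a multiple of the spacing, and \<open>N\<close> the number of
  complete blocks in the shell. A union bound over the blocks is summable in n, and Borel-Cantelli
  applies.\<close>

lemma blocks_eventually_hit:
  assumes \<gamma>: "0 < \<gamma>" and \<rho>: "0 < \<rho>" "\<rho> < 1 - \<gamma>\<^sup>2"
  defines "m \<equiv> (\<lambda>n. nat \<lfloor>exp (real (Suc n) * (1 - \<rho>)) / (2 * real (Suc n))\<rfloor>)"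
  defines "L \<equiv> (\<lambda>n. 2 * real (Suc n) * real (m n))"
  defines "N \<equiv> (\<lambda>n. nat \<lfloor>(exp (real (Suc n)) - exp (real n)) / L n\<rfloor>)"
  shows "AE \<omega> in M. eventually (\<lambda>n. \<forall>j<N n. \<exists>x. exp (real n) + real j * L n \<le> x \<and>
      x < exp (real n) + (real j + 1) * L n \<and> \<gamma> * sqrt (2 * real (Suc n)) < X x \<omega>) sequentially"
    and "eventually (\<lambda>n. 0 < L n \<and> L n \<le> exp (real (Suc n) * (1 - \<rho>)) \<and>
      exp (real n) + real (N n) * L n \<le> exp (real (Suc n)) \<and> exp (real n) \<le> 2 * (real (N n) * L n)) sequentially"
proof -
  let ?q = "\<lambda>s. exp (- (\<gamma> * sqrt (2 * s) + 2)\<^sup>2 / 2) / sqrt (2 * pi)"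
  let ?d = "\<lambda>s. A * exp (- s\<^sup>2 / (2 * t))"
  have lim: "filterlim (\<lambda>n. real (Suc n)) at_top sequentially"
    by (rule filterlim_compose[OF filterlim_real_sequentially filterlim_Suc])
  note asym = exceedance_asymptotics[OF \<gamma> \<rho>]
  note ev = eventually_compose_filterlim[OF asym(1) lim] eventually_compose_filterlim[OF asym(2) lim]
    eventually_compose_filterlim[OF asym(3) lim] eventually_compose_filterlim[OF asym(4) lim]
    eventually_compose_filterlim[OF asym(5) lim]
  have m_le: "2 * real (Suc n) * real (m n) \<le> exp (real (Suc n) * (1 - \<rho>))" for n
  proof -
    have "real (m n) \<le> exp (real (Suc n) * (1 - \<rho>)) / (2 * real (Suc n))"
      unfolding m_def by (rule of_nat_floor) simp
    then show ?thesis by (simp add: pos_le_divide_eq mult_ac del: of_nat_Suc)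
  qed
  \<comment> \<open>Rounding 2e down leaves at least 2e - 1, hence at least e once e \<ge> 1: this
    is why the denominator grows from 2 to 4.\<close>
  have m_ge: "exp (real (Suc n) * (1 - \<rho>)) / (4 * real (Suc n)) \<le> real (m n)"
    if "1 \<le> exp (real (Suc n) * (1 - \<rho>)) / (4 * real (Suc n))" for n
  proof -
    let ?e = "exp (real (Suc n) * (1 - \<rho>)) / (4 * real (Suc n))"
    have e2: "exp (real (Suc n) * (1 - \<rho>)) / (2 * real (Suc n)) = 2 * ?e" by (simp del: of_nat_Suc)
    have "2 * ?e - 1 \<le> real (m n)" unfolding m_def e2 by linarith
    then show ?thesis using that by linarith
  qed
  show "eventually (\<lambda>n. 0 < L n \<and> L n \<le> exp (real (Suc n) * (1 - \<rho>)) \<and>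
      exp (real n) + real (N n) * L n \<le> exp (real (Suc n)) \<and> exp (real n) \<le> 2 * (real (N n) * L n)) sequentially"
    using ev(4,5)
  proof eventually_elim
    case (elim n)
    have "0 < real (m n)" using m_ge[OF elim(1)] elim(1) by linarith
    then have D0: "0 < L n" by (simp add: L_def)
    have D1: "L n \<le> exp (real (Suc n) * (1 - \<rho>))" using m_le by (simp add: L_def)
    have ee: "2 * exp (real n) \<le> exp (real (Suc n))"
      using exp_ge_add_one_self[of "1::real"] by (simp add: exp_add)
    \<comment> \<open>Since 3/10 \<le> 1/2, the bound exp(n + 1)/10 on the block length gives at
      most e^n/2. The shell has width at least e^n, so the incomplete last block leaves at least
      half of e^n covered.\<close>
    have "exp (real (Suc n)) \<le> 3 * exp (real n)"
      using e_less_272 by (simp add: exp_add)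
    then have D2: "L n \<le> exp (real n) / 2" using D1 elim(2) exp_ge_zero[of "real n"] by linarith
    have pos: "0 \<le> (exp (real (Suc n)) - exp (real n)) / L n" using D0 by simp
    have "real (N n) \<le> (exp (real (Suc n)) - exp (real n)) / L n"
      unfolding N_def by (rule of_nat_floor[OF pos])
    then have N1: "exp (real n) + real (N n) * L n \<le> exp (real (Suc n))"
      using D0 by (simp add: pos_le_divide_eq del: of_nat_Suc)
    have "(exp (real (Suc n)) - exp (real n)) / L n - 1 \<le> real (N n)" unfolding N_def by linarith
    then have "exp (real (Suc n)) - exp (real n) \<le> (real (N n) + 1) * L n"
      using D0 by (simp add: pos_divide_le_eq diff_le_eq del: of_nat_Suc)
    then have "exp (real n) \<le> 2 * (real (N n) * L n)" using D2 ee by (simp add: distrib_right del: of_nat_Suc)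
    with D0 D1 N1 show ?case by blast
  qed
  define F where "F n = (\<Union>j\<in>{..<N n}. {\<omega> \<in> space M. \<forall>i<m n. X ((exp (real n) + real j * L n) + real i * (2 * real (Suc n))) \<omega> \<le> \<gamma> * sqrt (2 * real (Suc n))})" for n
  have F[measurable]: "F n \<in> events" for n unfolding F_def by measurable
  have "eventually (\<lambda>n. prob (F n) \<le> 2 * exp (-1)^(Suc n)) sequentially"
    using ev(1-4)
  proof eventually_elim
    case (elim n)
    define s where "s = real (Suc n)"
    have s: "0 < s" by (simp add: s_def)
    note elim = elim[folded s_def]
    let ?p = "exp (- real (m n) * (?q s - 40 * ?d s)) + real (m n) * (40 * ?d s)"
    have mg: "exp (s * (1 - \<rho>)) / (4 * s) \<le> real (m n)" using m_ge[of n] elim(4) unfolding s_def by blast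
    have ml: "real (m n) \<le> exp (s * (1 - \<rho>))"
    proof -
      have "1 * real (m n) \<le> 2 * s * real (m n)" by (intro mult_right_mono) (auto simp: s_def)
      then show ?thesis using m_le[of n] by (simp add: s_def)
    qed
    have d0: "0 < ?d s" using A_pos by simp
    \<comment> \<open>The exponent 2s leaves e^(-s) after the union bound over at most e^s
      blocks.\<close>
    have "2 * s \<le> exp (s * (1 - \<rho>)) / (4 * s) * (?q s / 2)" by (rule elim(2))
    also have "\<dots> \<le> real (m n) * (?q s / 2)" by (intro mult_right_mono mg) auto
    also have "\<dots> \<le> real (m n) * (?q s - 40 * ?d s)" using elim(1) by (intro mult_left_mono) auto
    finally have e1: "exp (- real (m n) * (?q s - 40 * ?d s)) \<le> exp (- 2 * s)" by simp
    have "exp s * (real (m n) * (40 * ?d s)) \<le> exp s * (exp (s * (1 - \<rho>)) * (40 * ?d s))"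
      using ml d0 by (intro mult_left_mono mult_right_mono) auto
    also have "\<dots> \<le> exp (- s)" by (rule elim(3))
    finally have e2: "exp s * (real (m n) * (40 * ?d s)) \<le> exp (- s)" .
    have "exp s * exp (- real (m n) * (?q s - 40 * ?d s)) \<le> exp s * exp (- 2 * s)"
      using e1 by (intro mult_left_mono) auto
    also have "\<dots> = exp (- s)" by (simp add: exp_add[symmetric])
    finally have e3: "exp s * ?p \<le> 2 * exp (- s)" using e2 by (simp add: distrib_left)
    have "0 < real (m n)" using mg elim(4) by linarith
    then have "1 \<le> real (m n)" by simp
    then have "1 * 1 \<le> 2 * real (Suc n) * real (m n)" by (intro mult_mono) auto
    then have D1: "1 \<le> L n" by (simp add: L_def)
    have Np: "real (N n) \<le> exp s"
    proof -
      have "real (N n) \<le> (exp (real (Suc n)) - exp (real n)) / L n"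
        unfolding N_def using D1 by (intro of_nat_floor) auto
      also have "\<dots> \<le> exp (real (Suc n)) - exp (real n)" using D1 by (simp add: divide_le_eq mult_le_cancel_left1)
      also have "\<dots> \<le> exp s" by (simp add: s_def)
      finally show ?thesis .
    qed
    have p0: "0 \<le> ?p" using A_pos by (intro add_nonneg_nonneg mult_nonneg_nonneg) auto
    have "prob (F n) \<le> (\<Sum>j\<in>{..<N n}. prob {\<omega> \<in> space M. \<forall>i<m n. X ((exp (real n) + real j * L n) + real i * (2 * s)) \<omega> \<le> \<gamma> * sqrt (2 * s)})"
      unfolding F_def s_def by (rule finite_measure_subadditive_finite) auto
    also have "\<dots> \<le> real (card {..<N n}) * ?p"
      using \<gamma> s by (intro sum_bounded_above prob_block_without_peak) auto
    also have "\<dots> \<le> exp s * ?p" using Np p0 by (intro mult_right_mono) auto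
    also have "\<dots> \<le> 2 * exp (- s)" by (rule e3)
    also have "exp (- s) = exp (-1)^(Suc n)" by (simp only: s_def exp_of_nat_mult[symmetric]) simp
    finally show ?case .
  qed
  then have "eventually (\<lambda>n. norm (prob (F n)) \<le> 2 * exp (-1)^(Suc n)) sequentially" by simp
  moreover have "summable (\<lambda>n. 2 * exp (-1::real)^(Suc n))"
    by (intro summable_mult) (simp add: summable_geometric summable_mult)
  ultimately have "summable (\<lambda>n. prob (F n))" by (rule summable_comparison_test_ev)
  then have "AE \<omega> in M. eventually (\<lambda>n. \<omega> \<in> space M - F n) sequentially"
    by (intro borel_cantelli_AE1) (auto simp: emeasure_eq_measure)
  then show "AE \<omega> in M. eventually (\<lambda>n. \<forall>j<N n. \<exists>x. exp (real n) + real j * L n \<le> x \<and>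
      x < exp (real n) + (real j + 1) * L n \<and> \<gamma> * sqrt (2 * real (Suc n)) < X x \<omega>) sequentially"
  proof eventually_elim
    case (elim \<omega>)
    then show ?case
    proof eventually_elim
      case (elim n)
      show ?case
      proof (intro allI impI)
        fix j assume j: "j < N n"
        let ?x = "\<lambda>i. (exp (real n) + real j * L n) + real i * (2 * real (Suc n))"
        from elim j obtain i where i: "i < m n" "\<not> X (?x i) \<omega> \<le> \<gamma> * sqrt (2 * real (Suc n))"
          unfolding F_def by blast
        have "real i * (2 * real (Suc n)) < real (m n) * (2 * real (Suc n))"
          using i(1) by (intro mult_strict_right_mono) auto
        then have "?x i < exp (real n) + (real j + 1) * L n"
          by (simp add: L_def algebra_simps del: of_nat_Suc)
        moreover have "exp (real n) + real j * L n \<le> ?x i" by simp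
        ultimately show "\<exists>x. exp (real n) + real j * L n \<le> x \<and>
          x < exp (real n) + (real j + 1) * L n \<and> \<gamma> * sqrt (2 * real (Suc n)) < X x \<omega>"
          using i(2) by (intro exI[of _ "?x i"]) simp
      qed
    qed
  qed
qed

text \<open>The exponent \<rho>' is quantified inside the almost sure statement, because the infimum
  defining the dimension runs over uncountably many exponents. One family of blocks, built for
  \<rho>, serves all \<rho>' \<le> \<rho>, so a single null set suffices.\<close>

lemma tall_peaks_content_not_summable:
  assumes \<gamma>: "0 < \<gamma>" and \<rho>: "0 < \<rho>" "\<rho> < 1 - \<gamma>\<^sup>2"
    and g: "\<And>n x. x < exp (real (Suc n)) \<Longrightarrow> g x \<le> sqrt (2 * real (Suc n))" "\<And>x. 0 < g x"
  shows "AE \<omega> in M. \<forall>\<rho>'. 0 < \<rho>' \<longrightarrow> \<rho>' \<le> \<rho> \<longrightarrow>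
    \<not> (\<Sum>n. macro_content \<rho>' (Suc n) (tall_peaks c g (\<lambda>x. X x \<omega>) \<gamma>)) < \<infinity>"
proof -
  define m where "m n = nat \<lfloor>exp (real (Suc n) * (1 - \<rho>)) / (2 * real (Suc n))\<rfloor>" for n
  define L where "L n = 2 * real (Suc n) * real (m n)" for n
  define N where "N n = nat \<lfloor>(exp (real (Suc n)) - exp (real n)) / L n\<rfloor>" for n
  note hit = blocks_eventually_hit[OF \<gamma> \<rho>, folded m_def, folded L_def, folded N_def]
  have "filterlim (\<lambda>n. exp (real n)) at_top sequentially"
    by (rule filterlim_compose[OF exp_at_top filterlim_real_sequentially])
  then have big: "eventually (\<lambda>n. c < exp (real n)) sequentially" by (simp add: filterlim_at_top_dense)
  show ?thesis using hit(1)
  proof eventually_elim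
    case (elim \<omega>)
    let ?E = "tall_peaks c g (\<lambda>x. X x \<omega>) \<gamma>"
    show ?case
    proof (intro allI impI)
      fix \<rho>' assume \<rho>': "0 < \<rho>'" "\<rho>' \<le> \<rho>"
      from elim hit(2) big have "eventually (\<lambda>n. ennreal (1 / (6 * exp 1)) \<le> macro_content \<rho>' (Suc n) ?E) sequentially"
      proof eventually_elim
        case (elim n)
        have r1: "\<rho> \<le> 1" using \<rho>(2) zero_le_power2[of \<gamma>] by linarith
        show ?case
        proof (rule macro_content_ge_of_blocks[where D="L n" and N="N n" and \<rho>=\<rho>])
          fix j assume j: "j < N n"
          then obtain x where x: "exp (real n) + real j * L n \<le> x" "x < exp (real n) + (real j + 1) * L n"
            "\<gamma> * sqrt (2 * real (Suc n)) < X x \<omega>" using elim by blast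
          have "0 \<le> real j * L n" using elim by simp
          then have x0: "exp (real n) \<le> x" using x(1) by linarith
          have "(real j + 1) * L n \<le> real (N n) * L n" using j elim by (intro mult_right_mono) auto
          then have "x < exp (real (Suc n))" using x(2) elim by linarith
          then have "\<gamma> * g x \<le> \<gamma> * sqrt (2 * real (Suc n))" using g(1) \<gamma> by (intro mult_left_mono) auto
          then have "\<gamma> * g x < \<bar>X x \<omega>\<bar>" using x(3) by linarith
          then have "\<gamma> < \<bar>X x \<omega>\<bar> / g x" using g(2)[of x] by (simp add: pos_less_divide_eq)
          moreover have "0 \<le> x" "c < x" using x0 elim exp_ge_zero[of "real n"] by linarith+
          ultimately have "x \<in> ?E" by (simp add: tall_peaks_def)
          with x show "\<exists>x\<in>?E. exp (real n) + real j * L n \<le> x \<and> x < exp (real n) + (real j + 1) * L n" by blast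
        qed (use elim \<rho>' r1 in auto)
      qed
      then show "\<not> (\<Sum>n. macro_content \<rho>' (Suc n) ?E) < \<infinity>"
        by (rule suminf_ennreal_eventually_ge) simp
    qed
  qed
qed

end

section \<open>The dimension of the tall peaks\<close>

text \<open>Two sequences of exponents, decreasing and increasing to 1 - \<gamma>^2, reduce both
  bounds to countably many almost sure statements. For \<gamma> = 1 the lower bound is just the
  positivity of the exponents in the definition.\<close>

lemma (in gaussian_field) tall_peaks_dim:
  assumes \<gamma>: "0 < \<gamma>" "0 \<le> 1 - \<gamma>\<^sup>2"
    and g: "\<And>n x. exp (real n) \<le> x \<Longrightarrow> sqrt (2 * real n) \<le> g x" "\<And>x. 0 < g x"
      "\<And>n x. x < exp (real (Suc n)) \<Longrightarrow> g x \<le> sqrt (2 * real (Suc n))"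
  shows "AE \<omega> in M. macro_hausdorff_dim (tall_peaks c g (\<lambda>x. X x \<omega>) \<gamma>) = 1 - \<gamma>\<^sup>2"
proof -
  let ?\<delta> = "1 - \<gamma>\<^sup>2"
  have up: "AE \<omega> in M. \<forall>k. (\<Sum>n. macro_content (?\<delta> + inverse (real (Suc k))) (Suc n)
      (tall_peaks c g (\<lambda>x. X x \<omega>) \<gamma>)) < \<infinity>"
    unfolding AE_all_countable
    by (intro allI tall_peaks_content_summable g) (use \<gamma> in \<open>auto intro!: add_nonneg_pos simp del: of_nat_Suc\<close>)
  \<comment> \<open>The double successor keeps 1 - 1/(k + 2) positive already at k = 0.\<close>
  have low: "AE \<omega> in M. \<forall>k. 0 < ?\<delta> \<longrightarrow> (\<forall>\<rho>'. 0 < \<rho>' \<longrightarrow> \<rho>' \<le> ?\<delta> * (1 - inverse (real (Suc (Suc k)))) \<longrightarrow>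
      \<not> (\<Sum>n. macro_content \<rho>' (Suc n) (tall_peaks c g (\<lambda>x. X x \<omega>) \<gamma>)) < \<infinity>)"
    unfolding AE_all_countable
  proof (intro allI)
    fix k
    show "AE \<omega> in M. 0 < ?\<delta> \<longrightarrow> (\<forall>\<rho>'. 0 < \<rho>' \<longrightarrow> \<rho>' \<le> ?\<delta> * (1 - inverse (real (Suc (Suc k)))) \<longrightarrow>
      \<not> (\<Sum>n. macro_content \<rho>' (Suc n) (tall_peaks c g (\<lambda>x. X x \<omega>) \<gamma>)) < \<infinity>)"
    proof (cases "0 < ?\<delta>")
      case True
      have i: "0 < inverse (real (Suc (Suc k)))" "inverse (real (Suc (Suc k))) < 1"
        by (auto simp: inverse_eq_divide)
      then have "0 < ?\<delta> * (1 - inverse (real (Suc (Suc k))))" using True by (intro mult_pos_pos) auto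
      moreover have "?\<delta> * (1 - inverse (real (Suc (Suc k)))) < ?\<delta> * 1"
        using True i by (intro mult_strict_left_mono) auto
      ultimately show ?thesis
        using tall_peaks_content_not_summable[OF \<gamma>(1), of "?\<delta> * (1 - inverse (real (Suc (Suc k))))" g c] g True
        by (simp del: of_nat_Suc)
    qed simp
  qed
  from up low show ?thesis
  proof eventually_elim
    case (elim \<omega>)
    let ?E = "tall_peaks c g (\<lambda>x. X x \<omega>) \<gamma>"
    let ?S = "{\<rho>. \<rho> > 0 \<and> (\<Sum>n. macro_content \<rho> (Suc n) ?E) < \<infinity>}"
    have mem: "?\<delta> + inverse (real (Suc k)) \<in> ?S" for k
      using elim(1) \<gamma>(2) by (simp add: add_nonneg_pos del: of_nat_Suc)
    have bdd: "bdd_below ?S" by (rule bdd_belowI[of _ 0]) auto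
    have "Inf ?S \<le> ?\<delta> + inverse (real (Suc k))" for k
      by (rule cInf_lower[OF mem bdd])
    moreover have "(\<lambda>k. ?\<delta> + inverse (real (Suc k))) \<longlonglongrightarrow> ?\<delta> + 0"
      by (intro tendsto_add tendsto_const LIMSEQ_inverse_real_of_nat)
    ultimately have le: "Inf ?S \<le> ?\<delta>"
      using LIMSEQ_le_const[of "\<lambda>k. ?\<delta> + inverse (real (Suc k))" ?\<delta> "Inf ?S"] by auto
    have "?\<delta> \<le> Inf ?S"
    proof (cases "0 < ?\<delta>")
      case True
      have "?\<delta> * (1 - inverse (real (Suc (Suc k)))) \<le> Inf ?S" for k
      proof (rule cInf_greatest)
        show "?S \<noteq> {}" using mem by blast
        fix \<rho> assume \<rho>: "\<rho> \<in> ?S"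
        show "?\<delta> * (1 - inverse (real (Suc (Suc k)))) \<le> \<rho>"
        proof (rule ccontr)
          assume "\<not> ?thesis"
          then have "\<rho> \<le> ?\<delta> * (1 - inverse (real (Suc (Suc k))))" by linarith
          from elim(2)[THEN spec, THEN mp, OF True, THEN spec, THEN mp, THEN mp, OF _ this] \<rho> show False by blast
        qed
      qed
      moreover have "(\<lambda>k. ?\<delta> * (1 - inverse (real (Suc (Suc k))))) \<longlonglongrightarrow> ?\<delta> * (1 - 0)"
        by (intro tendsto_mult tendsto_diff tendsto_const LIMSEQ_Suc[OF LIMSEQ_inverse_real_of_nat])
      ultimately show ?thesis
        using LIMSEQ_le_const2[of "\<lambda>k. ?\<delta> * (1 - inverse (real (Suc (Suc k))))" ?\<delta> "Inf ?S"] by auto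
    next
      case False
      have "0 \<le> Inf ?S" by (rule cInf_greatest) (use mem in auto)
      then show ?thesis using False by linarith
    qed
    with le show ?case by (simp add: macro_hausdorff_dim_def)
  qed
qed

text \<open>The square of \<open>\<kappa>\<close> is sqrt(\<pi>/t), the inverse of the variance of
  Z(t,x); scaling by it turns the kernel estimates into the locale assumptions. Continuity in x is
  the slice of joint continuity at the fixed time t.\<close>

lemma linear_SHE_gaussian_field:
  fixes M :: "'w measure"
  assumes "prob_space M" "white_noise M \<xi>" "linear_SHE_solution M \<xi> Z" and t: "0 < t"
  defines "\<kappa> \<equiv> (pi / t) powr (1 / 4)"
  shows "gaussian_field M \<xi> (\<lambda>x z. \<kappa> * heat_integrand t x z) (\<lambda>x \<omega>. \<kappa> * Z t x \<omega>)
    (\<kappa>\<^sup>2 * (4 * t powr (1/4))) (\<kappa>\<^sup>2 * (2 * sqrt t)) t"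
proof -
  interpret white_noise_space M \<xi>
    using assms(1,2) by (simp add: white_noise_space_def white_noise_space_axioms_def)
  have \<kappa>: "0 < \<kappa>" using t by (simp add: \<kappa>_def)
  have \<kappa>2: "\<kappa>\<^sup>2 = sqrt (pi / t)"
    using t by (simp add: \<kappa>_def powr_powr powr_half_sqrt flip: powr_numeral)
  have scale: "(\<integral>\<^sup>+z. ennreal ((\<kappa> * h z)\<^sup>2) \<partial>lborel) = ennreal (\<kappa>\<^sup>2) * (\<integral>\<^sup>+z. ennreal ((h z)\<^sup>2) \<partial>lborel)"
    if [measurable]: "h \<in> borel_measurable borel" for h :: "real \<times> real \<Rightarrow> real"
    by (simp add: power_mult_distrib ennreal_mult nn_integral_cmult)
  show ?thesis
  proof (unfold_locales)
    fix x x' K :: real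
    have "wiener_integral M \<xi> (heat_integrand t x) (Z t x)"
      using assms(3) t by (simp add: linear_SHE_solution_def heat_integrand_def)
    then show "wiener_approx M \<xi> (\<lambda>z. \<kappa> * heat_integrand t x z) (\<lambda>\<omega>. \<kappa> * Z t x \<omega>)"
      by (intro wiener_approx_cmult wiener_integral_approx)
    have "ennreal (\<kappa>\<^sup>2) * ennreal (sqrt (t / pi)) = 1"
      using t by (simp add: \<kappa>2 ennreal_mult[symmetric] real_sqrt_mult[symmetric])
    then show "(\<integral>\<^sup>+z. ennreal ((\<kappa> * heat_integrand t x z)\<^sup>2) \<partial>lborel) = 1"
      by (simp add: scale heat_integrand_norm[OF t])
    have "(\<integral>\<^sup>+z. ennreal ((\<kappa> * (heat_integrand t x z - heat_integrand t x' z))\<^sup>2) \<partial>lborel)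
        \<le> ennreal (\<kappa>\<^sup>2) * ennreal (4 * t powr (1/4) * \<bar>x - x'\<bar> powr (1/2))"
      by (subst scale) (auto intro!: mult_left_mono heat_integrand_diff_norm t)
    then show "(\<integral>\<^sup>+z. ennreal ((\<kappa> * heat_integrand t x z - \<kappa> * heat_integrand t x' z)\<^sup>2) \<partial>lborel)
        \<le> ennreal (\<kappa>\<^sup>2 * (4 * t powr (1/4)) * \<bar>x - x'\<bar> powr (1/2))"
      by (simp add: right_diff_distrib ennreal_mult[symmetric] mult_ac)
    have [measurable]: "{z :: real \<times> real. \<bar>snd z - x\<bar> < K} \<in> sets borel"
      by (intro borel_open open_Collect_less continuous_intros)
    assume K: "0 \<le> K"
    have "(\<integral>\<^sup>+z. ennreal ((\<kappa> * (heat_integrand t x z * indicator (- {z. \<bar>snd z - x\<bar> < K}) z))\<^sup>2) \<partial>lborel)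
        \<le> ennreal (\<kappa>\<^sup>2) * ennreal (2 * sqrt t * exp (- K\<^sup>2 / (2 * t)))"
      by (subst scale, measurable) (intro mult_left_mono heat_integrand_cutoff_norm t K, simp)
    also have "\<dots> = ennreal (\<kappa>\<^sup>2 * (2 * sqrt t) * exp (- K\<^sup>2 / (2 * t)))"
      using t by (subst ennreal_mult[symmetric]) (auto simp: mult_ac)
    finally show "(\<integral>\<^sup>+z. ennreal ((\<kappa> * heat_integrand t x z * indicator (- {z. \<bar>snd z - x\<bar> < K}) z)\<^sup>2) \<partial>lborel)
        \<le> ennreal (\<kappa>\<^sup>2 * (2 * sqrt t) * exp (- K\<^sup>2 / (2 * t)))"
      by (simp only: mult.assoc)
  next
    have "AE \<omega> in M. continuous_on ({0..} \<times> UNIV) (\<lambda>(t, x). Z t x \<omega>)"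
      using assms(3) by (auto simp: linear_SHE_solution_def)
    then show "AE \<omega> in M. continuous_on UNIV (\<lambda>x. \<kappa> * Z t x \<omega>)"
    proof eventually_elim
      case (elim \<omega>)
      have "continuous_on UNIV ((\<lambda>(t, x). Z t x \<omega>) \<circ> (\<lambda>x. (t, x)))"
        by (rule continuous_on_compose) (use t in \<open>auto intro!: continuous_intros continuous_on_subset[OF elim]\<close>)
      then show ?case by (intro continuous_intros) (simp add: comp_def)
    qed
  qed (use \<kappa> t in auto)
qed

text \<open>On shell n + 1 the gauge lies between the thresholds of the upper and the lower bound.
  The maximum with e makes it positive everywhere, and since e \<le> exp(n + 1) the upper estimate
  survives it for every n.\<close>

lemma gauge_bounds:
  defines "g \<equiv> \<lambda>x. (2 * log_plus x) powr (1 / 2)"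
  shows "exp (real n) \<le> x \<Longrightarrow> sqrt (2 * real n) \<le> g x" "0 < g x"
    "x < exp (real (Suc n)) \<Longrightarrow> g x \<le> sqrt (2 * real (Suc n))"
proof -
  have pos: "0 < max y (exp 1 :: real)" for y by (simp add: less_max_iff_disj)
  have "ln (exp 1) \<le> ln (max x (exp 1))" for x :: real using pos by (subst ln_le_cancel_iff) auto
  then have lp: "1 \<le> log_plus x" for x by (simp add: log_plus_def)
  have g: "g x = sqrt (2 * log_plus x)" for x
    unfolding g_def using lp[of x] by (intro powr_half_sqrt) auto
  show "0 < g x" using lp[of x] by (simp add: g)
  show "sqrt (2 * real n) \<le> g x" if "exp (real n) \<le> x"
  proof -
    have "ln (exp (real n)) \<le> ln (max x (exp 1))" using that pos by (subst ln_le_cancel_iff) auto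
    then show ?thesis by (simp add: g log_plus_def)
  qed
  show "g x \<le> sqrt (2 * real (Suc n))" if "x < exp (real (Suc n))"
  proof -
    have "ln (max x (exp 1)) \<le> ln (exp (real (Suc n)))" using that pos by (subst ln_le_cancel_iff) auto
    then show ?thesis by (simp add: g log_plus_def)
  qed
qed

theorem theorem1p3:
  fixes M :: "'w measure"
    and \<xi> :: "(real \<times> real) set \<Rightarrow> 'w \<Rightarrow> real"
    and Z :: "real \<Rightarrow> real \<Rightarrow> 'w \<Rightarrow> real"
    and g :: "real \<Rightarrow> real"
    and X :: "real \<Rightarrow> real \<Rightarrow> 'w \<Rightarrow> real"
    and c\<^sub>0 :: real
  assumes "prob_space M"
    and "white_noise M \<xi>"
    and "linear_SHE_solution M \<xi> Z"
    and "c\<^sub>0 > 0"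
  defines "g \<equiv> (\<lambda>x. (2 * log_plus x) powr (1 / 2))"
    and "X \<equiv> (\<lambda>t x \<omega>. (pi / t) powr (1 / 4) * Z t x \<omega>)"
  shows "(\<forall>t>0. multifractal_peaks M c\<^sub>0 g (X t)) \<and>
    (\<forall>t>0. \<forall>\<gamma>>0.
       (0 \<le> 1 - \<gamma>\<^sup>2 \<longrightarrow>
          (AE \<omega> in M. macro_hausdorff_dim (tall_peaks c\<^sub>0 g (\<lambda>x. X t x \<omega>) \<gamma>) = 1 - \<gamma>\<^sup>2)) \<and>
       (1 - \<gamma>\<^sup>2 < 0 \<longrightarrow>
          (AE \<omega> in M. bounded (tall_peaks c\<^sub>0 g (\<lambda>x. X t x \<omega>) \<gamma>))))"
proof -
  have gb: "\<And>n x. exp (real n) \<le> x \<Longrightarrow> sqrt (2 * real n) \<le> g x" "\<And>x. 0 < g x"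
    "\<And>n x. x < exp (real (Suc n)) \<Longrightarrow> g x \<le> sqrt (2 * real (Suc n))"
    unfolding g_def by (fact gauge_bounds)+
  have dim: "AE \<omega> in M. macro_hausdorff_dim (tall_peaks c\<^sub>0 g (\<lambda>x. X t x \<omega>) \<gamma>) = 1 - \<gamma>\<^sup>2"
    if "0 < t" "0 < \<gamma>" "0 \<le> 1 - \<gamma>\<^sup>2" for t \<gamma>
    unfolding X_def
    by (rule gaussian_field.tall_peaks_dim[OF linear_SHE_gaussian_field[OF assms(1-3) that(1)]])
      (use that gb in auto)
  have bdd: "AE \<omega> in M. bounded (tall_peaks c\<^sub>0 g (\<lambda>x. X t x \<omega>) \<gamma>)"
    if "0 < t" "0 < \<gamma>" "1 - \<gamma>\<^sup>2 < 0" for t \<gamma>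
    unfolding X_def
  proof (rule gaussian_field.tall_peaks_bounded[OF linear_SHE_gaussian_field[OF assms(1-3) that(1)]])
    show "1 < \<gamma>"
      using that power_le_one[of \<gamma> 2] by (cases "\<gamma> \<le> 1") auto
  qed (use gb in auto)
  have "multifractal_peaks M c\<^sub>0 g (X t)" if t: "0 < t" for t
    unfolding multifractal_peaks_def
  \<comment> \<open>The scales 1/(i + 1) start at \<gamma> = 1, where the dimension is 0 and the
    formula still applies; below it 1 - \<gamma>^2 increases strictly as \<gamma> decreases.\<close>
  proof (intro exI[of _ "\<lambda>i. 1 / real (Suc i)"] conjI allI)
    show "1 / real (Suc (Suc i)) < 1 / real (Suc i)" "0 < 1 / real (Suc i)" for i
      by (auto simp: frac_less2)
    have "AE \<omega> in M. \<forall>i. macro_hausdorff_dim (tall_peaks c\<^sub>0 g (\<lambda>x. X t x \<omega>) (1 / real (Suc i))) = 1 - (1 / real (Suc i))\<^sup>2"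
      unfolding AE_all_countable
      by (intro allI dim t) (auto simp: power_le_one power_one_over divide_le_eq)
    then show "AE \<omega> in M. \<forall>i. macro_hausdorff_dim (tall_peaks c\<^sub>0 g (\<lambda>x. X t x \<omega>) (1 / real (Suc i)))
        < macro_hausdorff_dim (tall_peaks c\<^sub>0 g (\<lambda>x. X t x \<omega>) (1 / real (Suc (Suc i))))"
    proof eventually_elim
      case (elim \<omega>)
      have "(1 / real (Suc (Suc i)))\<^sup>2 < (1 / real (Suc i))\<^sup>2" for i
        by (intro power_strict_mono) (auto simp: frac_less2)
      then show ?case by (simp add: elim del: of_nat_Suc)
    qed
  qed
  with dim bdd show ?thesis by blast
qed

end
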